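(* Let $1\leq \beta <d$ be fixed. Then for all $\alpha$ satisfying $0<\alpha< 1$, there exists a positive constant $\delta_{\alpha,d}$ (depending only on $\alpha$ and $d$) such that for all $u_0 \in L^\infty(|x|\mathrm{d}x) \cap L^\infty(|x|^\beta\mathrm{d}x)$ with $\mathrm{div}(u_0) = 0$ satisfying $$\sup_{x \in \mathbb R^d,\, t>0}|x|^\alpha t^{\frac{1}{2}(1- \alpha)}|(e^{t\Delta}u_0)(x)|\leq \delta_{\alpha,d},$$ the Navier-Stokes equations have a global mild solution $u$ on $(0,\infty) \times \mathbb R^d$ with initial datum $u_0$ such that $$\sup_{x \in \mathbb R^d,\, t>0}\big(|x|+t^{\frac{1}{2}}\big)|u(x,t)| <+\infty$$ and $$\sup_{x \in \mathbb R^d,\, 0<t<T}|x|^\beta|u(x,t)| <+\infty\quad\text{for all } T \in (0, \infty).$$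
   Context: $d\ge 2$ is the space dimension; $u_0$ and $u(\cdot,t)$ are vector fields on $\mathbb R^d$ with $d$ components. For $\beta\ge 0$, $L^\infty(|x|^\beta\mathrm{d}x)$ denotes the space of measurable functions $u$ on $\mathbb R^d$ (scalar- or vector-valued) with $\|u\|_{L^\infty(|x|^\beta\mathrm{d}x)} := \operatorname{ess\,sup}_{x\in\mathbb R^d}|x|^\beta|u(x)|<+\infty$. The heat semigroup is $e^{t\Delta}u(x)=\int_{\mathbb R^d}(4\pi t)^{-d/2}e^{-|x-y|^2/(4t)}u(y)\,\mathrm{d}y$, acting componentwise. The Navier-Stokes equations are $\partial_t u=\Delta u-\nabla\cdot(u\otimes u)-\nabla p$, $\nabla\cdot u=0$, $u(0,x)=u_0$. A mild solution on $[0,T]$ (global if $T=\infty$) with divergence-free initial datum $u_0$ is a $u$ solving the integral equation $$u(t)=e^{t\Delta}u_0-\int_0^t e^{(t-\tau)\Delta}\mathbb P\nabla\cdot\big(u(\tau,\cdot)\otimes u(\tau,\cdot)\big)\,\mathrm{d}\tau .$$ Here $(u\otimes v)_{ij}=u_iv_j$, $(\nabla\cdot F)_i=\sum_{j=1}^d\partial_jF_{ij}$ for a tensor $F=(F_{ij})$, and $\mathbb P$ is the Helmholtz-Leray projection $(\mathbb Pf)_j=f_j+\sum_{k=1}^dR_jR_kf_k$, with Riesz transforms $\widehat{R_jg}(\xi)=\frac{i\xi_j}{|\xi|}\hat g(\xi)$. The operator $e^{t\Delta}\mathbb P\nabla\cdot$ acts by convolution with its (integrable, for $t>0$) kernel,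 whose Fourier symbol is given by $(e^{t\Delta}\mathbb P\nabla\cdot F)^{\wedge}_j(\xi)=\sum_{k,l}e^{-t|\xi|^2}\big(\delta_{jk}-\tfrac{\xi_j\xi_k}{|\xi|^2}\big)i\xi_l\hat F_{kl}(\xi)$. *)

theory Defs
  imports "HOL-Analysis.Analysis" "HOL-Probability.Essential_Supremum"
begin

section \<open>Weighted spaces\<close>

definition weighted_Linf_norm :: "real \<Rightarrow> (real^'n \<Rightarrow> 'b::euclidean_space) \<Rightarrow> ereal" where
  "weighted_Linf_norm \<beta> u = esssup lebesgue (\<lambda>x. ereal (norm x powr \<beta> * norm (u x)))"

definition weighted_Linf :: "real \<Rightarrow> (real^'n \<Rightarrow> 'b::euclidean_space) set" where
  "weighted_Linf \<beta> = {u \<in> borel_measurable lebesgue. weighted_Linf_norm \<beta> u < \<infinity>}"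

section \<open>Divergence-free fields\<close>

definition partial :: "'n \<Rightarrow> (real^'n \<Rightarrow> real) \<Rightarrow> real^'n \<Rightarrow> real" where
  "partial i f x = frechet_derivative f (at x) (axis i 1)"

text \<open>If all iterated partial derivatives are differentiable, they are in particular
  continuous, so this is the class of C-infinity functions.\<close>

definition smooth :: "(real^'n \<Rightarrow> real) \<Rightarrow> bool" where
  "smooth f \<longleftrightarrow> (\<forall>is. foldr partial is f differentiable_on UNIV)"

definition test_function :: "(real^'n \<Rightarrow> real) \<Rightarrow> bool" where
  "test_function \<phi> \<longleftrightarrow> smooth \<phi> \<and> compact (closure {x. \<phi> x \<noteq> 0})"

text \<open>The divergence is taken in the sense of distributions; this is meant for locally
  integrable fields (in dimension at least 2, every field in \<^term>\<open>weighted_Linf 1\<close> is one).\<close>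

definition divergence_free :: "(real^'n \<Rightarrow> real^'n) \<Rightarrow> bool" where
  "divergence_free u \<longleftrightarrow>
    (\<forall>\<phi>. test_function \<phi> \<longrightarrow> (LINT x|lebesgue. (\<Sum>i\<in>UNIV. u x $ i * partial i \<phi> x)) = 0)"

section \<open>The heat semigroup\<close>

definition heat_kernel :: "real \<Rightarrow> real^'n \<Rightarrow> real" where
  "heat_kernel t z = (4 * pi * t) powr (- (real CARD('n) / 2)) * exp (- (norm z)\<^sup>2 / (4 * t))"

definition heat :: "real \<Rightarrow> (real^'n \<Rightarrow> real^'n) \<Rightarrow> real^'n \<Rightarrow> real^'n" where
  "heat t u x = (LINT y|lebesgue. heat_kernel t (x - y) *\<^sub>R u y)"

section \<open>The heat semigroup composed with the Leray projection and the divergence\<close>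

definition oseen_symbol :: "real \<Rightarrow> 'n \<Rightarrow> 'n \<Rightarrow> 'n \<Rightarrow> real^'n \<Rightarrow> complex" where
  "oseen_symbol t j k l \<xi> =
    complex_of_real (exp (- t * (norm \<xi>)\<^sup>2)
      * ((if j = k then 1 else 0) - \<xi> $ j * \<xi> $ k / (norm \<xi>)\<^sup>2))
    * (\<i> * complex_of_real (\<xi> $ l))"

text \<open>The kernel is the inverse Fourier transform of the symbol. The convention is that the
  Fourier transform of \<open>f\<close> at \<open>\<xi>\<close> is the integral of \<open>exp (- \<i> (x \<bullet> \<xi>)) f x\<close> over \<open>x\<close>, under which
  the partial derivative in direction \<open>l\<close> has symbol \<open>\<i> \<xi>\<^sub>l\<close> and convolution becomes multiplication.
  For \<open>t > 0\<close> the integral below converges absolutely, and it is real because the symbol is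
  \<open>\<i>\<close> times an odd real function, so that \<^const>\<open>Re\<close> only changes the type.\<close>

definition oseen_kernel :: "real \<Rightarrow> 'n \<Rightarrow> 'n \<Rightarrow> 'n \<Rightarrow> real^'n \<Rightarrow> real" where
  "oseen_kernel t j k l x =
    Re (LINT \<xi>|lebesgue. exp (\<i> * complex_of_real (x \<bullet> \<xi>)) * oseen_symbol t j k l \<xi>)
      / (2 * pi) ^ CARD('n)"

definition tensor :: "real^'n \<Rightarrow> real^'n \<Rightarrow> real^'n^'n" where
  "tensor u v = (\<chi> i j. u $ i * v $ j)"

definition oseen :: "real \<Rightarrow> (real^'n \<Rightarrow> real^'n^'n) \<Rightarrow> real^'n \<Rightarrow> real^'n" where
  "oseen t F x =
    (\<chi> j. \<Sum>k\<in>UNIV. \<Sum>l\<in>UNIV. LINT y|lebesgue. oseen_kernel t j k l (x - y) * F y $ k $ l)"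

definition oseen_converges :: "real \<Rightarrow> (real^'n \<Rightarrow> real^'n^'n) \<Rightarrow> real^'n \<Rightarrow> bool" where
  "oseen_converges t F x \<longleftrightarrow>
    (\<forall>j k l. integrable lebesgue (\<lambda>y. oseen_kernel t j k l (x - y) * F y $ k $ l))"

section \<open>Mild solutions\<close>

text \<open>Solutions are represented by their pointwise defined version, for which the integral equation
  holds at every point. The convergence of all integrals is part of the notion, since the Bochner
  integral is 0 by convention on functions that are not integrable. The equation is imposed for
  positive times and complemented by \<open>u 0 = u0\<close>, because the formula for the heat
  semigroup only makes sense for \<open>t > 0\<close>.\<close>

definition mild_solution ::
  "ereal \<Rightarrow> (real^'n \<Rightarrow> real^'n) \<Rightarrow> (real \<Rightarrow> real^'n \<Rightarrow> real^'n) \<Rightarrow> bool" where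
  "mild_solution T u0 u \<longleftrightarrow>
    u 0 = u0 \<and>
    (\<lambda>(t, x). u t x) \<in> borel_measurable (lebesgue_on ({t. 0 < t \<and> ereal t \<le> T} \<times> UNIV)) \<and>
    (\<forall>t x. 0 < t \<and> ereal t \<le> T \<longrightarrow>
      integrable lebesgue (\<lambda>y. heat_kernel t (x - y) *\<^sub>R u0 y) \<and>
      (\<forall>\<tau>\<in>{0<..<t}. oseen_converges (t - \<tau>) (\<lambda>y. tensor (u \<tau> y) (u \<tau> y)) x) \<and>
      set_integrable lebesgue {0<..<t}
        (\<lambda>\<tau>. oseen (t - \<tau>) (\<lambda>y. tensor (u \<tau> y) (u \<tau> y)) x) \<and>
      u t x = heat t u0 x
        - (LINT \<tau>:{0<..<t}|lebesgue. oseen (t - \<tau>) (\<lambda>y. tensor (u \<tau> y) (u \<tau> y)) x))"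

end

theory Submission
  imports Defs "HOL-Probability.Characteristic_Functions" "HOL-Real_Asymp.Real_Asymp"
begin

text \<open>All estimates rest on one kernel profile,
  \<open>P t z = t powr (1/4) * (sqrt t + |z|) powr - (d + 1/2)\<close>: the heat kernel is at most
  \<open>C * P t\<close> and the Oseen kernel at most \<open>C * t powr - (1/2) * P t\<close>. For \<open>0 \<le> \<gamma> < d\<close> the convolution
  of \<open>P t\<close> with \<open>|y| powr - \<gamma>\<close> is bounded by \<open>t powr - (\<gamma>/2)\<close> and by \<open>|x| powr - \<gamma>\<close>, hence by every
  product of powers in between. In the time variable only Beta integrals remain.

  The Picard iterates stay small in the norm with weight \<open>|x| powr \<alpha> * t powr ((1 - \<alpha>)/2)\<close>. Estimating one
  factor of \<open>u \<otimes> u\<close> in that norm makes the Duhamel term a contraction both for the weight \<open>|x|\<close>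
  and for the weight \<open>sqrt t\<close>, with a constant that depends only on \<open>\<alpha>\<close> and \<open>d\<close>. The last
  weight also covers \<open>x = 0\<close>, where the weights in \<open>|x|\<close> say nothing. The weight \<open>|x| powr \<beta>\<close>
  is reached afterwards, for bounded times, by repeatedly doubling the exponent of the decay at infinity.\<close>

section \<open>Fourier transforms of Gaussians with polynomial factors\<close>

text \<open>The order of the two stages is forced by \<beta>. One factor weighted by
  \<open>|x| powr \<beta>\<close> and one in the small norm would give a product of spatial order
  \<beta> + \<alpha>, possibly beyond d, where local integrability at the origin fails. The fixed
  point therefore uses only the orders 2\<alpha>, 1 + \<alpha> and \<alpha>, all below 2 and hence
  below d, and its smallness constant is fixed before \<beta> appears. Improving the decay of a
  solution already found needs no smallness, so those constants may depend on \<beta>, on the time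
  and on the data.

  In the small norm the time integral has the exponents (1 + \<alpha>)/2 at the end \<open>t\<close>
  and 1 - \<alpha> at the end 0; it converges exactly for 0 < \<alpha> < 1.

  On the kernel side the obstacle is the factor 1/|\<xi>|^2 of the Leray projection, which does not
  split into coordinates. Each Gaussian in its superposition does, and everything reduces to Fourier
  integrals in one variable, whose monomial factors are handled by a recursion.\<close>

definition gauss_fourier :: "nat \<Rightarrow> real \<Rightarrow> real \<Rightarrow> complex" where
  "gauss_fourier m s x = (LINT r|lborel. exp (\<i> * of_real (x * r)) * of_real (r ^ m * exp (- s * r\<^sup>2)))"

lemma integrable_power_gauss:
  fixes s :: real
  assumes "s > 0"
  shows "integrable lborel (\<lambda>r. r ^ m * exp (- s * r\<^sup>2))"
proof -
  \<comment> \<open>The standard deviation for which the normal density is a multiple of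
    \<open>exp (- s * r\<^sup>2)\<close>; the claim becomes the existence of normal moments.\<close>
  define \<sigma> where "\<sigma> = 1 / sqrt (2 * s)"
  have \<sigma>: "\<sigma> > 0" "\<sigma>\<^sup>2 = 1 / (2 * s)"
    using assms by (auto simp: \<sigma>_def power_divide)
  have "integrable lborel (\<lambda>r. sqrt (2 * pi * \<sigma>\<^sup>2) * (normal_density 0 \<sigma> r * (r - 0) ^ m))"
    using \<sigma> by (intro integrable_mult_right integrable_normal_moment)
  also have "(\<lambda>r. sqrt (2 * pi * \<sigma>\<^sup>2) * (normal_density 0 \<sigma> r * (r - 0) ^ m)) = (\<lambda>r. r ^ m * exp (- s * r\<^sup>2))"
    using \<sigma> assms by (auto simp: normal_density_def fun_eq_iff)
  finally show ?thesis .
qed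

lemma integrable_gauss_fourier:
  assumes "s > 0"
  shows "integrable lborel (\<lambda>r. exp (\<i> * of_real (x * r)) * of_real (r ^ m * exp (- s * r\<^sup>2)) :: complex)"
  by (rule Bochner_Integration.integrable_bound[OF integrable_power_gauss[OF assms, of m]])
     (auto simp: norm_mult norm_power abs_mult power_abs)

text \<open>Rescaling the variable by \<open>c = 1 / sqrt (2 * s)\<close> turns the Gaussian into
  the standard normal density up to \<open>sqrt (2 * pi)\<close>, so the value is read off from the
  characteristic function at \<open>x * c\<close>.\<close>

lemma norm_gauss_fourier_0:
  assumes "s > 0"
  shows "norm (gauss_fourier 0 s x) = sqrt (pi / s) * exp (- x\<^sup>2 / (4 * s))"
proof -
  define c where "c = 1 / sqrt (2 * s)"
  have c: "c > 0" "c\<^sup>2 = 1 / (2 * s)"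
    using assms by (auto simp: c_def power_divide)
  have "gauss_fourier 0 s x = c *\<^sub>R (LINT r|lborel. exp (\<i> * of_real (x * (0 + c * r))) * of_real (exp (- s * (0 + c * r)\<^sup>2)))"
    unfolding gauss_fourier_def using c
    by (subst lborel_integral_real_affine[where c = c and t = 0]) auto
  also have "(LINT r|lborel. exp (\<i> * of_real (x * (0 + c * r))) * of_real (exp (- s * (0 + c * r)\<^sup>2)))
     = (LINT r|lborel. sqrt (2 * pi) *\<^sub>R (std_normal_density r *\<^sub>R iexp (x * c * r)))"
    using c assms by (intro Bochner_Integration.integral_cong)
      (auto simp: std_normal_density_def power_mult_distrib scaleR_conv_of_real ac_simps)
  also have "\<dots> = sqrt (2 * pi) *\<^sub>R (LINT r|lborel. std_normal_density r *\<^sub>R iexp (x * c * r))"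
    by (rule integral_scaleR_right)
  also have "(LINT r|lborel. std_normal_density r *\<^sub>R iexp (x * c * r)) = char std_normal_distribution (x * c)"
    unfolding char_def by (subst integral_density) (auto simp: normal_density_nonneg)
  also have "char std_normal_distribution (x * c) = complex_of_real (exp (- ((x * c)\<^sup>2) / 2))"
    by (simp only: char_std_normal_distribution)
  finally have "norm (gauss_fourier 0 s x) = c * sqrt (2 * pi) * exp (- ((x * c)\<^sup>2) / 2)"
    using c by (simp add: norm_mult)
  also have "c * sqrt (2 * pi) = sqrt (pi / s)"
    using assms by (simp add: c_def real_sqrt_divide real_sqrt_mult)
  also have "- ((x * c)\<^sup>2) / 2 = - x\<^sup>2 / (4 * s)"
    using c by (simp add: power_mult_distrib)
  finally show ?thesis by simp
qed

lemma tendsto_power_gauss: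
  fixes s :: real
  assumes "s > 0"
  shows "((\<lambda>r. r ^ m * exp (- s * r\<^sup>2)) \<longlongrightarrow> 0) at_top"
    and "((\<lambda>r. r ^ m * exp (- s * r\<^sup>2)) \<longlongrightarrow> 0) at_bot"
proof -
  show *: "((\<lambda>r. r ^ m * exp (- s * r\<^sup>2)) \<longlongrightarrow> 0) at_top"
    using assms by real_asymp
  have "((\<lambda>r. (-1) ^ m * (r ^ m * exp (- s * r\<^sup>2))) \<longlongrightarrow> (-1) ^ m * 0) at_top"
    by (intro tendsto_mult * tendsto_const)
  also have "(\<lambda>r::real. (-1) ^ m * (r ^ m * exp (- s * r\<^sup>2))) = (\<lambda>r. (- r) ^ m * exp (- s * (- r)\<^sup>2))"
    by (intro ext, subst (2) power_minus) simp
  finally show "((\<lambda>r. r ^ m * exp (- s * r\<^sup>2)) \<longlongrightarrow> 0) at_bot"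
    by (subst filterlim_at_bot_mirror) simp
qed

text \<open>Integration by parts: \<open>?F'\<close> is the derivative of the integrand of exponent
  \<open>m\<close>, which vanishes at both infinities, so \<open>?F'\<close> has integral 0. The
  truncated \<open>m - 1\<close> at \<open>m = 0\<close> is harmless because its coefficient is
  \<open>of_nat m\<close>.\<close>

lemma gauss_fourier_Suc:
  assumes s: "s > 0"
  shows "of_real (2 * s) * gauss_fourier (Suc m) s x =
    of_nat m * gauss_fourier (m - 1) s x + \<i> * of_real x * gauss_fourier m s x"
proof -
  let ?e = "\<lambda>m r. exp (\<i> * of_real (x * r)) * of_real (r ^ m * exp (- s * r\<^sup>2)) :: complex"
  let ?F' = "\<lambda>r. \<i> * of_real x * ?e m r + (of_nat m * ?e (m - 1) r - 2 * of_real s * ?e (Suc m) r)"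
  have int: "integrable lborel (?e m)" for m
    using s by (rule integrable_gauss_fourier)
  have F: "(?e m has_vector_derivative ?F' r) (at r)" for r
  proof -
    have 1: "((\<lambda>r. exp (\<i> * of_real (x * r))) has_vector_derivative \<i> * of_real x * exp (\<i> * of_real (x * r))) (at r)"
      unfolding of_real_mult
      by (rule has_vector_derivative_real_field) (auto intro!: derivative_eq_intros)
    have "((\<lambda>r. r ^ m * exp (- s * r\<^sup>2)) has_real_derivative
        (of_nat m * (r ^ (m - 1) * exp (- s * r\<^sup>2)) - 2 * s * (r ^ Suc m * exp (- s * r\<^sup>2)))) (at r)"
      by (auto intro!: derivative_eq_intros simp: field_simps)
    then have 2: "((\<lambda>r. of_real (r ^ m * exp (- s * r\<^sup>2)) :: complex) has_vector_derivative
        of_real (of_nat m * (r ^ (m - 1) * exp (- s * r\<^sup>2)) - 2 * s * (r ^ Suc m * exp (- s * r\<^sup>2)))) (at r)"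
      by (intro has_vector_derivative_of_real) (simp add: has_real_derivative_iff_has_vector_derivative)
    show ?thesis
      by (rule has_vector_derivative_eq_rhs[OF has_vector_derivative_mult[OF 1 2]])
         (simp add: algebra_simps)
  qed
  have tends: "(?e m \<longlongrightarrow> 0) at_top" "(?e m \<longlongrightarrow> 0) at_bot"
    by (rule tendsto_norm_zero_cancel; use tendsto_power_gauss[OF s, THEN tendsto_norm_zero, of m]
        in \<open>simp add: norm_mult norm_power abs_mult power_abs\<close>)+
  have intF': "integrable lborel ?F'"
    by (intro Bochner_Integration.integrable_add Bochner_Integration.integrable_diff integrable_mult_right int)
  have "(LBINT r=-\<infinity>..\<infinity>. ?F' r) = 0 - 0"
  proof (rule interval_integral_FTC_integrable[OF _ F])
    show "isCont ?F' r" for r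
      by (intro continuous_intros)
    show "set_integrable lborel (einterval (- \<infinity>) \<infinity>) ?F'"
      using intF' by (simp add: set_integrable_def)
    show "((?e m \<circ> real_of_ereal) \<longlongrightarrow> 0) (at_right (- \<infinity>))" "((?e m \<circ> real_of_ereal) \<longlongrightarrow> 0) (at_left \<infinity>)"
      using tends by (simp_all only: ereal_tendsto_simps)
  qed simp
  then have "(LINT r|lborel. ?F' r) = 0"
    by (simp add: interval_lebesgue_integral_def set_lebesgue_integral_def)
  also have "(LINT r|lborel. ?F' r) = \<i> * of_real x * gauss_fourier m s x +
      (of_nat m * gauss_fourier (m - 1) s x - 2 * of_real s * gauss_fourier (Suc m) s x)"
  proof (rule has_bochner_integral_integral_eq)
    have "has_bochner_integral lborel (?e m) (gauss_fourier m s x)" for m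
      using int[of m] unfolding gauss_fourier_def by (rule has_bochner_integral_integrable)
    then show "has_bochner_integral lborel ?F' (\<i> * of_real x * gauss_fourier m s x +
      (of_nat m * gauss_fourier (m - 1) s x - 2 * of_real s * gauss_fourier (Suc m) s x))"
      by (intro has_bochner_integral_add has_bochner_integral_diff has_bochner_integral_mult_right)
  qed
  finally show ?thesis
    by (simp add: algebra_simps)
qed

text \<open>The recursion refers to two predecessors, hence the strong induction. Each monomial
  factor costs \<open>s powr (- (1/2))\<close> and at most one power of
  \<open>1 + \<bar>x\<bar> / sqrt s\<close>, while the Gaussian factor is kept in full.\<close>

lemma norm_gauss_fourier_le:
  "\<exists>C>0. \<forall>s>0. \<forall>x. norm (gauss_fourier m s x)
     \<le> C * s powr (- (real m + 1) / 2) * (1 + \<bar>x\<bar> / sqrt s) ^ m * exp (- x\<^sup>2 / (4 * s))"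
proof (induction m rule: less_induct)
  case (less m)
  show ?case
  proof (cases m)
    case 0
    have "norm (gauss_fourier 0 s x) \<le> sqrt pi * s powr (-1/2) * exp (- x\<^sup>2 / (4 * s))" if "s > 0" for s x
      using that by (subst norm_gauss_fourier_0) (auto simp: powr_minus powr_half_sqrt real_sqrt_divide field_simps)
    then show ?thesis using 0 by (intro exI[of _ "sqrt pi"]) auto
  next
    case (Suc k)
    obtain C where C: "C > 0" "\<And>s x. s > 0 \<Longrightarrow> norm (gauss_fourier k s x)
        \<le> C * s powr (- (real k + 1) / 2) * (1 + \<bar>x\<bar> / sqrt s) ^ k * exp (- x\<^sup>2 / (4 * s))"
      using less[of k] Suc by blast
    obtain C' where C': "C' > 0" "\<And>s x. s > 0 \<Longrightarrow> norm (gauss_fourier (k - 1) s x)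
        \<le> C' * s powr (- (real (k - 1) + 1) / 2) * (1 + \<bar>x\<bar> / sqrt s) ^ (k - 1) * exp (- x\<^sup>2 / (4 * s))"
      using less[of "k - 1"] Suc by (metis diff_le_self le_imp_less_Suc)
    have "norm (gauss_fourier (Suc k) s x) \<le> (C + real k * C') * s powr (- (real (Suc k) + 1) / 2)
            * (1 + \<bar>x\<bar> / sqrt s) ^ Suc k * exp (- x\<^sup>2 / (4 * s))" if s: "s > 0" for s x
    proof -
      define r where "r = 1 + \<bar>x\<bar> / sqrt s"
      define e where "e = exp (- x\<^sup>2 / (4 * s))"
      define q where "q = s powr (- (real (Suc k) + 1) / 2)"
      have r: "r \<ge> 1" "\<bar>x\<bar> / sqrt s \<le> r" using s by (auto simp: r_def)
      have e: "e > 0" "q > 0" using s by (auto simp: e_def q_def)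
      have "2 * s * norm (gauss_fourier (Suc k) s x) = norm (of_real (2 * s) * gauss_fourier (Suc k) s x)"
        using s by (simp add: norm_mult)
      also have "\<dots> \<le> real k * norm (gauss_fourier (k - 1) s x) + \<bar>x\<bar> * norm (gauss_fourier k s x)"
        unfolding gauss_fourier_Suc[OF s] by (rule order_trans[OF norm_triangle_ineq]) (simp add: norm_mult)
      also have "real k * norm (gauss_fourier (k - 1) s x) \<le> real k * C' * s * q * r ^ Suc k * e"
      \<comment> \<open>For \<open>k = 0\<close> the truncated \<open>k - 1\<close> would carry the
        wrong power of \<open>s\<close>, but then the coefficient \<open>real k\<close>
        vanishes.\<close>
      proof (cases k)
        case (Suc j)
        have "norm (gauss_fourier (k - 1) s x) \<le> C' * s powr (- (real (k - 1) + 1) / 2) * r ^ (k - 1) * e"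
          using C'(2)[OF s] by (simp add: r_def e_def)
        also have "s powr (- (real (k - 1) + 1) / 2) = s powr (1 + - (real (Suc k) + 1) / 2)"
          using Suc by (simp add: field_simps)
        also have "\<dots> = s * q" unfolding q_def powr_add using s by simp
        also have "C' * (s * q) * r ^ (k - 1) * e \<le> C' * (s * q) * r ^ Suc k * e"
          using C' e s r by (intro mult_right_mono mult_left_mono power_increasing) auto
        finally show ?thesis by (simp add: mult.assoc mult_left_mono)
      qed auto
      also have "\<bar>x\<bar> * norm (gauss_fourier k s x) \<le> C * s * q * r ^ Suc k * e"
      proof -
        have "\<bar>x\<bar> * norm (gauss_fourier k s x) \<le> \<bar>x\<bar> * (C * s powr (- (real k + 1) / 2) * r ^ k * e)"
          using C(2)[OF s] by (intro mult_left_mono) (simp_all add: r_def e_def)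
        also have "s powr (- (real k + 1) / 2) = s powr (1 - 1/2 + - (real (Suc k) + 1) / 2)"
          by (simp add: field_simps)
        also have "\<dots> = s * q / sqrt s" unfolding q_def powr_add powr_diff using s by (simp add: powr_half_sqrt)
        also have "\<bar>x\<bar> * (C * (s * q / sqrt s) * r ^ k * e) = (\<bar>x\<bar> / sqrt s) * (C * s * q * r ^ k * e)"
          by simp
        also have "\<dots> \<le> r * (C * s * q * r ^ k * e)"
          using C e s r by (intro mult_right_mono) auto
        finally show ?thesis by (simp add: mult_ac)
      qed
      finally have "2 * s * norm (gauss_fourier (Suc k) s x) \<le> s * ((C + real k * C') * q * r ^ Suc k * e)"
        by (simp add: algebra_simps)
      then have "2 * norm (gauss_fourier (Suc k) s x) \<le> (C + real k * C') * q * r ^ Suc k * e"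
        using s by (simp add: mult.assoc mult.left_commute)
      moreover have "0 \<le> norm (gauss_fourier (Suc k) s x)" by simp
      ultimately have "norm (gauss_fourier (Suc k) s x) \<le> (C + real k * C') * q * r ^ Suc k * e"
        by linarith
      then show ?thesis by (simp only: r_def e_def q_def)
    qed
    moreover have "C + real k * C' > 0" using C C' by (simp add: add_pos_nonneg)
    ultimately show ?thesis unfolding Suc by blast
  qed
qed

section \<open>From one variable to all coordinates\<close>

lemma axis_index_axis_1: "axis_index (axis i 1 :: real^'n) = i"
  unfolding axis_index_def by (simp add: axis_eq_axis)

lemma prod_Basis_vec:
  fixes g :: "real^'n \<Rightarrow> 'b::comm_monoid_mult"
  shows "(\<Prod>b\<in>Basis. g b) = (\<Prod>i\<in>UNIV. g (axis i 1))"
proof -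
  have eq: "(Basis :: (real^'n) set) = range (\<lambda>i. axis i 1)"
    by (auto simp: Basis_vec_def)
  have inj: "inj (\<lambda>i. axis i 1 :: real^'n)"
    by (auto simp: inj_def axis_eq_axis)
  show ?thesis
    unfolding eq by (subst prod.reindex[OF inj]) simp
qed

text \<open>Fubini over the coordinates. By \<open>lborel_eq\<close> the measure is the image of a
  product measure indexed by \<open>Basis\<close>, so coordinate indices are exchanged for basis
  vectors by means of \<open>axis_index\<close>.\<close>

lemma integral_lborel_prod_vec:
  fixes f :: "'n::finite \<Rightarrow> real \<Rightarrow> complex"
  assumes f: "\<And>i. integrable lborel (f i)"
  shows "integrable lborel (\<lambda>x::real^'n. \<Prod>i\<in>UNIV. f i (x $ i))"
    and "(LINT x|lborel. (\<Prod>i\<in>UNIV. f i ((x::real^'n) $ i))) = (\<Prod>i\<in>UNIV. LINT r|lborel. f i r)"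
proof -
  interpret P: product_sigma_finite "\<lambda>_::real^'n. lborel :: real measure" ..
  have [measurable]: "f i \<in> borel_measurable borel" for i
    using f[of i] by auto
  let ?g = "\<lambda>b::real^'n. f (axis_index b)"
  let ?T = "\<lambda>h. \<Sum>b\<in>Basis. h b *\<^sub>R (b :: real^'n)"
  have T: "?T \<in> (\<Pi>\<^sub>M b\<in>(Basis::(real^'n) set). lborel) \<rightarrow>\<^sub>M borel"
    by measurable
  have eq: "(\<Prod>i\<in>UNIV. f i (?T h $ i)) = (\<Prod>b\<in>Basis. ?g b (h b))" for h
    by (subst prod_Basis_vec) (simp add: axis_index_axis_1 cart_eq_inner_axis inner_sum_left_Basis)
  have int: "integrable (\<Pi>\<^sub>M b\<in>(Basis::(real^'n) set). lborel) (\<lambda>h. \<Prod>b\<in>Basis. ?g b (h b))"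
    by (intro P.product_integrable_prod f finite_Basis)
  show "integrable lborel (\<lambda>x::real^'n. \<Prod>i\<in>UNIV. f i (x $ i))"
    by (subst lborel_eq, subst integrable_distr_eq[OF T]) (simp_all only: eq int, measurable)
  have "(LINT x|lborel. (\<Prod>i\<in>UNIV. f i ((x::real^'n) $ i))) =
      (LINT h|(\<Pi>\<^sub>M b\<in>(Basis::(real^'n) set). lborel). (\<Prod>b\<in>Basis. ?g b (h b)))"
    by (subst lborel_eq, subst integral_distr[OF T]) (simp_all only: eq, measurable)
  also have "\<dots> = (\<Prod>b\<in>(Basis::(real^'n) set). LINT r|lborel. ?g b r)"
    by (intro P.product_integral_prod f finite_Basis)
  also have "\<dots> = (\<Prod>i\<in>UNIV. LINT r|lborel. f i r)"
    by (subst prod_Basis_vec) (simp add: axis_index_axis_1)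
  finally show "(LINT x|lborel. (\<Prod>i\<in>UNIV. f i ((x::real^'n) $ i))) = (\<Prod>i\<in>UNIV. LINT r|lborel. f i r)" .
qed

lemma nn_integral_lborel_prod_vec:
  fixes f :: "'n::finite \<Rightarrow> real \<Rightarrow> ennreal"
  assumes f[measurable]: "\<And>i. f i \<in> borel_measurable borel"
  shows "(\<integral>\<^sup>+x. (\<Prod>i\<in>UNIV. f i ((x::real^'n) $ i)) \<partial>lborel) = (\<Prod>i\<in>UNIV. \<integral>\<^sup>+r. f i r \<partial>lborel)"
proof -
  have "(\<integral>\<^sup>+x. (\<Prod>i\<in>UNIV. f i ((x::real^'n) $ i)) \<partial>lborel)
      = (\<integral>\<^sup>+x. (\<Prod>b\<in>Basis. f (axis_index b) ((x::real^'n) \<bullet> b)) \<partial>lborel)"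
    by (subst prod_Basis_vec) (simp add: axis_index_axis_1 cart_eq_inner_axis)
  also have "\<dots> = (\<Prod>b\<in>(Basis::(real^'n) set). \<integral>\<^sup>+r. f (axis_index b) r \<partial>lborel)"
    by (rule nn_integral_lborel_prod) auto
  also have "\<dots> = (\<Prod>i\<in>UNIV. \<integral>\<^sup>+r. f i r \<partial>lborel)"
    by (subst prod_Basis_vec) (simp add: axis_index_axis_1)
  finally show ?thesis .
qed

text \<open>For a multi-index \<open>m\<close>, the integral over \<open>\<xi>\<close> is, up to a
  power of \<open>\<i>\<close> and the factor \<open>(2 * pi) ^ CARD('n)\<close>, the corresponding
  partial derivative of the heat kernel at time \<open>s\<close>.\<close>

definition gauss_moment :: "('n::finite \<Rightarrow> nat) \<Rightarrow> real \<Rightarrow> real^'n \<Rightarrow> real^'n \<Rightarrow> complex" where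
  "gauss_moment m s x \<xi> =
    exp (\<i> * of_real (x \<bullet> \<xi>)) * of_real ((\<Prod>i\<in>UNIV. (\<xi> $ i) ^ m i) * exp (- s * (norm \<xi>)\<^sup>2))"

lemma norm_power2_vec: "(norm (x::real^'n))\<^sup>2 = (\<Sum>i\<in>UNIV. (x $ i)\<^sup>2)"
  by (simp add: norm_vec_def L2_set_def sum_nonneg)

lemma gauss_moment_eq_prod:
  "gauss_moment m s x \<xi> =
    (\<Prod>i\<in>UNIV. exp (\<i> * of_real (x $ i * \<xi> $ i)) * of_real ((\<xi> $ i) ^ m i * exp (- s * (\<xi> $ i)\<^sup>2)))"
  unfolding gauss_moment_def
  by (simp add: norm_power2_vec inner_vec_def prod.distrib exp_sum sum_distrib_left sum_negf[symmetric])

text \<open>Joint in \<open>s\<close>, \<open>x\<close> and \<open>\<xi>\<close>, because the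
  integrals over \<open>s\<close> and \<open>\<xi>\<close> get exchanged later.\<close>

lemma measurable_gauss_moment [measurable]:
  "(\<lambda>p. gauss_moment m (fst p) (fst (snd p)) (snd (snd p))) \<in> borel_measurable (borel \<Otimes>\<^sub>M (borel \<Otimes>\<^sub>M borel))"
  unfolding gauss_moment_def cart_eq_inner_axis by measurable

lemma integrable_gauss_moment:
  assumes "s > 0"
  shows "integrable lborel (gauss_moment m s x)"
  unfolding gauss_moment_eq_prod[abs_def]
  using assms by (intro integral_lborel_prod_vec integrable_gauss_fourier)

text \<open>Combines \<open>1 + r \<le> exp r\<close> with completing the square:
  \<open>r * q - r\<^sup>2 / 4 = q\<^sup>2 - (r / 2 - q)\<^sup>2\<close>.\<close>

lemma exp_square_le_powr:
  assumes "r \<ge> (0::real)" "q \<ge> 0"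
  shows "exp (- r\<^sup>2 / 4) \<le> exp (q\<^sup>2) * (1 + r) powr (- q)"
proof -
  have "(1 + r) powr q \<le> exp r powr q"
    using assms exp_ge_add_one_self[of r] by (intro powr_mono2) auto
  also have "\<dots> = exp (r * q)" by (simp add: exp_powr_real)
  finally have "(1 + r) powr q * exp (- r\<^sup>2 / 4) \<le> exp (r * q) * exp (- r\<^sup>2 / 4)"
    by (intro mult_right_mono) auto
  also have "\<dots> = exp (r * q + - r\<^sup>2 / 4)" by (simp only: exp_add)
  also have "\<dots> \<le> exp (q\<^sup>2)"
    using zero_le_power2[of "r / 2 - q"] by (simp add: power2_eq_square algebra_simps)
  finally show ?thesis using assms by (simp add: powr_minus field_simps)
qed

text \<open>The integral factorises over the coordinates, and the Gaussian absorbs the polynomial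
  factors. Hence every order of decay \<open>q\<close> is available, and the exponent of
  \<open>s\<close> counts dimension plus degree.\<close>

lemma norm_integral_gauss_moment_le:
  fixes m :: "'n::finite \<Rightarrow> nat"
  assumes "q \<ge> 0"
  shows "\<exists>C>0. \<forall>s>0. \<forall>x::real^'n. norm (LINT \<xi>|lborel. gauss_moment m s x \<xi>)
     \<le> C * s powr (- (real CARD('n) + real (sum m UNIV)) / 2) * (1 + norm x / sqrt s) powr (- q)"
proof -
  obtain C where C: "\<And>i. C i > 0" "\<And>i s x. s > 0 \<Longrightarrow> norm (gauss_fourier (m i) s x)
     \<le> C i * s powr (- (real (m i) + 1) / 2) * (1 + \<bar>x\<bar> / sqrt s) ^ m i * exp (- x\<^sup>2 / (4 * s))"
    using norm_gauss_fourier_le[of "m _"] by metis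
  define M where "M = sum m UNIV"
  have "norm (LINT \<xi>|lborel. gauss_moment m s x \<xi>)
     \<le> (prod C UNIV * exp ((q + M)\<^sup>2)) * s powr (- (real CARD('n) + real M) / 2) * (1 + norm x / sqrt s) powr (- q)"
    if s: "s > 0" for s and x :: "real^'n"
  proof -
    define r where "r = norm x / sqrt s"
    have r: "r \<ge> 0" using s by (simp add: r_def)
    have "(LINT \<xi>|lborel. gauss_moment m s x \<xi>) = (\<Prod>i\<in>UNIV. gauss_fourier (m i) s (x $ i))"
      unfolding gauss_moment_eq_prod gauss_fourier_def
      using s by (intro integral_lborel_prod_vec integrable_gauss_fourier)
    then have "norm (LINT \<xi>|lborel. gauss_moment m s x \<xi>) = (\<Prod>i\<in>UNIV. norm (gauss_fourier (m i) s (x $ i)))"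
      by (simp add: prod_norm)
    also have "\<dots> \<le> (\<Prod>i\<in>UNIV. C i * s powr (- (real (m i) + 1) / 2) * (1 + \<bar>x $ i\<bar> / sqrt s) ^ m i * exp (- (x $ i)\<^sup>2 / (4 * s)))"
      using s by (intro prod_mono conjI C norm_ge_zero)
    also have "\<dots> \<le> (\<Prod>i\<in>UNIV. C i * s powr (- (real (m i) + 1) / 2) * (1 + r) ^ m i * exp (- (x $ i)\<^sup>2 / (4 * s)))"
      using s C(1) component_le_norm_cart[of x]
      by (intro prod_mono conjI mult_right_mono mult_left_mono power_mono)
         (auto simp: r_def divide_right_mono less_imp_le intro!: mult_nonneg_nonneg)
    also have "\<dots> = prod C UNIV * s powr (\<Sum>i\<in>UNIV. - (real (m i) + 1) / 2) * (1 + r) ^ M * exp (- r\<^sup>2 / 4)"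
    proof -
      have "(\<Prod>i\<in>UNIV. exp (- (x $ i)\<^sup>2 / (4 * s))) = exp (\<Sum>i\<in>UNIV. - (x $ i)\<^sup>2 / (4 * s))"
        by (simp add: exp_sum)
      also have "(\<Sum>i\<in>UNIV. - (x $ i)\<^sup>2 / (4 * s)) = - r\<^sup>2 / 4"
        using s by (simp add: r_def power_divide norm_power2_vec sum_negf sum_divide_distrib mult.commute)
      finally show ?thesis
        using s by (simp add: prod.distrib powr_sum power_sum M_def)
    qed
    also have "(\<Sum>i\<in>UNIV. - (real (m i) + 1) / 2) = - (real CARD('n) + real M) / 2"
      by (simp add: M_def sum_divide_distrib[symmetric] sum_negf sum.distrib sum_subtractf)
    \<comment> \<open>The order \<open>q + M\<close> is chosen so that \<open>M\<close> powers
      cancel \<open>(1 + r) ^ M\<close> and \<open>q\<close> remain.\<close>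
    also have "prod C UNIV * s powr (- (real CARD('n) + real M) / 2) * (1 + r) ^ M * exp (- r\<^sup>2 / 4)
      \<le> prod C UNIV * s powr (- (real CARD('n) + real M) / 2) * (1 + r) ^ M
          * (exp ((q + M)\<^sup>2) * (1 + r) powr (- (q + M)))"
      using r assms C(1) by (intro mult_left_mono exp_square_le_powr mult_nonneg_nonneg prod_nonneg) (auto intro: less_imp_le)
    also have "(1 + r) powr (- (q + M)) = (1 + r) powr (- q) / (1 + r) ^ M"
      using r by (simp add: powr_add[symmetric] powr_realpow[symmetric] powr_diff[symmetric])
    finally show ?thesis
      using r by (simp add: r_def mult_ac)
  qed
  moreover have "prod C UNIV * exp ((q + M)\<^sup>2) > 0" using C by (simp add: prod_pos)
  ultimately show ?thesis unfolding M_def by blast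
qed

section \<open>The decay of the heat and Oseen kernels\<close>

text \<open>Any exponent strictly between \<open>d\<close> and \<open>d + 1\<close> would do: above \<open>d\<close> the profile is integrable, and
  below \<open>d + 1\<close> the integral over \<open>s \<ge> t\<close> that represents the Oseen kernel converges after
  extracting the profile.\<close>

definition decay_profile :: "real \<Rightarrow> real^'n \<Rightarrow> real" where
  "decay_profile t z = t powr (1/4) * (sqrt t + norm z) powr - (real CARD('n) + 1/2)"

lemma decay_profile_nonneg: "0 \<le> decay_profile t z"
  by (simp add: decay_profile_def)

lemma one_plus_norm_powr:
  fixes x :: "'a::real_normed_vector"
  assumes "s > 0"
  shows "(1 + norm x / sqrt s) powr (- p) = s powr (p / 2) * (sqrt s + norm x) powr (- p)"
proof -
  have "1 + norm x / sqrt s = (sqrt s + norm x) / sqrt s"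
    using assms by (simp add: field_simps)
  also have "\<dots> powr (- p) = (sqrt s + norm x) powr (- p) / sqrt s powr (- p)"
    by (rule powr_divide)
  also have "sqrt s powr (- p) = s powr (- p / 2)"
    using assms by (simp add: powr_half_sqrt[symmetric] powr_powr)
  finally show ?thesis using assms by (simp add: powr_minus field_simps)
qed

text \<open>The self-similar form: an L1-preserving dilation by \<open>sqrt t\<close> of one fixed
  function.\<close>

lemma decay_profile_eq:
  fixes z :: "real^'n"
  assumes "t > 0"
  shows "decay_profile t z = t powr (- real CARD('n) / 2) * (1 + norm z / sqrt t) powr - (real CARD('n) + 1/2)"
proof -
  have "t powr (- real CARD('n) / 2) * t powr ((real CARD('n) + 1/2) / 2) = t powr (1/4)"
    by (simp add: powr_add[symmetric] field_simps)
  then show ?thesis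
    unfolding one_plus_norm_powr[OF assms] decay_profile_def by (simp add: mult.assoc[symmetric])
qed

lemma heat_kernel_nonneg: "0 \<le> heat_kernel t z"
  by (simp add: heat_kernel_def)

lemma heat_kernel_le_decay_profile:
  "\<exists>C>0. \<forall>t>0. \<forall>z::real^'n. heat_kernel t z \<le> C * decay_profile t z"
proof (intro exI conjI allI impI)
  let ?p = "real CARD('n) + 1/2"
  fix t :: real and z :: "real^'n" assume t: "t > 0"
  have "heat_kernel t z = (4 * pi) powr (- real CARD('n) / 2) * t powr (- real CARD('n) / 2) * exp (- (norm z / sqrt t)\<^sup>2 / 4)"
    using t by (simp add: heat_kernel_def powr_mult power_divide mult.commute)
  also have "\<dots> \<le> (4 * pi) powr (- real CARD('n) / 2) * t powr (- real CARD('n) / 2) * (exp (?p\<^sup>2) * (1 + norm z / sqrt t) powr (- ?p))"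
    using t by (intro mult_left_mono exp_square_le_powr) auto
  also have "\<dots> = ((4 * pi) powr (- real CARD('n) / 2) * exp (?p\<^sup>2)) * decay_profile t z"
    unfolding decay_profile_eq[OF t] by simp
  finally show "heat_kernel t z \<le> ((4 * pi) powr (- real CARD('n) / 2) * exp (?p\<^sup>2)) * decay_profile t z" .
qed simp

section \<open>The Oseen kernel as a superposition of Gaussian moments\<close>

lemma has_bochner_integral_exp_atLeast:
  fixes a t :: real
  assumes a: "a > 0"
  shows "has_bochner_integral lborel (\<lambda>s. indicator {t..} s * exp (- s * a)) (exp (- t * a) / a)"
proof -
  have "(\<integral>\<^sup>+s. ennreal (exp (- s * a)) * indicator {t..} s \<partial>lborel) = 0 - (- exp (- t * a) / a)"
  proof (rule nn_integral_FTC_atLeast[where F="\<lambda>s. - exp (- s * a) / a"])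
    show "((\<lambda>s. - exp (- s * a) / a) \<longlongrightarrow> 0) at_top"
      using a by real_asymp
  qed (use a in \<open>auto intro!: derivative_eq_intros\<close>)
  then have "(\<integral>\<^sup>+s. ennreal (indicator {t..} s * exp (- s * a)) \<partial>lborel) = ennreal (exp (- t * a) / a)"
    by (simp add: ennreal_mult' ennreal_indicator mult.commute)
  then show ?thesis
    using a by (intro has_bochner_integral_nn_integral) auto
qed

text \<open>The exponent 5/4 is \<open>(d + 3) / 2 - p / 2\<close> with \<open>p = d + 1/2\<close>:
  the size of a third-order derivative of the heat kernel after the decay of order \<open>p\<close>
  has been extracted.\<close>

lemma has_bochner_integral_powr_atLeast:
  fixes t :: real
  assumes t: "t > 0"
  shows "has_bochner_integral lborel (\<lambda>s. indicator {t..} s * s powr (- (5/4))) (4 * t powr (- (1/4)))"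
proof -
  have "(\<integral>\<^sup>+s. ennreal (s powr (- (5/4))) * indicator {t..} s \<partial>lborel) = ennreal (0 - (- 4 * t powr (- (1/4))))"
  proof (rule nn_integral_FTC_atLeast[where F="\<lambda>s. - 4 * s powr (- (1/4))"])
    show "((\<lambda>s::real. - 4 * s powr (- (1/4))) \<longlongrightarrow> 0) at_top"
      by real_asymp
    show "DERIV (\<lambda>s. - 4 * s powr (- (1/4))) s :> s powr (- (5/4))" if "t \<le> s" for s
      using that t by (auto intro!: derivative_eq_intros)
  qed auto
  then have "(\<integral>\<^sup>+s. ennreal (indicator {t..} s * s powr (- (5/4))) \<partial>lborel) = ennreal (4 * t powr (- (1/4)))"
    by (simp add: ennreal_mult' ennreal_indicator mult.commute)
  then show ?thesis
    by (intro has_bochner_integral_nn_integral) auto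
qed

text \<open>Multi-indices of \<open>\<xi> $ l\<close> and of
  \<open>\<xi> $ j * \<xi> $ k * \<xi> $ l\<close>; addition takes care of coinciding
  indices.\<close>

definition multi1 :: "'n \<Rightarrow> 'n \<Rightarrow> nat" where "multi1 l i = of_bool (i = l)"
definition multi3 :: "'n \<Rightarrow> 'n \<Rightarrow> 'n \<Rightarrow> 'n \<Rightarrow> nat" where
  "multi3 j k l i = multi1 j i + multi1 k i + multi1 l i"

lemma prod_power_multi1: "(\<Prod>i\<in>UNIV. ((\<xi>::real^'n) $ i) ^ multi1 l i) = \<xi> $ l"
proof -
  have "(\<Prod>i\<in>UNIV. (\<xi> $ i) ^ multi1 l i) = (\<Prod>i\<in>UNIV. if i = l then \<xi> $ i else 1)"
    by (intro prod.cong) (auto simp: multi1_def)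
  then show ?thesis by simp
qed

lemma prod_power_multi3: "(\<Prod>i\<in>UNIV. ((\<xi>::real^'n) $ i) ^ multi3 j k l i) = \<xi> $ j * \<xi> $ k * \<xi> $ l"
  by (simp add: multi3_def power_add prod.distrib prod_power_multi1)

lemma sum_multi1: "sum (multi1 l) (UNIV :: 'n::finite set) = 1"
  by (simp add: multi1_def of_bool_def)

lemma sum_multi3: "sum (multi3 j k l) (UNIV :: 'n::finite set) = 3"
  by (simp add: multi3_def sum.distrib sum_multi1)

text \<open>The Leray projection is resolved into heat kernels by writing
  \<open>exp (- t a) / a\<close> with \<open>a = |\<xi>|\<^sup>2\<close> as the integral of \<open>exp (- s a)\<close> over \<open>s \<ge> t\<close>.\<close>

lemma oseen_symbol_eq:
  fixes x \<xi> :: "real^'n"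
  assumes t: "t > 0"
  shows "integrable lborel (\<lambda>s. indicator {t..} s *\<^sub>R gauss_moment (multi3 j k l) s x \<xi>)"
    and "exp (\<i> * of_real (x \<bullet> \<xi>)) * oseen_symbol t j k l \<xi> =
      \<i> * (of_bool (j = k) * gauss_moment (multi1 l) t x \<xi>
        - (LINT s|lborel. indicator {t..} s *\<^sub>R gauss_moment (multi3 j k l) s x \<xi>))"
    and "(LINT s|lborel. norm (indicator {t..} s *\<^sub>R gauss_moment (multi3 j k l) s x \<xi>))
      \<le> norm (gauss_moment (multi1 l) t x \<xi>)"
proof -
  define e where "e = exp (\<i> * of_real (x \<bullet> \<xi>))"
  define c where "c = \<xi> $ j * \<xi> $ k * \<xi> $ l"
  define a where "a = (norm \<xi>)\<^sup>2"
  have e: "norm e = 1" by (simp add: e_def)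
  have m3: "gauss_moment (multi3 j k l) s x \<xi> = (e * of_real c) * of_real (exp (- s * a))" for s
    by (simp add: gauss_moment_def prod_power_multi3 e_def c_def a_def)
  have m1: "gauss_moment (multi1 l) s x \<xi> = e * of_real (\<xi> $ l * exp (- s * a))" for s
    by (simp add: gauss_moment_def prod_power_multi1 e_def a_def)
  \<comment> \<open>At \<open>\<xi> = 0\<close> the integral over \<open>s\<close> diverges and the
    quotient divides by 0; a vanishing factor \<open>f\<close> makes both sides 0. The type of
    \<open>f\<close> stays open: complex for the integral itself, real for the integral of the
    norm.\<close>
  have hb: "has_bochner_integral lborel (\<lambda>s. f * of_real (indicator {t..} s * exp (- s * a))) (f * of_real (exp (- t * a) / a))"
    if "\<xi> = 0 \<Longrightarrow> f = 0" for f :: "'b::{real_normed_field, banach, second_countable_topology}"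
  proof (cases "\<xi> = 0")
    case False
    then show ?thesis
      by (intro has_bochner_integral_mult_right has_bochner_integral_of_real has_bochner_integral_exp_atLeast)
         (auto simp: a_def)
  qed (use that in auto)
  have eq: "indicator {t..} s *\<^sub>R gauss_moment (multi3 j k l) s x \<xi> = (e * of_real c) * of_real (indicator {t..} s * exp (- s * a))" for s
    by (simp add: m3 indicator_def)
  have hb3: "has_bochner_integral lborel (\<lambda>s. indicator {t..} s *\<^sub>R gauss_moment (multi3 j k l) s x \<xi>)
     ((e * of_real c) * of_real (exp (- t * a) / a))"
    unfolding eq by (intro hb) (auto simp: c_def)
  then show "integrable lborel (\<lambda>s. indicator {t..} s *\<^sub>R gauss_moment (multi3 j k l) s x \<xi>)"
    by (rule integrable.intros)
  show "exp (\<i> * of_real (x \<bullet> \<xi>)) * oseen_symbol t j k l \<xi> =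
      \<i> * (of_bool (j = k) * gauss_moment (multi1 l) t x \<xi>
        - (LINT s|lborel. indicator {t..} s *\<^sub>R gauss_moment (multi3 j k l) s x \<xi>))"
    unfolding has_bochner_integral_integral_eq[OF hb3] m1
    by (simp add: oseen_symbol_def e_def[symmetric] c_def a_def[symmetric] algebra_simps)
  have "norm (indicator {t..} s *\<^sub>R gauss_moment (multi3 j k l) s x \<xi>)
      = \<bar>c\<bar> * of_real (indicator {t..} s * exp (- s * a))" for s :: real
    unfolding eq using e by (simp add: norm_mult indicator_def)
  then have "(LINT s|lborel. norm (indicator {t..} s *\<^sub>R gauss_moment (multi3 j k l) s x \<xi>))
      = (LINT s|lborel. \<bar>c\<bar> * of_real (indicator {t..} s * exp (- s * a)))"
    by (simp only:)
  also have "\<dots> = \<bar>c\<bar> * (exp (- t * a) / a)"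
    using has_bochner_integral_integral_eq[OF hb[of "\<bar>c\<bar>"]] by (simp add: c_def)
  also have "\<dots> = (\<bar>\<xi> $ j\<bar> * \<bar>\<xi> $ k\<bar> / a) * (\<bar>\<xi> $ l\<bar> * exp (- t * a))"
    by (simp add: c_def abs_mult)
  also have "\<dots> \<le> 1 * (\<bar>\<xi> $ l\<bar> * exp (- t * a))"
  proof (intro mult_right_mono)
    have "\<bar>\<xi> $ j\<bar> * \<bar>\<xi> $ k\<bar> \<le> norm \<xi> * norm \<xi>"
      by (intro mult_mono component_le_norm_cart) auto
    then show "\<bar>\<xi> $ j\<bar> * \<bar>\<xi> $ k\<bar> / a \<le> 1"
      by (auto simp: a_def power2_eq_square divide_le_eq)
  qed auto
  also have "\<dots> = norm (gauss_moment (multi1 l) t x \<xi>)"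
    unfolding m1 using e by (simp add: norm_mult)
  finally show "(LINT s|lborel. norm (indicator {t..} s *\<^sub>R gauss_moment (multi3 j k l) s x \<xi>))
      \<le> norm (gauss_moment (multi1 l) t x \<xi>)" .
qed

lemma measurable_gauss_moment_compose [measurable (raw)]:
  assumes "f \<in> borel_measurable M" "g \<in> borel_measurable M" "h \<in> borel_measurable M"
  shows "(\<lambda>w. gauss_moment m (f w) (g w) (h w)) \<in> borel_measurable M"
  using measurable_compose[OF measurable_Pair[OF assms(1) measurable_Pair[OF assms(2,3)]] measurable_gauss_moment]
  by simp

lemma measurable_vec_nth_compose [measurable (raw)]:
  fixes f :: "'a \<Rightarrow> real^'n"
  assumes "f \<in> borel_measurable M"
  shows "(\<lambda>w. f w $ i) \<in> borel_measurable M"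
  unfolding cart_eq_inner_axis using assms by measurable

lemma measurable_oseen_symbol [measurable]: "oseen_symbol t j k l \<in> borel_measurable borel"
  unfolding oseen_symbol_def[abs_def] by measurable

text \<open>Exchanges the integrals over \<open>\<xi>\<close> and \<open>s\<close>. Fubini applies
  because the \<open>s\<close>-integral of the norm is dominated by that of
  \<open>gauss_moment (multi1 l) t x\<close>, the factor \<open>\<xi> $ j * \<xi> $ k\<close> having
  been spent against \<open>(norm \<xi>)\<^sup>2\<close>.\<close>

lemma oseen_kernel_eq:
  fixes x :: "real^'n"
  assumes t: "t > 0"
  shows "oseen_kernel t j k l x = Re (\<i> * (of_bool (j = k) * (LINT \<xi>|lborel. gauss_moment (multi1 l) t x \<xi>)
        - (LINT s|lborel. indicator {t..} s *\<^sub>R (LINT \<xi>|lborel. gauss_moment (multi3 j k l) s x \<xi>)))) / (2 * pi) ^ CARD('n)"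
    (is ?eq)
    and "integrable lborel (\<lambda>s. indicator {t..} s *\<^sub>R (LINT \<xi>|lborel. gauss_moment (multi3 j k l) s x \<xi>))" (is ?int)
proof -
  let ?f = "\<lambda>\<xi> s. indicator {t..} s *\<^sub>R gauss_moment (multi3 j k l) s x \<xi>"
  have int1: "integrable lborel (gauss_moment (multi1 l) t x)"
    using t by (rule integrable_gauss_moment)
  have int: "integrable (lborel \<Otimes>\<^sub>M lborel) (\<lambda>(\<xi>, s). ?f \<xi> s)"
  proof (rule lborel_pair.Fubini_integrable)
    show "(\<lambda>(\<xi>, s). ?f \<xi> s) \<in> borel_measurable (lborel \<Otimes>\<^sub>M lborel)"
      by measurable
    show "integrable lborel (\<lambda>\<xi>. LINT s|lborel. norm (case (\<xi>, s) of (\<xi>, s) \<Rightarrow> ?f \<xi> s))"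
    proof (rule Bochner_Integration.integrable_bound[OF int1])
      show "(\<lambda>\<xi>. LINT s|lborel. norm (case (\<xi>, s) of (\<xi>, s) \<Rightarrow> ?f \<xi> s)) \<in> borel_measurable lborel"
        by measurable
    qed (use oseen_symbol_eq(3)[OF t, of j k l x] in simp)
    show "AE \<xi> in lborel. integrable lborel (\<lambda>s. case (\<xi>, s) of (\<xi>, s) \<Rightarrow> ?f \<xi> s)"
      using oseen_symbol_eq(1)[OF t, of j k l x] by simp
  qed
  have swap: "(LINT \<xi>|lborel. LINT s|lborel. ?f \<xi> s) = (LINT s|lborel. LINT \<xi>|lborel. ?f \<xi> s)"
    using lborel_pair.Fubini_integral[OF int] by simp
  have int2: "integrable lborel (\<lambda>\<xi>. LINT s|lborel. ?f \<xi> s)"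
    using lborel_pair.integrable_fst[OF int] by simp
  have "(LINT \<xi>|lebesgue. exp (\<i> * of_real (x \<bullet> \<xi>)) * oseen_symbol t j k l \<xi>)
      = (LINT \<xi>|lborel. \<i> * (of_bool (j = k) * gauss_moment (multi1 l) t x \<xi> - (LINT s|lborel. ?f \<xi> s)))"
    by (subst integral_completion) (simp_all add: oseen_symbol_eq(2)[OF t])
  also have "\<dots> = \<i> * (of_bool (j = k) * (LINT \<xi>|lborel. gauss_moment (multi1 l) t x \<xi>)
        - (LINT \<xi>|lborel. LINT s|lborel. ?f \<xi> s))"
    using int1 int2 by simp
  also have "(LINT \<xi>|lborel. LINT s|lborel. ?f \<xi> s) = (LINT s|lborel. indicator {t..} s *\<^sub>R (LINT \<xi>|lborel. gauss_moment (multi3 j k l) s x \<xi>))"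
    unfolding swap by simp
  finally show ?eq by (simp only: oseen_kernel_def)
  show ?int
    using lborel_pair.integrable_snd[OF int] by simp
qed

text \<open>Two contributions: a first-order derivative of the heat kernel at time \<open>t\<close>
  if \<open>j = k\<close>, and third-order ones integrated over \<open>s \<ge> t\<close>. Both are
  bounded by a multiple of \<open>t powr (- (1/4)) * (sqrt t + norm x) powr (- p)\<close>.\<close>

lemma oseen_kernel_le_decay_profile:
  "\<exists>C>0. \<forall>t>0. \<forall>j k l. \<forall>x::real^'n. \<bar>oseen_kernel t j k l x\<bar> \<le> C * t powr (- (1/2)) * decay_profile t x"
proof -
  define d where "d = real CARD('n)"
  define p where "p = d + 1/2"
  have p: "p \<ge> 0" by (simp add: p_def d_def)
  obtain C1 :: "'n \<Rightarrow> real" where C1: "\<And>l. C1 l > 0" "\<And>l s (x::real^'n). s > 0 \<Longrightarrow>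
      norm (LINT \<xi>|lborel. gauss_moment (multi1 l) s x \<xi>) \<le> C1 l * s powr (- (d + 1) / 2) * (1 + norm x / sqrt s) powr (- p)"
    using norm_integral_gauss_moment_le[OF p, of "multi1 _ :: 'n \<Rightarrow> nat"] unfolding sum_multi1 d_def by simp metis
  obtain C3 :: "'n \<Rightarrow> 'n \<Rightarrow> 'n \<Rightarrow> real" where C3: "\<And>j k l. C3 j k l > 0" "\<And>j k l s (x::real^'n). s > 0 \<Longrightarrow>
      norm (LINT \<xi>|lborel. gauss_moment (multi3 j k l) s x \<xi>) \<le> C3 j k l * s powr (- (d + 3) / 2) * (1 + norm x / sqrt s) powr (- p)"
    using norm_integral_gauss_moment_le[OF p, of "multi3 _ _ _ :: 'n \<Rightarrow> nat"] unfolding sum_multi3 d_def by simp metis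
  define C where "C = (\<Sum>l\<in>UNIV. C1 l) + 4 * (\<Sum>j\<in>UNIV. \<Sum>k\<in>UNIV. \<Sum>l\<in>UNIV. C3 j k l)"
  have C1_le: "C1 l \<le> (\<Sum>l\<in>UNIV. C1 l)" for l
    using C1(1) by (intro member_le_sum) (auto intro: less_imp_le)
  have C3_le: "C3 j k l \<le> (\<Sum>j\<in>UNIV. \<Sum>k\<in>UNIV. \<Sum>l\<in>UNIV. C3 j k l)" for j k l
  proof -
    have "C3 j k l \<le> (\<Sum>l\<in>UNIV. C3 j k l)"
      using C3(1) by (intro member_le_sum) (auto intro: less_imp_le)
    also have "\<dots> \<le> (\<Sum>k\<in>UNIV. \<Sum>l\<in>UNIV. C3 j k l)"
      using C3(1) by (intro member_le_sum[where f = "\<lambda>k. \<Sum>l\<in>UNIV. C3 j k l"]) (auto intro!: sum_nonneg intro: less_imp_le)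
    also have "\<dots> \<le> (\<Sum>j\<in>UNIV. \<Sum>k\<in>UNIV. \<Sum>l\<in>UNIV. C3 j k l)"
      using C3(1) by (intro member_le_sum[where f = "\<lambda>j. \<Sum>k\<in>UNIV. \<Sum>l\<in>UNIV. C3 j k l"]) (auto intro!: sum_nonneg intro: less_imp_le)
    finally show ?thesis .
  qed
  have "C > 0"
    unfolding C_def using C1(1) C3(1) by (intro add_pos_nonneg sum_pos mult_nonneg_nonneg sum_nonneg) (auto intro: less_imp_le)
  moreover have "\<bar>oseen_kernel t j k l x\<bar> \<le> C * t powr (- (1/2)) * decay_profile t x"
    if t: "t > 0" for t j k l and x :: "real^'n"
  proof -
    define b where "b = (sqrt t + norm x) powr (- p)"
    let ?A = "LINT \<xi>|lborel. gauss_moment (multi1 l) t x \<xi>"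
    let ?g = "\<lambda>s. indicator {t..} s *\<^sub>R (LINT \<xi>|lborel. gauss_moment (multi3 j k l) s x \<xi>)"
    have prof: "t powr (- (1/2)) * decay_profile t x = t powr (- (1/4)) * b"
      by (simp add: decay_profile_def b_def p_def d_def mult.assoc[symmetric] powr_add[symmetric])
    have "norm ?A \<le> C1 l * t powr (- (d + 1) / 2) * (1 + norm x / sqrt t) powr (- p)"
      using t by (rule C1)
    also have "\<dots> = C1 l * (t powr (- (d + 1) / 2) * t powr (p / 2)) * b"
      unfolding one_plus_norm_powr[OF t] b_def by simp
    also have "t powr (- (d + 1) / 2) * t powr (p / 2) = t powr (- (1/4))"
      unfolding powr_add[symmetric] by (simp add: p_def field_simps)
    finally have A: "norm ?A \<le> C1 l * (t powr (- (1/4)) * b)" by simp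
    have "norm (LINT s|lborel. ?g s) \<le> (LINT s|lborel. C3 j k l * b * (indicator {t..} s * s powr (- (5/4))))"
    proof (rule Bochner_Integration.integral_norm_bound_integral)
      show "integrable lborel ?g" using t by (rule oseen_kernel_eq)
      show "integrable lborel (\<lambda>s. C3 j k l * b * (indicator {t..} s * s powr (- (5/4))))"
        using has_bochner_integral_powr_atLeast[OF t] by (auto simp: has_bochner_integral_iff)
      show "norm (?g s) \<le> C3 j k l * b * (indicator {t..} s * s powr (- (5/4)))" for s
      proof (cases "s \<ge> t")
        case True
        then have s: "s > 0" using t by simp
        have "norm (?g s) \<le> C3 j k l * s powr (- (d + 3) / 2) * (1 + norm x / sqrt s) powr (- p)"
          using True C3(2)[OF s] by simp
        also have "\<dots> = C3 j k l * (s powr (- (d + 3) / 2) * s powr (p / 2)) * (sqrt s + norm x) powr (- p)"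
          unfolding one_plus_norm_powr[OF s] by simp
        also have "s powr (- (d + 3) / 2) * s powr (p / 2) = s powr (- (5/4))"
          unfolding powr_add[symmetric] by (simp add: p_def field_simps)
        \<comment> \<open>For \<open>s \<ge> t\<close>, replacing \<open>sqrt s\<close> by
          \<open>sqrt t\<close> takes the dependence on \<open>x\<close> out of the
          \<open>s\<close>-integral.\<close>
        also have "C3 j k l * s powr (- (5/4)) * (sqrt s + norm x) powr (- p) \<le> C3 j k l * s powr (- (5/4)) * b"
          using C3(1)[of j k l] t True p unfolding b_def
          by (intro mult_left_mono powr_mono2') (auto intro: add_pos_nonneg)
        finally show ?thesis using True by (simp add: mult_ac)
      qed simp
    qed
    also have "\<dots> = C3 j k l * b * (4 * t powr (- (1/4)))"
      using has_bochner_integral_powr_atLeast[OF t] by (simp add: has_bochner_integral_iff)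
    finally have B: "norm (LINT s|lborel. ?g s) \<le> 4 * C3 j k l * (t powr (- (1/4)) * b)"
      by (simp add: mult_ac)
    have "\<bar>oseen_kernel t j k l x\<bar> \<le> norm (\<i> * (of_bool (j = k) * ?A - (LINT s|lborel. ?g s))) / (2 * pi) ^ CARD('n)"
      unfolding oseen_kernel_eq(1)[OF t] abs_divide
      by (intro divide_mono abs_Re_le_cmod) auto
    also have "\<dots> \<le> norm (\<i> * (of_bool (j = k) * ?A - (LINT s|lborel. ?g s))) / 1"
    proof (intro divide_left_mono)
      have "1 \<le> 2 * pi" using pi_gt3 by simp
      then show "1 \<le> (2 * pi) ^ CARD('n)" by (rule one_le_power)
    qed auto
    also have "\<dots> \<le> norm ?A + norm (LINT s|lborel. ?g s)"
      by (auto simp: norm_mult intro: order_trans[OF norm_triangle_ineq4])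
    also have "\<dots> \<le> C1 l * (t powr (- (1/4)) * b) + 4 * C3 j k l * (t powr (- (1/4)) * b)"
      by (intro add_mono A B)
    also have "\<dots> = (C1 l + 4 * C3 j k l) * (t powr (- (1/4)) * b)" by (simp add: algebra_simps)
    also have "\<dots> \<le> C * (t powr (- (1/4)) * b)"
      unfolding C_def using C1_le[of l] C3_le[of j k l] by (intro mult_right_mono add_mono mult_left_mono) (auto simp: b_def)
    finally show ?thesis by (simp add: prof mult.assoc)
  qed
  ultimately show ?thesis by blast
qed

section \<open>Convolution of the kernel profile with powers of the norm\<close>

text \<open>One coordinate of a product majorant in several variables. The value \<open>top\<close>
  at 0 costs nothing, a point being a null set, and keeps the product infinite on the coordinate
  hyperplanes.\<close>

lemma nn_integral_powr_finite:
  fixes a b :: real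
  assumes a: "a > 1" and b: "0 \<le> b" "b < 1"
  shows "(\<integral>\<^sup>+r. (if r = 0 then top else ennreal ((1 + \<bar>r\<bar>) powr - a * \<bar>r\<bar> powr - b)) \<partial>lborel) < \<infinity>"
proof -
  define h where "h r = (if r = (0::real) then 0 else ennreal ((1 + \<bar>r\<bar>) powr - a * \<bar>r\<bar> powr - b))" for r
  have h_meas[measurable]: "h \<in> borel_measurable borel"
    unfolding h_def by measurable
  have "(\<integral>\<^sup>+r. (if r = 0 then top else ennreal ((1 + \<bar>r\<bar>) powr - a * \<bar>r\<bar> powr - b)) \<partial>lborel) = (\<integral>\<^sup>+r. h r \<partial>lborel)"
    using AE_lborel_singleton[of "0::real"] by (intro nn_integral_cong_AE) (auto simp: h_def)
  also have "\<dots> \<le> (\<integral>\<^sup>+r. h r * indicator {0..} r + h r * indicator {..0} r \<partial>lborel)"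
    by (intro nn_integral_mono) (auto simp: indicator_def)
  also have "\<dots> = (\<integral>\<^sup>+r. h r * indicator {0..} r \<partial>lborel) + (\<integral>\<^sup>+r. h r * indicator {..0} r \<partial>lborel)"
    by (rule nn_integral_add) measurable
  also have "(\<integral>\<^sup>+r. h r * indicator {..0} r \<partial>lborel) = (\<integral>\<^sup>+r. h r * indicator {0..} r \<partial>lborel)"
    by (subst nn_integral_real_affine[where c = "-1" and t = 0])
       (auto intro!: nn_integral_cong simp: h_def indicator_def)
  also have "(\<integral>\<^sup>+r. h r * indicator {0..} r \<partial>lborel)
     \<le> (\<integral>\<^sup>+r. ennreal (indicator {0..1} r * r powr - b) + ennreal (indicator {1..} r * r powr - a) \<partial>lborel)"
  proof (rule nn_integral_mono)
    fix r :: real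
    have "(1 + r) powr - a * r powr - b \<le> indicator {0..1} r * r powr - b + indicator {1..} r * r powr - a"
      if "r > 0"
    proof (cases "r \<le> 1")
      case True
      have "(1 + r) powr - a * r powr - b \<le> 1 * r powr - b"
        using that a powr_mono[of "- a" 0 "1 + r"] by (intro mult_right_mono) auto
      then show ?thesis using True that by (auto simp: indicator_def intro: order_trans)
    next
      case False
      have "(1 + r) powr - a * r powr - b \<le> r powr - a * 1"
        using False a b powr_mono[of "- b" 0 r] by (intro mult_mono powr_mono2') auto
      then show ?thesis using False by simp
    qed
    then show "h r * indicator {0..} r \<le> ennreal (indicator {0..1} r * r powr - b) + ennreal (indicator {1..} r * r powr - a)"
      by (cases "r > 0") (auto simp: h_def indicator_def ennreal_plus[symmetric] simp del: ennreal_plus)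
  qed
  also have "\<dots> = (\<integral>\<^sup>+r. ennreal (indicator {0..1} r * r powr - b) \<partial>lborel) + (\<integral>\<^sup>+r. ennreal (indicator {1..} r * r powr - a) \<partial>lborel)"
    by (rule nn_integral_add) measurable
  also have "(\<integral>\<^sup>+r. ennreal (indicator {0..1} r * r powr - b) \<partial>lborel) = ennreal (1 powr (- b + 1) / (- b + 1))"
    using b by (intro nn_integral_has_integral_lebesgue has_integral_powr_from_0) auto
  also have "(\<integral>\<^sup>+r. ennreal (indicator {1..} r * r powr - a) \<partial>lborel) = ennreal (- (1 powr (- a + 1)) / (- a + 1))"
    using a by (intro nn_integral_has_integral_lebesgue has_integral_powr_to_inf) auto
  finally show ?thesis
    by (auto simp: add_mono top_unique intro: le_less_trans)
qed

text \<open>Both exponents are shared equally among the coordinates: as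
  \<open>\<bar>y $ i\<bar> \<le> norm y\<close>, the integrand lies below a product of one-variable
  functions with exponents \<open>p / d > 1\<close> and \<open>\<gamma> / d < 1\<close>.\<close>

lemma nn_integral_profile_powr_finite:
  fixes p \<gamma> :: real
  assumes p: "p > real CARD('n)" and \<gamma>: "0 \<le> \<gamma>" "\<gamma> < real CARD('n)"
  shows "(\<integral>\<^sup>+y. ennreal ((1 + norm (y::real^'n)) powr - p * norm y powr - \<gamma>) \<partial>lborel) < \<infinity>"
proof -
  define d where "d = real CARD('n)"
  have d: "d > 0" by (simp add: d_def)
  define h where "h r = (if r = (0::real) then top else ennreal ((1 + \<bar>r\<bar>) powr - (p / d) * \<bar>r\<bar> powr - (\<gamma> / d)))" for r
  have [measurable]: "h \<in> borel_measurable borel"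
    unfolding h_def by measurable
  have h_nz: "h r \<noteq> 0" for r by (auto simp: h_def)
  have "ennreal ((1 + norm y) powr - p * norm y powr - \<gamma>) \<le> (\<Prod>i\<in>UNIV. h (y $ i))" for y :: "real^'n"
  proof (cases "\<exists>i. y $ i = 0")
    \<comment> \<open>Since \<open>0 powr q = 0\<close>, a product of plain powers would vanish here
      and be no majorant; one factor \<open>top\<close> and no factor 0 make it infinite.\<close>
    case True
    then have "(\<Prod>i\<in>UNIV. h (y $ i)) = top"
      using h_nz by (subst ennreal_prod_eq_top) (auto simp: h_def)
    then show ?thesis by simp
  next
    case False
    have nz: "y \<noteq> 0" using False by auto
    have pw: "(z powr - (q / d)) ^ CARD('n) = z powr - q" if "z > 0" for z q :: real
      using that d by (simp add: powr_realpow[symmetric] powr_powr d_def)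
    have "(1 + norm y) powr - p * norm y powr - \<gamma> = (\<Prod>i\<in>(UNIV::'n set). (1 + norm y) powr - (p / d) * norm y powr - (\<gamma> / d))"
      using nz by (simp add: power_mult_distrib pw add_pos_nonneg)
    also have "\<dots> \<le> (\<Prod>i\<in>UNIV. (1 + \<bar>y $ i\<bar>) powr - (p / d) * \<bar>y $ i\<bar> powr - (\<gamma> / d))"
      using False p \<gamma> d component_le_norm_cart[of y]
      by (intro prod_mono conjI mult_mono powr_mono2') (auto simp: d_def)
    finally have "ennreal ((1 + norm y) powr - p * norm y powr - \<gamma>) \<le> ennreal \<dots>"
      by (rule ennreal_leI)
    also have "\<dots> = (\<Prod>i\<in>UNIV. h (y $ i))"
      using False by (subst prod_ennreal[symmetric]) (auto simp: h_def)
    finally show ?thesis .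
  qed
  then have "(\<integral>\<^sup>+y. ennreal ((1 + norm (y::real^'n)) powr - p * norm y powr - \<gamma>) \<partial>lborel) \<le> (\<integral>\<^sup>+y. (\<Prod>i\<in>UNIV. h ((y::real^'n) $ i)) \<partial>lborel)"
    by (intro nn_integral_mono)
  also have "\<dots> = (\<Prod>i\<in>(UNIV::'n set). \<integral>\<^sup>+r. h r \<partial>lborel)"
    by (rule nn_integral_lborel_prod_vec) measurable
  also have "\<dots> < \<infinity>"
    using nn_integral_powr_finite[of "p / d" "\<gamma> / d"] p \<gamma> d
    by (simp add: h_def[symmetric] d_def power_less_top_ennreal)
  finally show ?thesis .
qed

section \<open>Scaling, reflection and splitting of the convolution\<close>

lemma nn_integral_lborel_affine:
  fixes f :: "'a::euclidean_space \<Rightarrow> ennreal"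
  assumes [measurable]: "f \<in> borel_measurable borel" and c: "c \<noteq> 0"
  shows "(\<integral>\<^sup>+x. f x \<partial>lborel) = ennreal (\<bar>c\<bar> ^ DIM('a)) * (\<integral>\<^sup>+x. f (t + c *\<^sub>R x) \<partial>lborel)"
  by (subst lborel_affine[OF c, of t])
     (simp add: nn_integral_density nn_integral_distr nn_integral_cmult)

lemma nn_integral_lborel_reflect:
  fixes f :: "'a::euclidean_space \<Rightarrow> ennreal"
  assumes [measurable]: "f \<in> borel_measurable borel"
  shows "(\<integral>\<^sup>+y. f (x - y) \<partial>lborel) = (\<integral>\<^sup>+y. f y \<partial>lborel)"
  using nn_integral_lborel_affine[OF assms, of "-1" x] by simp

lemma measurable_decay_profile [measurable (raw)]:
  assumes "f \<in> borel_measurable M" "g \<in> borel_measurable M"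
  shows "(\<lambda>w. decay_profile (f w) (g w)) \<in> borel_measurable M"
  unfolding decay_profile_def using assms by measurable

text \<open>The dilation by \<open>sqrt t\<close> reduces to \<open>t = 1\<close>; its Jacobian
  cancels the normalisation of the profile.\<close>

lemma nn_integral_decay_profile_powr:
  fixes \<gamma> :: real
  assumes \<gamma>: "0 \<le> \<gamma>" "\<gamma> < real CARD('n)"
  shows "\<exists>J\<ge>0. \<forall>t>0. (\<integral>\<^sup>+y. ennreal (decay_profile t (y::real^'n) * norm y powr - \<gamma>) \<partial>lborel) = ennreal (J * t powr (- \<gamma> / 2))"
proof -
  let ?d = "real CARD('n)"
  let ?h = "\<lambda>y::real^'n. (1 + norm y) powr - (?d + 1/2) * norm y powr - \<gamma>"
  define J where "J = enn2real (\<integral>\<^sup>+y. ennreal (?h y) \<partial>lborel)"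
  have "(\<integral>\<^sup>+y. ennreal (?h y) \<partial>lborel) < \<infinity>"
    using \<gamma> by (intro nn_integral_profile_powr_finite) auto
  then have J: "J \<ge> 0" "(\<integral>\<^sup>+y. ennreal (?h y) \<partial>lborel) = ennreal J"
    by (simp_all add: J_def)
  have "(\<integral>\<^sup>+y. ennreal (decay_profile t (y::real^'n) * norm y powr - \<gamma>) \<partial>lborel) = ennreal (J * t powr (- \<gamma> / 2))" if t: "t > 0" for t
  proof -
    have "(\<integral>\<^sup>+y. ennreal (decay_profile t (y::real^'n) * norm y powr - \<gamma>) \<partial>lborel)
       = ennreal (sqrt t ^ CARD('n)) * (\<integral>\<^sup>+y. ennreal (decay_profile t (sqrt t *\<^sub>R (y::real^'n)) * norm (sqrt t *\<^sub>R y) powr - \<gamma>) \<partial>lborel)"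
      using t by (subst nn_integral_lborel_affine[where c = "sqrt t" and t = 0]) auto
    also have "(\<integral>\<^sup>+y. ennreal (decay_profile t (sqrt t *\<^sub>R (y::real^'n)) * norm (sqrt t *\<^sub>R y) powr - \<gamma>) \<partial>lborel)
       = (\<integral>\<^sup>+y. ennreal (t powr (- ?d / 2) * t powr (- \<gamma> / 2)) * ennreal (?h y) \<partial>lborel)"
    proof (intro nn_integral_cong)
      fix y :: "real^'n"
      have "norm (sqrt t *\<^sub>R y) powr - \<gamma> = t powr (- \<gamma> / 2) * norm y powr - \<gamma>"
        using t by (simp add: powr_mult powr_half_sqrt[symmetric] powr_powr)
      then show "ennreal (decay_profile t (sqrt t *\<^sub>R y) * norm (sqrt t *\<^sub>R y) powr - \<gamma>)
          = ennreal (t powr (- ?d / 2) * t powr (- \<gamma> / 2)) * ennreal (?h y)"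
        using t by (simp add: decay_profile_eq[OF t] ennreal_mult'[symmetric] mult_ac)
    qed
    also have "\<dots> = ennreal (t powr (- ?d / 2) * t powr (- \<gamma> / 2)) * ennreal J"
      unfolding J(2)[symmetric] by (rule nn_integral_cmult) measurable
    also have "ennreal (sqrt t ^ CARD('n)) * (ennreal (t powr (- ?d / 2) * t powr (- \<gamma> / 2)) * ennreal J)
       = ennreal ((sqrt t ^ CARD('n) * t powr (- ?d / 2)) * (t powr (- \<gamma> / 2) * J))"
      using J t by (simp add: ennreal_mult'[symmetric] mult_ac)
    also have "sqrt t ^ CARD('n) * t powr (- ?d / 2) = 1"
      using t by (simp add: powr_realpow[symmetric] powr_half_sqrt[symmetric] powr_powr powr_add[symmetric])
    finally show ?thesis by (simp add: mult.commute)
  qed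
  then show ?thesis using J by blast
qed

lemma decay_profile_antimono:
  assumes "t > 0" "norm y \<le> norm z"
  shows "decay_profile t (z::real^'n) \<le> decay_profile t (y::real^'n)"
  unfolding decay_profile_def using assms
  by (intro mult_left_mono powr_mono2') (auto intro: add_pos_nonneg)

text \<open>First bound: both factors decrease radially, so their product is at most the product
  with both taken at whichever of \<open>x - y\<close> and \<open>y\<close> has the smaller norm;
  the resulting integrals do not depend on \<open>x\<close>. Second bound: split at
  \<open>norm y = r\<close> with \<open>r = norm x / 2\<close>. Outside, the power is at most
  \<open>r powr - \<gamma>\<close> and the profile has the fixed mass \<open>J0\<close>. Inside,
  \<open>norm (x - y) \<ge> r\<close>, and the profile at \<open>x - y\<close> is at most a multiple
  of the one at time \<open>r\<^sup>2\<close> and point \<open>y\<close>, whose integral against the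
  power is \<open>J * r powr - \<gamma>\<close>.\<close>

lemma decay_profile_convolution:
  fixes \<gamma> :: real
  assumes \<gamma>: "0 \<le> \<gamma>" "\<gamma> < real CARD('n)"
  shows "\<exists>D>0. \<forall>t>0. \<forall>x::real^'n.
     (\<integral>\<^sup>+y. ennreal (decay_profile t (x - y) * norm y powr - \<gamma>) \<partial>lborel) \<le> ennreal (D * t powr (- \<gamma> / 2)) \<and>
     (x \<noteq> 0 \<longrightarrow> (\<integral>\<^sup>+y. ennreal (decay_profile t (x - y) * norm y powr - \<gamma>) \<partial>lborel) \<le> ennreal (D * norm x powr - \<gamma>))"
proof -
  define d where "d = real CARD('n)"
  define p where "p = d + 1/2"
  have d: "d > 0" by (simp add: d_def)
  obtain J where J: "J \<ge> 0" "\<And>t. t > 0 \<Longrightarrow>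
      (\<integral>\<^sup>+y. ennreal (decay_profile t (y::real^'n) * norm y powr - \<gamma>) \<partial>lborel) = ennreal (J * t powr (- \<gamma> / 2))"
    using nn_integral_decay_profile_powr[OF \<gamma>] by blast
  obtain J0 where J0: "J0 \<ge> 0" "\<And>t. t > 0 \<Longrightarrow>
      (\<integral>\<^sup>+y. ennreal (decay_profile t (y::real^'n) * norm y powr - 0) \<partial>lborel) = ennreal (J0 * t powr (- 0 / 2))"
    using nn_integral_decay_profile_powr[of 0, where 'n = 'n] by auto
  \<comment> \<open>As \<open>0 powr 0 = 0\<close>, the factor \<open>norm y powr - 0\<close>
    differs from 1 at the origin, a null set.\<close>
  have J0': "(\<integral>\<^sup>+y. ennreal (decay_profile t (y::real^'n)) \<partial>lborel) = ennreal J0" if t: "t > 0" for t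
  proof -
    have "(\<integral>\<^sup>+y. ennreal (decay_profile t (y::real^'n)) \<partial>lborel) = (\<integral>\<^sup>+y. ennreal (decay_profile t (y::real^'n) * norm y powr - 0) \<partial>lborel)"
      using AE_lborel_singleton[of "0::real^'n"] by (intro nn_integral_cong_AE, eventually_elim) auto
    then show ?thesis using J0(2)[OF t] t by simp
  qed
  \<comment> \<open>The summand 1 gives positivity, \<open>2 * J\<close> serves the first bound, the
    last summand the second.\<close>
  define D where "D = 1 + 2 * J + 2 powr \<gamma> * (J0 + 2 powr p * J)"
  have Dpos: "D > 0" using J J0 by (simp add: D_def add_pos_nonneg)
  have "(\<integral>\<^sup>+y. ennreal (decay_profile t (x - y) * norm y powr - \<gamma>) \<partial>lborel) \<le> ennreal (D * t powr (- \<gamma> / 2))"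
    if t: "t > 0" for t and x :: "real^'n"
  proof -
    let ?f = "\<lambda>y::real^'n. ennreal (decay_profile t y * norm y powr - \<gamma>)"
    have "(\<integral>\<^sup>+y. ennreal (decay_profile t (x - y) * norm y powr - \<gamma>) \<partial>lborel) \<le> (\<integral>\<^sup>+y. ?f (x - y) + ?f y \<partial>lborel)"
      using AE_lborel_singleton[of "0::real^'n"] AE_lborel_singleton[of x]
    proof (intro nn_integral_mono_AE, eventually_elim)
      fix y :: "real^'n" assume y: "y \<noteq> 0" "y \<noteq> x"
      have "decay_profile t (x - y) * norm y powr - \<gamma> \<le> decay_profile t (x - y) * norm (x - y) powr - \<gamma> + decay_profile t y * norm y powr - \<gamma>"
      proof (cases "norm (x - y) \<le> norm y")
        case True
        then have "decay_profile t (x - y) * norm y powr - \<gamma> \<le> decay_profile t (x - y) * norm (x - y) powr - \<gamma>"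
          using y \<gamma> by (intro mult_left_mono powr_mono2') (auto simp: decay_profile_nonneg)
        then show ?thesis by (simp add: decay_profile_nonneg add_increasing2)
      next
        case False
        then have "decay_profile t (x - y) * norm y powr - \<gamma> \<le> decay_profile t y * norm y powr - \<gamma>"
          using t by (intro mult_right_mono decay_profile_antimono) auto
        then show ?thesis by (simp add: decay_profile_nonneg add_increasing)
      qed
      then show "ennreal (decay_profile t (x - y) * norm y powr - \<gamma>) \<le> ?f (x - y) + ?f y"
        by (simp add: ennreal_plus[symmetric] decay_profile_nonneg del: ennreal_plus)
    qed
    also have "\<dots> = (\<integral>\<^sup>+y. ?f (x - y) \<partial>lborel) + (\<integral>\<^sup>+y. ?f y \<partial>lborel)"
      by (rule nn_integral_add) measurable
    also have "(\<integral>\<^sup>+y. ?f (x - y) \<partial>lborel) = (\<integral>\<^sup>+y. ?f y \<partial>lborel)"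
      by (rule nn_integral_lborel_reflect) measurable
    also have "(\<integral>\<^sup>+y. ?f y \<partial>lborel) = ennreal (J * t powr (- \<gamma> / 2))" using t by (rule J)
    also have "\<dots> + \<dots> = ennreal (2 * J * t powr (- \<gamma> / 2))"
      using J by (simp flip: ennreal_plus)
    also have "\<dots> \<le> ennreal (D * t powr (- \<gamma> / 2))"
      using J J0 by (intro ennreal_leI mult_right_mono) (auto simp: D_def intro!: add_nonneg_nonneg mult_nonneg_nonneg)
    finally show ?thesis .
  qed
  moreover have "(\<integral>\<^sup>+y. ennreal (decay_profile t (x - y) * norm y powr - \<gamma>) \<partial>lborel) \<le> ennreal (D * norm x powr - \<gamma>)"
    if t: "t > 0" and x: "x \<noteq> 0" for t and x :: "real^'n"
  proof -
    define r where "r = norm x / 2"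
    have r: "r > 0" using x by (simp add: r_def)
    have le: "decay_profile t (x - y) * norm y powr - \<gamma> \<le> r powr - \<gamma> * decay_profile t (x - y) + 2 powr p * (decay_profile (r\<^sup>2) y * norm y powr - \<gamma>)" for y
    proof (cases "norm y \<ge> r")
      case True
      then have "decay_profile t (x - y) * norm y powr - \<gamma> \<le> decay_profile t (x - y) * r powr - \<gamma>"
        using r \<gamma> by (intro mult_left_mono powr_mono2') (auto simp: decay_profile_nonneg)
      then show ?thesis by (simp add: decay_profile_nonneg add_increasing2 mult.commute)
    next
      case False
      have z: "norm (x - y) \<ge> r" using False norm_triangle_ineq2[of x y] by (simp add: r_def)
      have "decay_profile t (x - y) = sqrt t powr (1/2) * (sqrt t + norm (x - y)) powr - p"
        using t by (simp add: decay_profile_def p_def d_def powr_half_sqrt[symmetric] powr_powr)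
      also have "\<dots> \<le> (sqrt t + norm (x - y)) powr (1/2) * (sqrt t + norm (x - y)) powr - p"
        using t by (intro mult_right_mono powr_mono2) auto
      also have "\<dots> = (sqrt t + norm (x - y)) powr - d"
        by (simp add: powr_add[symmetric] p_def)
      also have "\<dots> \<le> r powr - d"
        using t z r d by (intro powr_mono2') (auto intro: add_increasing)
      \<comment> \<open>Inserting 1 as a product of opposite powers: inside the ball
        \<open>r + norm y \<le> 2 * r\<close>, which brings in the profile centred at the
        origin.\<close>
      also have "\<dots> = r powr - d * ((2 * r) powr p * (2 * r) powr - p)"
        using r by (simp add: powr_add[symmetric])
      also have "\<dots> \<le> r powr - d * ((2 * r) powr p * (r + norm y) powr - p)"
        using r False d by (intro mult_left_mono powr_mono2') (auto simp: p_def intro: add_pos_nonneg)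
      also have "\<dots> = 2 powr p * (r powr (1/2) * (r + norm y) powr - p)"
      proof -
        have "(2 * r) powr p = 2 powr p * (r powr d * r powr (1/2))"
          using r by (simp add: powr_mult powr_add[symmetric] p_def)
        then have "r powr - d * ((2 * r) powr p * (r + norm y) powr - p)
            = (r powr - d * r powr d) * (2 powr p * (r powr (1/2) * (r + norm y) powr - p))"
          by (simp only: mult_ac)
        also have "r powr - d * r powr d = 1" using r by (simp add: powr_add[symmetric])
        finally show ?thesis by simp
      qed
      also have "r powr (1/2) * (r + norm y) powr - p = decay_profile (r\<^sup>2) y"
      proof -
        have "(r\<^sup>2) powr (1/4) = r powr (1/2)"
          using r by (simp add: powr_numeral[symmetric] powr_powr del: powr_numeral)
        then show ?thesis using r by (simp add: decay_profile_def p_def d_def)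
      qed
      finally have "decay_profile t (x - y) * norm y powr - \<gamma> \<le> 2 powr p * decay_profile (r\<^sup>2) y * norm y powr - \<gamma>"
        by (intro mult_right_mono) auto
      moreover have "0 \<le> r powr - \<gamma> * decay_profile t (x - y)" by (simp add: decay_profile_nonneg)
      ultimately show ?thesis by simp
    qed
    have "(\<integral>\<^sup>+y. ennreal (decay_profile t (x - y) * norm y powr - \<gamma>) \<partial>lborel)
      \<le> (\<integral>\<^sup>+y. ennreal (r powr - \<gamma>) * ennreal (decay_profile t (x - y)) + ennreal (2 powr p) * ennreal (decay_profile (r\<^sup>2) y * norm y powr - \<gamma>) \<partial>lborel)"
      using le by (intro nn_integral_mono)
        (simp add: ennreal_mult'[symmetric] ennreal_plus[symmetric] decay_profile_nonneg ennreal_leI del: ennreal_plus)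
    also have "\<dots> = ennreal (r powr - \<gamma>) * (\<integral>\<^sup>+y. ennreal (decay_profile t (x - y)) \<partial>lborel)
        + ennreal (2 powr p) * (\<integral>\<^sup>+y. ennreal (decay_profile (r\<^sup>2) (y::real^'n) * norm y powr - \<gamma>) \<partial>lborel)"
    proof -
      have "(\<lambda>y. ennreal (decay_profile t (x - y))) \<in> borel_measurable lborel"
        "(\<lambda>y::real^'n. ennreal (decay_profile (r\<^sup>2) y * norm y powr - \<gamma>)) \<in> borel_measurable lborel"
        by measurable
      then show ?thesis by (simp only: nn_integral_add nn_integral_cmult borel_measurable_times_ennreal borel_measurable_const)
    qed
    also have "(\<integral>\<^sup>+y. ennreal (decay_profile t (x - y)) \<partial>lborel) = ennreal J0"
      using nn_integral_lborel_reflect[of "\<lambda>y. ennreal (decay_profile t y)" x] J0'[OF t] by simp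
    also have "(\<integral>\<^sup>+y. ennreal (decay_profile (r\<^sup>2) (y::real^'n) * norm y powr - \<gamma>) \<partial>lborel) = ennreal (J * r powr - \<gamma>)"
      using J(2)[of "r\<^sup>2"] r by (simp add: powr_numeral[symmetric] powr_powr del: powr_numeral)
    also have "ennreal (r powr - \<gamma>) * ennreal J0 + ennreal (2 powr p) * ennreal (J * r powr - \<gamma>) = ennreal (r powr - \<gamma> * (J0 + 2 powr p * J))"
      using J J0 by (simp add: ennreal_mult'[symmetric] ennreal_plus[symmetric] algebra_simps del: ennreal_plus)
    also have "r powr - \<gamma> * (J0 + 2 powr p * J) = 2 powr \<gamma> * (J0 + 2 powr p * J) * norm x powr - \<gamma>"
      by (simp add: r_def powr_divide powr_minus field_simps)
    also have "ennreal \<dots> \<le> ennreal (D * norm x powr - \<gamma>)"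
      using J J0 by (intro ennreal_leI mult_right_mono) (auto simp: D_def)
    finally show ?thesis .
  qed
  ultimately show ?thesis using Dpos by blast
qed

text \<open>The minimum of two numbers lies below each of their weighted geometric means; which
  bound is the better one is decided by comparing \<open>norm x\<close> with \<open>sqrt t\<close>.
  The bound free of \<open>x\<close> is kept separately for the origin.\<close>

lemma decay_profile_convolution_interpolated:
  fixes \<gamma> :: real
  assumes \<gamma>: "0 \<le> \<gamma>" "\<gamma> < real CARD('n)"
  shows "\<exists>D>0. \<forall>t>0. \<forall>x::real^'n.
     (\<integral>\<^sup>+y. ennreal (decay_profile t (x - y) * norm y powr - \<gamma>) \<partial>lborel) \<le> ennreal (D * t powr (- \<gamma> / 2)) \<and>
     (\<forall>\<theta>. x \<noteq> 0 \<and> 0 \<le> \<theta> \<and> \<theta> \<le> \<gamma> \<longrightarrow>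
       (\<integral>\<^sup>+y. ennreal (decay_profile t (x - y) * norm y powr - \<gamma>) \<partial>lborel)
         \<le> ennreal (D * norm x powr - \<theta> * t powr (- (\<gamma> - \<theta>) / 2)))"
proof -
  obtain D where D: "D > 0" "\<And>t (x::real^'n). t > 0 \<Longrightarrow>
     (\<integral>\<^sup>+y. ennreal (decay_profile t (x - y) * norm y powr - \<gamma>) \<partial>lborel) \<le> ennreal (D * t powr (- \<gamma> / 2))"
     "\<And>t (x::real^'n). t > 0 \<Longrightarrow> x \<noteq> 0 \<Longrightarrow>
     (\<integral>\<^sup>+y. ennreal (decay_profile t (x - y) * norm y powr - \<gamma>) \<partial>lborel) \<le> ennreal (D * norm x powr - \<gamma>)"
    using decay_profile_convolution[OF \<gamma>] by meson
  have "(\<integral>\<^sup>+y. ennreal (decay_profile t (x - y) * norm y powr - \<gamma>) \<partial>lborel)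
         \<le> ennreal (D * norm x powr - \<theta> * t powr (- (\<gamma> - \<theta>) / 2))"
    if t: "t > 0" and x: "x \<noteq> 0" and \<theta>: "0 \<le> \<theta>" "\<theta> \<le> \<gamma>" for t \<theta> and x :: "real^'n"
  proof (cases "norm x \<le> sqrt t")
    case True
    have "t powr (- \<gamma> / 2) = t powr (- \<theta> / 2) * t powr (- (\<gamma> - \<theta>) / 2)"
      by (simp add: powr_add[symmetric] field_simps)
    also have "t powr (- \<theta> / 2) = sqrt t powr - \<theta>"
      using t by (simp add: powr_half_sqrt[symmetric] powr_powr)
    also have "sqrt t powr - \<theta> * t powr (- (\<gamma> - \<theta>) / 2) \<le> norm x powr - \<theta> * t powr (- (\<gamma> - \<theta>) / 2)"
      using True x \<theta> by (intro mult_right_mono powr_mono2') auto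
    finally have "ennreal (D * t powr (- \<gamma> / 2)) \<le> ennreal (D * (norm x powr - \<theta> * t powr (- (\<gamma> - \<theta>) / 2)))"
      using D(1) by (intro ennreal_leI mult_left_mono) auto
    then show ?thesis using D(2)[OF t, of x] by (simp add: mult.assoc)
  next
    case False
    have "norm x powr - \<gamma> = norm x powr - \<theta> * norm x powr (- (\<gamma> - \<theta>))"
      by (simp add: powr_add[symmetric])
    also have "\<dots> \<le> norm x powr - \<theta> * sqrt t powr (- (\<gamma> - \<theta>))"
      using False t \<theta> by (intro mult_left_mono powr_mono2') auto
    also have "sqrt t powr (- (\<gamma> - \<theta>)) = t powr (- (\<gamma> - \<theta>) / 2)"
      using t by (simp add: powr_half_sqrt[symmetric] powr_powr)
    finally have "ennreal (D * norm x powr - \<gamma>) \<le> ennreal (D * (norm x powr - \<theta> * t powr (- (\<gamma> - \<theta>) / 2)))"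
      using D(1) by (intro ennreal_leI mult_left_mono) auto
    then show ?thesis using D(3)[OF t x] by (simp add: mult.assoc)
  qed
  with D show ?thesis by blast
qed

text \<open>The substitution \<open>\<tau> = t * w\<close> gives a Beta integral;
  \<open>a < 1\<close> and \<open>b < 1\<close> are integrability at its two end points.\<close>

lemma nn_integral_beta_le:
  fixes a b :: real
  assumes a: "a < 1" and b: "b < 1"
  shows "\<exists>C>0. \<forall>t>0. (\<integral>\<^sup>+\<tau>. ennreal (indicator {0<..<t} \<tau> * ((t - \<tau>) powr - a * \<tau> powr - b)) \<partial>lborel) \<le> ennreal (C * t powr (1 - a - b))"
proof (intro exI conjI allI impI)
  show "Beta (1 - b) (1 - a) > 0"
    using a b by (simp add: Beta_def Gamma_real_pos)
  fix t :: real assume t: "t > 0"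
  have eq1: "(\<integral>\<^sup>+\<tau>. ennreal (indicator {0<..<t} \<tau> * ((t - \<tau>) powr - a * \<tau> powr - b)) \<partial>lborel)
     = ennreal t * (\<integral>\<^sup>+w. ennreal (indicator {0<..<t} (t * w) * ((t - t * w) powr - a * (t * w) powr - b)) \<partial>lborel)"
    using t by (subst nn_integral_real_affine[where c = t and t = 0]) auto
  have "(\<integral>\<^sup>+w. ennreal (indicator {0<..<t} (t * w) * ((t - t * w) powr - a * (t * w) powr - b)) \<partial>lborel)
     \<le> (\<integral>\<^sup>+w. ennreal (t powr (- a - b)) * ennreal (indicator {0..1} w * (w powr ((1 - b) - 1) * (1 - w) powr ((1 - a) - 1))) \<partial>lborel)"
  proof (intro nn_integral_mono)
    fix w :: real
    have eq: "t - t * w = t * (1 - w)" by (simp add: algebra_simps)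
    have "(t - t * w) powr - a * (t * w) powr - b = t powr (- a - b) * (w powr ((1 - b) - 1) * (1 - w) powr ((1 - a) - 1))"
      if "0 < w" "w < 1"
      unfolding eq using t that by (simp add: powr_mult powr_diff powr_minus divide_simps)
    then show "ennreal (indicator {0<..<t} (t * w) * ((t - t * w) powr - a * (t * w) powr - b)) \<le>
       ennreal (t powr (- a - b)) * ennreal (indicator {0..1} w * (w powr ((1 - b) - 1) * (1 - w) powr ((1 - a) - 1)))"
      using t by (auto simp: indicator_def ennreal_mult'[symmetric] zero_less_mult_iff)
  qed
  also have "\<dots> = ennreal (t powr (- a - b)) * (\<integral>\<^sup>+w. ennreal (indicator {0..1} w * (w powr ((1 - b) - 1) * (1 - w) powr ((1 - a) - 1))) \<partial>lborel)"
    by (rule nn_integral_cmult) measurable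
  also have "(\<integral>\<^sup>+w. ennreal (indicator {0..1} w * (w powr ((1 - b) - 1) * (1 - w) powr ((1 - a) - 1))) \<partial>lborel) = ennreal (Beta (1 - b) (1 - a))"
    using a b by (intro nn_integral_has_integral_lebesgue has_integral_Beta_real) auto
  finally have "(\<integral>\<^sup>+\<tau>. ennreal (indicator {0<..<t} \<tau> * ((t - \<tau>) powr - a * \<tau> powr - b)) \<partial>lborel)
      \<le> ennreal t * (ennreal (t powr (- a - b)) * ennreal (Beta (1 - b) (1 - a)))"
    unfolding eq1 by (rule mult_left_mono) simp
  also have "ennreal t * (ennreal (t powr (- a - b)) * ennreal (Beta (1 - b) (1 - a))) = ennreal (Beta (1 - b) (1 - a) * (t powr 1 * t powr (- a - b)))"
    using t by (simp add: ennreal_mult'[symmetric] mult_ac)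
  also have "t powr 1 * t powr (- a - b) = t powr (1 - a - b)"
    unfolding powr_add[symmetric] by (simp add: algebra_simps)
  finally show "(\<integral>\<^sup>+\<tau>. ennreal (indicator {0<..<t} \<tau> * ((t - \<tau>) powr - a * \<tau> powr - b)) \<partial>lborel) \<le> ennreal (Beta (1 - b) (1 - a) * t powr (1 - a - b))"
    .
qed

section \<open>The heat semigroup and the Duhamel term in weighted spaces\<close>

lemma integrable_norm_integral_le:
  fixes f :: "'a \<Rightarrow> 'b::{banach, second_countable_topology}"
  assumes f: "f \<in> borel_measurable M" and le: "(\<integral>\<^sup>+x. norm (f x) \<partial>M) \<le> ennreal B" and B: "0 \<le> B"
  shows "integrable M f" and "norm (integral\<^sup>L M f) \<le> B"
proof -
  show int: "integrable M f"
    using f le by (intro integrableI_bounded) (auto intro: le_less_trans)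
  have "ennreal (norm (integral\<^sup>L M f)) \<le> ennreal B"
    using integral_norm_bound_ennreal[OF int] le by (rule order_trans)
  then show "norm (integral\<^sup>L M f) \<le> B" using B by simp
qed

lemma borel_measurable_vec_lambda [measurable (raw)]:
  fixes f :: "'a \<Rightarrow> 'n::finite \<Rightarrow> 'b::euclidean_space"
  assumes "\<And>i. (\<lambda>w. f w i) \<in> borel_measurable M"
  shows "(\<lambda>w. \<chi> i. f w i) \<in> borel_measurable M"
proof (subst borel_measurable_euclidean_space, intro ballI)
  fix b :: "'b^'n" assume "b \<in> Basis"
  then obtain i c where b: "b = axis i c" by (auto simp: Basis_vec_def)
  show "(\<lambda>w. (\<chi> i. f w i) \<bullet> b) \<in> borel_measurable M"
    unfolding b inner_axis using assms[of i] by simp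
qed

lemma measurable_vec_nth_nth_compose [measurable (raw)]:
  fixes f :: "'a \<Rightarrow> real^'n^'m"
  assumes "f \<in> borel_measurable M"
  shows "(\<lambda>w. f w $ i $ j) \<in> borel_measurable M"
proof -
  have "f w $ i $ j = f w \<bullet> axis i (axis j 1)" for w
    by (simp add: inner_axis)
  then show ?thesis using assms by simp
qed

text \<open>Over \<open>lborel\<close> the integrand is jointly Borel measurable in
  \<open>\<xi>\<close> and the parameters, so integrating out \<open>\<xi>\<close> preserves
  measurability; this is why \<open>lebesgue\<close> is left.\<close>

lemma measurable_oseen_kernel [measurable (raw)]:
  fixes g :: "'a \<Rightarrow> real^'n"
  assumes f: "f \<in> borel_measurable M" and g: "g \<in> borel_measurable M"
  shows "(\<lambda>w. oseen_kernel (f w) j k l (g w)) \<in> borel_measurable M"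
proof -
  have "(\<lambda>w. Re (LINT \<xi>|lborel. exp (\<i> * complex_of_real (g w \<bullet> \<xi>)) * oseen_symbol (f w) j k l \<xi>)
      / (2 * pi) ^ CARD('n)) \<in> borel_measurable M"
    unfolding oseen_symbol_def using f g by measurable
  also have "(\<lambda>w. Re (LINT \<xi>|lborel. exp (\<i> * complex_of_real (g w \<bullet> \<xi>)) * oseen_symbol (f w) j k l \<xi>)
      / (2 * pi) ^ CARD('n)) = (\<lambda>w. oseen_kernel (f w) j k l (g w))"
    unfolding oseen_kernel_def by (subst integral_completion) simp_all
  finally show ?thesis .
qed

lemma measurable_heat_kernel [measurable (raw)]:
  assumes "f \<in> borel_measurable M" "g \<in> borel_measurable M"
  shows "(\<lambda>w. heat_kernel (f w) (g w)) \<in> borel_measurable M"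
  unfolding heat_kernel_def using assms by measurable

lemma oseen_eq_lborel:
  fixes F :: "real^'n \<Rightarrow> real^'n^'n"
  assumes [measurable]: "F \<in> borel_measurable borel"
  shows "oseen s F x = (\<chi> j. \<Sum>k\<in>UNIV. \<Sum>l\<in>UNIV. LINT y|lborel. oseen_kernel s j k l (x - y) * F y $ k $ l)"
  unfolding oseen_def by (subst integral_completion) simp_all

text \<open>The constant precedes all other quantifiers, including \<open>\<gamma>\<close>, and
  depends on the dimension alone. \<open>E\<close> is any bound for the convolution at the given
  point, so that one statement serves all weights.\<close>

lemma oseen_bound:
  obtains C where "C > 0" "\<forall>s>0. \<forall>(F :: real^'n \<Rightarrow> real^'n^'n) x A E \<gamma>.
     F \<in> borel_measurable borel \<longrightarrow> 0 \<le> A \<longrightarrow> 0 \<le> E \<longrightarrow>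
     (\<forall>y k l. y \<noteq> 0 \<longrightarrow> \<bar>F y $ k $ l\<bar> \<le> A * norm y powr - \<gamma>) \<longrightarrow>
     (\<integral>\<^sup>+y. ennreal (decay_profile s (x - y) * norm y powr - \<gamma>) \<partial>lborel) \<le> ennreal E \<longrightarrow>
     oseen_converges s F x \<and> norm (oseen s F x) \<le> C * A * s powr (- (1/2)) * E"
proof -
  obtain C where C: "C > 0" "\<And>t j k l (x::real^'n). t > 0 \<Longrightarrow> \<bar>oseen_kernel t j k l x\<bar> \<le> C * t powr (- (1/2)) * decay_profile t x"
    using oseen_kernel_le_decay_profile by meson
  define d where "d = real CARD('n)"
  have "oseen_converges s F x \<and> norm (oseen s F x) \<le> (d * (d * (d * C))) * A * s powr (- (1/2)) * E"
    if s: "s > 0" and F[measurable]: "F \<in> borel_measurable borel" and A: "0 \<le> A" and E: "0 \<le> E"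
      and FA: "\<And>y k l. y \<noteq> 0 \<Longrightarrow> \<bar>F y $ k $ l\<bar> \<le> A * norm y powr - \<gamma>"
      and conv: "(\<integral>\<^sup>+y. ennreal (decay_profile s (x - y) * norm y powr - \<gamma>) \<partial>lborel) \<le> ennreal E"
    for s and F :: "real^'n \<Rightarrow> real^'n^'n" and x A E \<gamma>
  proof -
    define B where "B = C * s powr (- (1/2)) * A * E"
    have B: "B \<ge> 0" using C A E by (simp add: B_def)
    have meas: "(\<lambda>y. oseen_kernel s j k l (x - y) * F y $ k $ l) \<in> borel_measurable lborel" for j k l
      by measurable
    have nn: "(\<integral>\<^sup>+y. norm (oseen_kernel s j k l (x - y) * F y $ k $ l) \<partial>lborel) \<le> ennreal B" for j k l
    proof -
      have "(\<integral>\<^sup>+y. norm (oseen_kernel s j k l (x - y) * F y $ k $ l) \<partial>lborel)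
        \<le> (\<integral>\<^sup>+y. ennreal (C * s powr (- (1/2)) * A) * ennreal (decay_profile s (x - y) * norm y powr - \<gamma>) \<partial>lborel)"
        using AE_lborel_singleton[of "0::real^'n"]
      proof (intro nn_integral_mono_AE, eventually_elim)
        fix y :: "real^'n" assume y: "y \<noteq> 0"
        have "norm (oseen_kernel s j k l (x - y) * F y $ k $ l)
            \<le> (C * s powr (- (1/2)) * decay_profile s (x - y)) * (A * norm y powr - \<gamma>)"
          using C(2)[OF s, of j k l "x - y"] FA[OF y, of k l]
          by (simp add: abs_mult mult_mono' decay_profile_nonneg)
        then show "ennreal (norm (oseen_kernel s j k l (x - y) * F y $ k $ l))
          \<le> ennreal (C * s powr (- (1/2)) * A) * ennreal (decay_profile s (x - y) * norm y powr - \<gamma>)"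
          using C A by (simp add: ennreal_mult'[symmetric] decay_profile_nonneg ennreal_leI mult_ac)
      qed
      also have "\<dots> = ennreal (C * s powr (- (1/2)) * A) * (\<integral>\<^sup>+y. ennreal (decay_profile s (x - y) * norm y powr - \<gamma>) \<partial>lborel)"
        by (rule nn_integral_cmult) measurable
      also have "\<dots> \<le> ennreal (C * s powr (- (1/2)) * A) * ennreal E"
        by (intro mult_left_mono conv) simp
      also have "\<dots> = ennreal B"
        using C A E by (simp add: B_def ennreal_mult'[symmetric])
      finally show ?thesis .
    qed
    have int: "integrable lborel (\<lambda>y. oseen_kernel s j k l (x - y) * F y $ k $ l)"
      and le: "\<bar>LINT y|lborel. oseen_kernel s j k l (x - y) * F y $ k $ l\<bar> \<le> B" for j k l
      using integrable_norm_integral_le[OF meas nn B] by auto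
    have "oseen_converges s F x"
      unfolding oseen_converges_def using int by (simp add: integrable_completion)
    \<comment> \<open>One factor \<open>d\<close> each from the sums over \<open>l\<close> and
      \<open>k\<close>, and one from bounding the norm by the sum of the components.\<close>
    moreover have "norm (oseen s F x) \<le> d * (d * (d * B))"
    proof -
      have "\<bar>oseen s F x $ j\<bar> \<le> d * (d * B)" for j
      proof -
        have "\<bar>oseen s F x $ j\<bar> \<le> (\<Sum>k\<in>UNIV. \<bar>\<Sum>l\<in>UNIV. LINT y|lborel. oseen_kernel s j k l (x - y) * F y $ k $ l\<bar>)"
          by (simp add: oseen_eq_lborel sum_abs)
        also have "\<dots> \<le> (\<Sum>k\<in>(UNIV::'n set). \<Sum>l\<in>(UNIV::'n set). B)"
          by (intro sum_mono order_trans[OF sum_abs] le)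
        also have "\<dots> = d * (d * B)" by (simp add: d_def)
        finally show ?thesis .
      qed
      then have "(\<Sum>j\<in>UNIV. \<bar>oseen s F x $ j\<bar>) \<le> (\<Sum>j\<in>(UNIV::'n set). d * (d * B))"
        by (intro sum_mono)
      then show ?thesis
        using norm_le_l1_cart[of "oseen s F x"] by (simp add: d_def)
    qed
    ultimately show ?thesis by (simp add: B_def mult_ac)
  qed
  moreover have "d * (d * (d * C)) > 0" using C by (simp add: d_def)
  ultimately show thesis using that by blast
qed

text \<open>The argument is a tensor field and not a velocity: this makes the operator linear, so
  that it applies to differences of quadratic terms.\<close>

definition duhamel :: "(real \<Rightarrow> real^'n \<Rightarrow> real^'n^'n) \<Rightarrow> real \<Rightarrow> real^'n \<Rightarrow> real^'n" where
  "duhamel F t x = (LINT \<tau>:{0<..<t}|lebesgue. oseen (t - \<tau>) (F \<tau>) x)"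

definition duhamel_converges :: "(real \<Rightarrow> real^'n \<Rightarrow> real^'n^'n) \<Rightarrow> real \<Rightarrow> real^'n \<Rightarrow> bool" where
  "duhamel_converges F t x \<longleftrightarrow> (\<forall>\<tau>\<in>{0<..<t}. oseen_converges (t - \<tau>) (F \<tau>) x) \<and>
    set_integrable lebesgue {0<..<t} (\<lambda>\<tau>. oseen (t - \<tau>) (F \<tau>) x)"

lemma measurable_oseen_compose:
  fixes F :: "real \<Rightarrow> real^'n \<Rightarrow> real^'n^'n"
  assumes F: "(\<lambda>(t, x). F t x) \<in> borel_measurable (borel \<Otimes>\<^sub>M borel)"
    and f: "f \<in> borel_measurable M" and g: "g \<in> borel_measurable M" and h: "h \<in> borel_measurable M"
  shows "(\<lambda>w. oseen (f w) (F (g w)) (h w)) \<in> borel_measurable M"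
proof -
  have F'[measurable (raw)]: "(\<lambda>w. F (a w) (b w)) \<in> borel_measurable N"
    if "a \<in> borel_measurable N" "b \<in> borel_measurable N" for a b and N :: "'c measure"
    using measurable_compose[OF measurable_Pair[OF that] F] by simp
  have "F t \<in> borel_measurable borel" for t by measurable
  then have "(\<lambda>w. oseen (f w) (F (g w)) (h w)) = (\<lambda>w. \<chi> j. \<Sum>k\<in>UNIV. \<Sum>l\<in>UNIV.
      LINT y|lborel. oseen_kernel (f w) j k l (h w - y) * F (g w) y $ k $ l)"
    by (simp add: oseen_eq_lborel)
  also have "\<dots> \<in> borel_measurable M"
    using f g h by measurable
  finally show ?thesis .
qed

lemma duhamel_eq_lborel:
  fixes F :: "real \<Rightarrow> real^'n \<Rightarrow> real^'n^'n"
  assumes F: "(\<lambda>(t, x). F t x) \<in> borel_measurable (borel \<Otimes>\<^sub>M borel)"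
  shows "duhamel F t x = (LINT \<tau>|lborel. indicator {0<..<t} \<tau> *\<^sub>R oseen (t - \<tau>) (F \<tau>) x)"
  unfolding duhamel_def set_lebesgue_integral_def
  by (intro integral_completion borel_measurable_scaleR measurable_oseen_compose[OF F]) auto

lemma measurable_duhamel:
  fixes F :: "real \<Rightarrow> real^'n \<Rightarrow> real^'n^'n"
  assumes F: "(\<lambda>(t, x). F t x) \<in> borel_measurable (borel \<Otimes>\<^sub>M borel)"
  shows "(\<lambda>(t, x). duhamel F t x) \<in> borel_measurable (borel \<Otimes>\<^sub>M borel)"
proof -
  note [measurable (raw)] = measurable_oseen_compose[OF F]
  have "(\<lambda>(t, x). LINT \<tau>|lborel. indicator {0<..<t} \<tau> *\<^sub>R oseen (t - \<tau>) (F \<tau>) x) \<in> borel_measurable (borel \<Otimes>\<^sub>M borel)"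
    unfolding indicator_def greaterThanLessThan_iff by measurable
  then show ?thesis by (simp add: duhamel_eq_lborel[OF F])
qed

lemma oseen_diff:
  assumes "oseen_converges s F x" "oseen_converges s G x"
  shows "oseen s (\<lambda>y. F y - G y) x = oseen s F x - oseen s G x"
  using assms unfolding oseen_converges_def oseen_def
  by (simp add: vec_eq_iff right_diff_distrib sum_subtractf)

lemma duhamel_diff:
  assumes F: "duhamel_converges F t x" and G: "duhamel_converges G t x"
  shows "duhamel (\<lambda>\<tau> y. F \<tau> y - G \<tau> y) t x = duhamel F t x - duhamel G t x"
proof -
  have "duhamel (\<lambda>\<tau> y. F \<tau> y - G \<tau> y) t x = (LINT \<tau>:{0<..<t}|lebesgue. oseen (t - \<tau>) (F \<tau>) x - oseen (t - \<tau>) (G \<tau>) x)"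
    unfolding duhamel_def using F G
    by (intro set_lebesgue_integral_cong) (auto simp: duhamel_converges_def oseen_diff)
  also have "\<dots> = duhamel F t x - duhamel G t x"
    unfolding duhamel_def using F G by (intro set_integral_diff) (auto simp: duhamel_converges_def)
  finally show ?thesis .
qed

text \<open>The junk value \<open>0 powr 0 = 0\<close> is the reason for the case distinction on \<open>\<theta> = 0\<close>.\<close>

definition spatial_weight :: "real \<Rightarrow> real^'n \<Rightarrow> real" where
  "spatial_weight \<theta> x = (if \<theta> = 0 then 1 else norm x powr - \<theta>)"

text \<open>The convolution trades the spatial order \<open>\<gamma>\<close> for the order
  \<open>\<theta>\<close> at the price
  \<open>(t - \<tau>) powr (- (\<gamma> - \<theta>) / 2)\<close>. Together with the kernel's own
  \<open>(t - \<tau>) powr (- (1/2))\<close> this stays integrable in time because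
  \<open>\<gamma> - \<theta> < 1\<close>. The choice \<open>\<theta> = 0\<close> covers the
  origin.\<close>

lemma duhamel_bound:
  fixes \<gamma> \<theta> b :: real
  assumes \<gamma>: "0 \<le> \<theta>" "\<theta> \<le> \<gamma>" "\<gamma> < real CARD('n)" "\<gamma> - \<theta> < 1" and b: "b < 1"
  obtains C where "C > 0" "\<forall>(F :: real \<Rightarrow> real^'n \<Rightarrow> real^'n^'n) t x A.
     (\<lambda>(t, x). F t x) \<in> borel_measurable (borel \<Otimes>\<^sub>M borel) \<longrightarrow> 0 < t \<longrightarrow> 0 \<le> A \<longrightarrow> x \<noteq> 0 \<or> \<theta> = 0 \<longrightarrow>
     (\<forall>\<tau> y k l. 0 < \<tau> \<longrightarrow> \<tau> < t \<longrightarrow> y \<noteq> 0 \<longrightarrow> \<bar>F \<tau> y $ k $ l\<bar> \<le> A * norm y powr - \<gamma> * \<tau> powr - b) \<longrightarrow>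
     duhamel_converges F t x \<and>
     norm (duhamel F t x) \<le> C * A * spatial_weight \<theta> x * t powr (1/2 - (\<gamma> - \<theta>) / 2 - b)"
proof -
  define c where "c = (\<gamma> - \<theta>) / 2"
  have "2 * c < 1" using \<gamma>(4) by (simp add: c_def)
  then have c: "1/2 + c < 1" by linarith
  obtain C1 where C1: "C1 > 0" "\<forall>s>0. \<forall>(F :: real^'n \<Rightarrow> real^'n^'n) x A E \<gamma>.
     F \<in> borel_measurable borel \<longrightarrow> 0 \<le> A \<longrightarrow> 0 \<le> E \<longrightarrow>
     (\<forall>y k l. y \<noteq> 0 \<longrightarrow> \<bar>F y $ k $ l\<bar> \<le> A * norm y powr - \<gamma>) \<longrightarrow>
     (\<integral>\<^sup>+y. ennreal (decay_profile s (x - y) * norm y powr - \<gamma>) \<partial>lborel) \<le> ennreal E \<longrightarrow>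
     oseen_converges s F x \<and> norm (oseen s F x) \<le> C1 * A * s powr (- (1/2)) * E"
    by (rule oseen_bound)
  have "\<exists>D>0. \<forall>t>0. \<forall>x::real^'n. x \<noteq> 0 \<or> \<theta> = 0 \<longrightarrow>
     (\<integral>\<^sup>+y. ennreal (decay_profile t (x - y) * norm y powr - \<gamma>) \<partial>lborel) \<le> ennreal (D * spatial_weight \<theta> x * t powr - c)"
  proof -
    obtain D where D: "D > 0" "\<forall>t>0. \<forall>x::real^'n.
     (\<integral>\<^sup>+y. ennreal (decay_profile t (x - y) * norm y powr - \<gamma>) \<partial>lborel) \<le> ennreal (D * t powr (- \<gamma> / 2)) \<and>
     (\<forall>\<theta>. x \<noteq> 0 \<and> 0 \<le> \<theta> \<and> \<theta> \<le> \<gamma> \<longrightarrow>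
       (\<integral>\<^sup>+y. ennreal (decay_profile t (x - y) * norm y powr - \<gamma>) \<partial>lborel)
         \<le> ennreal (D * norm x powr - \<theta> * t powr (- (\<gamma> - \<theta>) / 2)))"
      using decay_profile_convolution_interpolated[OF order_trans[OF \<gamma>(1,2)] \<gamma>(3)] by blast
    have eq: "- c = - (\<gamma> - \<theta>) / 2" unfolding c_def by (rule minus_divide_left)
    show ?thesis unfolding eq using D \<gamma> by (intro exI[of _ D]) (auto simp: spatial_weight_def)
  qed
  then obtain D where D: "D > 0" "\<And>t (x::real^'n). t > 0 \<Longrightarrow> x \<noteq> 0 \<or> \<theta> = 0 \<Longrightarrow>
     (\<integral>\<^sup>+y. ennreal (decay_profile t (x - y) * norm y powr - \<gamma>) \<partial>lborel) \<le> ennreal (D * spatial_weight \<theta> x * t powr - c)"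
    by blast
  obtain C2 where C2: "C2 > 0" "\<And>t. t > 0 \<Longrightarrow> (\<integral>\<^sup>+\<tau>. ennreal (indicator {0<..<t} \<tau> * ((t - \<tau>) powr - (1/2 + c) * \<tau> powr - b)) \<partial>lborel)
     \<le> ennreal (C2 * t powr (1 - (1/2 + c) - b))"
    using nn_integral_beta_le[OF c b] by blast
  have w: "0 \<le> spatial_weight \<theta> x" for x :: "real^'n" by (simp add: spatial_weight_def)
  have main: "duhamel_converges F t x \<and>
     norm (duhamel F t x) \<le> (C1 * D * C2) * A * spatial_weight \<theta> x * t powr (1/2 - (\<gamma> - \<theta>) / 2 - b)"
    if F: "(\<lambda>(t, x). F t x) \<in> borel_measurable (borel \<Otimes>\<^sub>M borel)" and t: "0 < t" and A: "0 \<le> A"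
      and x: "x \<noteq> 0 \<or> \<theta> = 0"
      and FA: "\<And>\<tau> y k l. 0 < \<tau> \<Longrightarrow> \<tau> < t \<Longrightarrow> y \<noteq> 0 \<Longrightarrow> \<bar>F \<tau> y $ k $ l\<bar> \<le> A * norm y powr - \<gamma> * \<tau> powr - b"
    for F :: "real \<Rightarrow> real^'n \<Rightarrow> real^'n^'n" and t x A
  proof -
    define K where "K = C1 * A * D * spatial_weight \<theta> x"
    have K: "K \<ge> 0" using C1 A D w by (simp add: K_def)
    have Fm: "F \<tau> \<in> borel_measurable borel" for \<tau>
      using measurable_compose[OF measurable_Pair1' F, of \<tau>] by simp
    have os: "oseen_converges (t - \<tau>) (F \<tau>) x \<and> norm (oseen (t - \<tau>) (F \<tau>) x) \<le> K * ((t - \<tau>) powr - (1/2 + c) * \<tau> powr - b)"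
      if \<tau>: "0 < \<tau>" "\<tau> < t" for \<tau>
    proof -
      have "oseen_converges (t - \<tau>) (F \<tau>) x \<and> norm (oseen (t - \<tau>) (F \<tau>) x)
          \<le> C1 * (A * \<tau> powr - b) * (t - \<tau>) powr (- (1/2)) * (D * spatial_weight \<theta> x * (t - \<tau>) powr - c)"
      proof (intro C1(2)[rule_format, where \<gamma> = \<gamma>])
        show "\<bar>F \<tau> y $ k $ l\<bar> \<le> A * \<tau> powr - b * norm y powr - \<gamma>" if "y \<noteq> 0" for y k l
          using FA[OF \<tau> that, of k l] by (simp add: mult_ac)
      qed (use \<tau> A D w x Fm in auto)
      moreover have "(t - \<tau>) powr (- (1/2)) * (t - \<tau>) powr - c = (t - \<tau>) powr - (1/2 + c)"
        by (simp add: powr_add[symmetric])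
      then have "C1 * (A * \<tau> powr - b) * (t - \<tau>) powr (- (1/2)) * (D * spatial_weight \<theta> x * (t - \<tau>) powr - c)
          = K * ((t - \<tau>) powr - (1/2 + c) * \<tau> powr - b)"
        unfolding K_def by (metis (no_types, opaque_lifting) mult.assoc mult.left_commute mult.commute)
      ultimately show ?thesis by simp
    qed
    let ?f = "\<lambda>\<tau>. indicator {0<..<t} \<tau> *\<^sub>R oseen (t - \<tau>) (F \<tau>) x"
    have meas: "?f \<in> borel_measurable lborel"
      by (intro borel_measurable_scaleR measurable_oseen_compose[OF F]) auto
    have "(\<integral>\<^sup>+\<tau>. norm (?f \<tau>) \<partial>lborel) \<le> (\<integral>\<^sup>+\<tau>. ennreal K * ennreal (indicator {0<..<t} \<tau> * ((t - \<tau>) powr - (1/2 + c) * \<tau> powr - b)) \<partial>lborel)"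
      using os K by (intro nn_integral_mono) (auto simp: indicator_def ennreal_mult'[symmetric] intro!: ennreal_leI)
    also have "\<dots> = ennreal K * (\<integral>\<^sup>+\<tau>. ennreal (indicator {0<..<t} \<tau> * ((t - \<tau>) powr - (1/2 + c) * \<tau> powr - b)) \<partial>lborel)"
      by (rule nn_integral_cmult) measurable
    also have "\<dots> \<le> ennreal K * ennreal (C2 * t powr (1 - (1/2 + c) - b))"
      using t by (intro mult_left_mono C2) auto
    also have "\<dots> = ennreal (K * (C2 * t powr (1 - (1/2 + c) - b)))"
      using K C2 by (simp add: ennreal_mult'[symmetric])
    finally have nn: "(\<integral>\<^sup>+\<tau>. norm (?f \<tau>) \<partial>lborel) \<le> ennreal (K * (C2 * t powr (1 - (1/2 + c) - b)))" .
    have B: "0 \<le> K * (C2 * t powr (1 - (1/2 + c) - b))" using K C2 by simp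
    have int: "set_integrable lebesgue {0<..<t} (\<lambda>\<tau>. oseen (t - \<tau>) (F \<tau>) x)"
      unfolding set_integrable_def using meas integrable_norm_integral_le(1)[OF meas nn B]
      by (subst integrable_completion) auto
    have le: "norm (duhamel F t x) \<le> K * (C2 * t powr (1 - (1/2 + c) - b))"
      unfolding duhamel_eq_lborel[OF F] by (rule integrable_norm_integral_le(2)[OF meas nn B])
    have eq: "1 - (1/2 + c) - b = 1/2 - (\<gamma> - \<theta>) / 2 - b"
      unfolding c_def by simp
    have "norm (duhamel F t x) \<le> (C1 * D * C2) * A * spatial_weight \<theta> x * t powr (1/2 - (\<gamma> - \<theta>) / 2 - b)"
      using le unfolding eq K_def by (simp only: mult_ac)
    then show ?thesis
      using os int unfolding duhamel_converges_def by auto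
  qed
  show thesis
  proof (rule that)
    show "C1 * D * C2 > 0" using C1(1) C2(1) D(1) by simp
  qed (intro allI impI, rule main; blast)
qed

text \<open>The datum is controlled almost everywhere only, but its convolution with the kernel is
  controlled at every point. One family of constants covers both weights, since both come from the
  same convolution estimate.\<close>

lemma heat_bound:
  fixes \<gamma> :: real
  assumes \<gamma>: "0 \<le> \<gamma>" "\<gamma> < real CARD('n)"
  obtains C where "C > 0" "\<forall>(u :: real^'n \<Rightarrow> real^'n) t x A. u \<in> borel_measurable lebesgue \<longrightarrow> 0 < t \<longrightarrow> 0 \<le> A \<longrightarrow>
     (AE y in lebesgue. norm (u y) \<le> A * norm y powr - \<gamma>) \<longrightarrow>
     integrable lebesgue (\<lambda>y. heat_kernel t (x - y) *\<^sub>R u y) \<and>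
     norm (heat t u x) \<le> C * A * t powr (- \<gamma> / 2) \<and>
     (x \<noteq> 0 \<longrightarrow> norm (heat t u x) \<le> C * A * norm x powr - \<gamma>)"
proof -
  obtain C where C: "C > 0" "\<And>t (z::real^'n). t > 0 \<Longrightarrow> heat_kernel t z \<le> C * decay_profile t z"
    using heat_kernel_le_decay_profile by blast
  obtain D where D: "D > 0" "\<And>t (x::real^'n). t > 0 \<Longrightarrow>
     (\<integral>\<^sup>+y. ennreal (decay_profile t (x - y) * norm y powr - \<gamma>) \<partial>lborel) \<le> ennreal (D * t powr (- \<gamma> / 2))"
     "\<And>t (x::real^'n). t > 0 \<Longrightarrow> x \<noteq> 0 \<Longrightarrow>
     (\<integral>\<^sup>+y. ennreal (decay_profile t (x - y) * norm y powr - \<gamma>) \<partial>lborel) \<le> ennreal (D * norm x powr - \<gamma>)"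
    using decay_profile_convolution[OF \<gamma>] by meson
  have *: "integrable lebesgue (\<lambda>y. heat_kernel t (x - y) *\<^sub>R u y) \<and> norm (heat t u x) \<le> (C * D) * A * E"
    if u: "u \<in> borel_measurable lebesgue" and t: "0 < t" and A: "0 \<le> A" and E: "0 \<le> E"
      and AE: "AE y in lebesgue. norm (u y) \<le> A * norm y powr - \<gamma>"
      and le: "(\<integral>\<^sup>+y. ennreal (decay_profile t (x - y) * norm y powr - \<gamma>) \<partial>lborel) \<le> ennreal (D * E)"
    for u :: "real^'n \<Rightarrow> real^'n" and t x A E
  proof -
    have "(\<lambda>y. heat_kernel t (x - y)) \<in> borel_measurable lborel"
      by measurable
    then have meas: "(\<lambda>y. heat_kernel t (x - y) *\<^sub>R u y) \<in> borel_measurable lebesgue"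
      by (intro borel_measurable_scaleR u measurable_completion)
    have "(\<integral>\<^sup>+y. norm (heat_kernel t (x - y) *\<^sub>R u y) \<partial>lebesgue)
      \<le> (\<integral>\<^sup>+y. ennreal (C * A) * ennreal (decay_profile t (x - y) * norm y powr - \<gamma>) \<partial>lebesgue)"
      using AE
    proof (intro nn_integral_mono_AE, eventually_elim)
      fix y assume y: "norm (u y) \<le> A * norm y powr - \<gamma>"
      have "norm (heat_kernel t (x - y) *\<^sub>R u y) \<le> (C * decay_profile t (x - y)) * (A * norm y powr - \<gamma>)"
        using C(2)[OF t, of "x - y"] y heat_kernel_nonneg[of t "x - y"] by (simp add: mult_mono')
      then show "ennreal (norm (heat_kernel t (x - y) *\<^sub>R u y)) \<le> ennreal (C * A) * ennreal (decay_profile t (x - y) * norm y powr - \<gamma>)"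
        using C A by (simp add: ennreal_mult'[symmetric] decay_profile_nonneg ennreal_leI mult_ac)
    qed
    also have "\<dots> = ennreal (C * A) * (\<integral>\<^sup>+y. ennreal (decay_profile t (x - y) * norm y powr - \<gamma>) \<partial>lborel)"
      unfolding nn_integral_completion by (rule nn_integral_cmult) measurable
    also have "\<dots> \<le> ennreal (C * A) * ennreal (D * E)"
      by (intro mult_left_mono le) simp
    also have "\<dots> = ennreal ((C * D) * A * E)"
      using C A D E by (simp add: ennreal_mult'[symmetric] mult_ac)
    finally have nn: "(\<integral>\<^sup>+y. norm (heat_kernel t (x - y) *\<^sub>R u y) \<partial>lebesgue) \<le> ennreal ((C * D) * A * E)" .
    show ?thesis
      using integrable_norm_integral_le[OF meas nn] C D A E by (simp add: heat_def)
  qed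
  show thesis
  proof (rule that, safe)
    show "C * D > 0" using C D by simp
    fix u :: "real^'n \<Rightarrow> real^'n" and t A :: real and x :: "real^'n"
    assume u: "u \<in> borel_measurable lebesgue" "0 < t" "0 \<le> A" "AE y in lebesgue. norm (u y) \<le> A * norm y powr - \<gamma>"
    show "integrable lebesgue (\<lambda>y. heat_kernel t (x - y) *\<^sub>R u y)"
      and "norm (heat t u x) \<le> C * D * A * t powr (- \<gamma> / 2)"
      using *[OF u(1-3) _ u(4) D(2)[OF u(2)]] by auto
    show "norm (heat t u x) \<le> C * D * A * norm x powr - \<gamma>" if "x \<noteq> 0"
      using *[OF u(1-3) _ u(4) D(3)[OF u(2) that]] by auto
  qed
qed

section \<open>Picard iteration\<close>

definition quadratic :: "(real \<Rightarrow> real^'n \<Rightarrow> real^'n) \<Rightarrow> real \<Rightarrow> real^'n \<Rightarrow> real^'n^'n" where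
  "quadratic U \<tau> y = tensor (U \<tau> y) (U \<tau> y)"

lemma measurable_quadratic:
  fixes U :: "real \<Rightarrow> real^'n \<Rightarrow> real^'n"
  assumes "(\<lambda>(t, x). U t x) \<in> borel_measurable (borel \<Otimes>\<^sub>M borel)"
  shows "(\<lambda>(t, x). quadratic U t x) \<in> borel_measurable (borel \<Otimes>\<^sub>M borel)"
proof -
  have [measurable]: "(\<lambda>p. U (fst p) (snd p)) \<in> borel_measurable (borel \<Otimes>\<^sub>M borel)"
    using assms by (simp add: case_prod_beta')
  show ?thesis
    unfolding quadratic_def tensor_def case_prod_beta' by measurable
qed

lemma abs_quadratic_le: "\<bar>quadratic U \<tau> y $ k $ l\<bar> \<le> norm (U \<tau> y) * norm (U \<tau> y)"
  by (simp add: quadratic_def tensor_def abs_mult mult_mono component_le_norm_cart)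

lemma abs_quadratic_diff_le:
  "\<bar>quadratic U \<tau> y $ k $ l - quadratic V \<tau> y $ k $ l\<bar> \<le> (norm (U \<tau> y) + norm (V \<tau> y)) * norm (U \<tau> y - V \<tau> y)"
proof -
  have "quadratic U \<tau> y $ k $ l - quadratic V \<tau> y $ k $ l =
      U \<tau> y $ k * (U \<tau> y - V \<tau> y) $ l + (U \<tau> y - V \<tau> y) $ k * V \<tau> y $ l"
    by (simp add: quadratic_def tensor_def algebra_simps)
  also have "\<bar>\<dots>\<bar> \<le> norm (U \<tau> y) * norm (U \<tau> y - V \<tau> y) + norm (U \<tau> y - V \<tau> y) * norm (V \<tau> y)"
    by (rule order_trans[OF abs_triangle_ineq])
       (unfold abs_mult, intro add_mono mult_mono component_le_norm_cart abs_ge_zero norm_ge_zero)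
  finally show ?thesis by (simp add: algebra_simps)
qed

lemma geometric_increments_converge:
  fixes a :: "nat \<Rightarrow> 'a::banach"
  assumes a: "\<And>n. norm (a (Suc n) - a n) \<le> K * (1/2) ^ n"
  shows "a \<longlonglongrightarrow> lim a" and "norm (lim a - a n) \<le> 2 * K * (1/2) ^ n"
proof -
  have "summable (\<lambda>n. a (Suc n) - a n)"
    by (rule summable_comparison_test'[of "\<lambda>n. K * (1/2) ^ n" 0]) (auto intro!: summable_mult summable_geometric a)
  then have "(\<lambda>n. \<Sum>i<n. a (Suc i) - a i) \<longlonglongrightarrow> (\<Sum>n. a (Suc n) - a n)"
    by (rule summable_LIMSEQ)
  then have "(\<lambda>n. (\<Sum>i<n. a (Suc i) - a i) + a 0) \<longlonglongrightarrow> (\<Sum>n. a (Suc n) - a n) + a 0"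
    by (intro tendsto_intros)
  then have "convergent a"
    unfolding sum_lessThan_telescope convergent_def by auto
  then show lim: "a \<longlonglongrightarrow> lim a"
    by (simp add: convergent_LIMSEQ_iff)
  have K: "0 \<le> K" using order_trans[OF norm_ge_zero a[of 0]] by simp
  \<comment> \<open>The subtracted term turns the bound into the exact geometric sum, which is what
    lets the induction on \<open>m\<close> close.\<close>
  have "norm (a (m + n) - a n) \<le> 2 * K * ((1/2) ^ n - (1/2) ^ (m + n))" for m
  proof (induction m)
    case (Suc m)
    have "norm (a (Suc m + n) - a n) \<le> norm (a (Suc (m + n)) - a (m + n)) + norm (a (m + n) - a n)"
      using norm_triangle_ineq[of "a (Suc (m + n)) - a (m + n)" "a (m + n) - a n"] by simp
    also have "\<dots> \<le> K * (1/2) ^ (m + n) + 2 * K * ((1/2) ^ n - (1/2) ^ (m + n))"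
      by (intro add_mono a Suc.IH)
    also have "\<dots> = 2 * K * ((1/2) ^ n - (1/2) ^ (Suc m + n))" by (simp add: algebra_simps)
    finally show ?case .
  qed simp
  also have "2 * K * ((1/2) ^ n - (1/2) ^ (m + n)) \<le> 2 * K * (1/2) ^ n" for m
    using K by (intro mult_left_mono) auto
  finally have "norm (a (m + n) - a n) \<le> 2 * K * (1/2) ^ n" for m .
  then show "norm (lim a - a n) \<le> 2 * K * (1/2) ^ n"
    by (intro LIMSEQ_le_const2[OF tendsto_norm[OF tendsto_diff[OF LIMSEQ_ignore_initial_segment[OF lim, of n] tendsto_const]]]) auto
qed

text \<open>Isolates the fixed point argument from the kernel estimates. The exponents assumed for
  \<open>F\<close> are those of products: two factors in the \<alpha>-norm, or one in the
  \<alpha>-norm times one bounded by \<open>norm y powr - 1\<close> or by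
  \<open>\<tau> powr - (1/2)\<close>. Only \<open>\<delta>\<close> has to be small; \<open>M\<close>
  may be as large as the datum requires.\<close>

locale picard =
  fixes \<alpha> C \<delta> M :: real and H :: "real \<Rightarrow> real^'n \<Rightarrow> real^'n"
  assumes alpha: "0 < \<alpha>" "\<alpha> < 1"
    and const: "0 < C" "0 \<le> \<delta>" "0 \<le> M" "8 * C * \<delta> \<le> 1"
    and H_meas: "(\<lambda>(t, x). H t x) \<in> borel_measurable (borel \<Otimes>\<^sub>M borel)"
    and H_alpha: "0 < t \<Longrightarrow> x \<noteq> 0 \<Longrightarrow> norm (H t x) \<le> \<delta> * norm x powr - \<alpha> * t powr - ((1 - \<alpha>) / 2)"
    and H_one: "0 < t \<Longrightarrow> x \<noteq> 0 \<Longrightarrow> norm (H t x) \<le> M * norm x powr - 1"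
    and H_sup: "0 < t \<Longrightarrow> norm (H t x) \<le> M * t powr - (1/2)"
    and duhamel_alpha: "\<lbrakk>(\<lambda>(t, x). F t x) \<in> borel_measurable (borel \<Otimes>\<^sub>M borel); 0 < t; 0 \<le> A; x \<noteq> 0;
        \<And>\<tau> y k l. 0 < \<tau> \<Longrightarrow> y \<noteq> 0 \<Longrightarrow> \<bar>F \<tau> y $ k $ l\<bar> \<le> A * norm y powr - (2 * \<alpha>) * \<tau> powr - (1 - \<alpha>)\<rbrakk>
      \<Longrightarrow> norm (duhamel F t x) \<le> C * A * norm x powr - \<alpha> * t powr - ((1 - \<alpha>) / 2)"
    and duhamel_one: "\<lbrakk>(\<lambda>(t, x). F t x) \<in> borel_measurable (borel \<Otimes>\<^sub>M borel); 0 < t; 0 \<le> A; x \<noteq> 0;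
        \<And>\<tau> y k l. 0 < \<tau> \<Longrightarrow> y \<noteq> 0 \<Longrightarrow> \<bar>F \<tau> y $ k $ l\<bar> \<le> A * norm y powr - (1 + \<alpha>) * \<tau> powr - ((1 - \<alpha>) / 2)\<rbrakk>
      \<Longrightarrow> norm (duhamel F t x) \<le> C * A * norm x powr - 1"
    and duhamel_sup: "\<lbrakk>(\<lambda>(t, x). F t x) \<in> borel_measurable (borel \<Otimes>\<^sub>M borel); 0 < t; 0 \<le> A;
        \<And>\<tau> y k l. 0 < \<tau> \<Longrightarrow> y \<noteq> 0 \<Longrightarrow> \<bar>F \<tau> y $ k $ l\<bar> \<le> A * norm y powr - \<alpha> * \<tau> powr - (1 - \<alpha> / 2)\<rbrakk>
      \<Longrightarrow> duhamel_converges F t x \<and> norm (duhamel F t x) \<le> C * A * t powr - (1/2)"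
begin

text \<open>Balls of twice the size of the data in the three norms. The bound with
  \<open>\<tau>\<close> alone is required at every \<open>x\<close>, the others away from the
  origin, where the power would take its default value 0.\<close>

definition admissible :: "(real \<Rightarrow> real^'n \<Rightarrow> real^'n) \<Rightarrow> bool" where
  "admissible U \<longleftrightarrow> (\<lambda>(t, x). U t x) \<in> borel_measurable (borel \<Otimes>\<^sub>M borel) \<and>
    (\<forall>t>0. \<forall>x. x \<noteq> 0 \<longrightarrow> norm (U t x) \<le> 2 * \<delta> * norm x powr - \<alpha> * t powr - ((1 - \<alpha>) / 2)) \<and>
    (\<forall>t>0. \<forall>x. x \<noteq> 0 \<longrightarrow> norm (U t x) \<le> 2 * M * norm x powr - 1) \<and>
    (\<forall>t>0. \<forall>x. norm (U t x) \<le> 2 * M * t powr - (1/2))"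

lemma admissible_H: "admissible H"
  unfolding admissible_def
proof (intro conjI allI impI H_meas)
  fix t :: real and x :: "real^'n" assume t: "0 < t"
  have *: "a \<le> 2 * b" if "a \<le> b" "0 \<le> a" for a b :: real using that by simp
  show "norm (H t x) \<le> 2 * \<delta> * norm x powr - \<alpha> * t powr - ((1 - \<alpha>) / 2)" if "x \<noteq> 0"
    using *[OF H_alpha[OF t that]] by (simp add: mult.assoc)
  show "norm (H t x) \<le> 2 * M * norm x powr - 1" if "x \<noteq> 0"
    using *[OF H_one[OF t that]] by (simp add: mult.assoc)
  show "norm (H t x) \<le> 2 * M * t powr - (1/2)"
    using *[OF H_sup[OF t, of x]] by (simp add: mult.assoc)
qed

lemma powr_half_combine: "t powr - ((1 - \<alpha>) / 2) * t powr - (1/2) = t powr - (1 - \<alpha> / 2)"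
proof -
  have "- ((1 - \<alpha>) / 2) + - (1/2) = - (1 - \<alpha> / 2)" by (simp add: diff_divide_distrib)
  then show ?thesis by (metis powr_add)
qed

lemma duhamel_quadratic_sup:
  assumes U: "admissible U" and t: "0 < t"
  shows "duhamel_converges (quadratic U) t x" "norm (duhamel (quadratic U) t x) \<le> C * (4 * \<delta> * M) * t powr - (1/2)"
proof -
  have "duhamel_converges (quadratic U) t x \<and> norm (duhamel (quadratic U) t x) \<le> C * (4 * \<delta> * M) * t powr - (1/2)"
  proof (rule duhamel_sup[OF measurable_quadratic])
    fix \<tau> :: real and y :: "real^'n" and k l assume \<tau>: "0 < \<tau>" and y: "y \<noteq> 0"
    have "\<bar>quadratic U \<tau> y $ k $ l\<bar> \<le> norm (U \<tau> y) * norm (U \<tau> y)" by (rule abs_quadratic_le)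
    also have "\<dots> \<le> (2 * \<delta> * norm y powr - \<alpha> * \<tau> powr - ((1 - \<alpha>) / 2)) * (2 * M * \<tau> powr - (1/2))"
      using U \<tau> y by (intro mult_mono') (auto simp: admissible_def)
    also have "\<dots> = 4 * \<delta> * M * norm y powr - \<alpha> * (\<tau> powr - ((1 - \<alpha>) / 2) * \<tau> powr - (1/2))" by simp
    finally show "\<bar>quadratic U \<tau> y $ k $ l\<bar> \<le> 4 * \<delta> * M * norm y powr - \<alpha> * \<tau> powr - (1 - \<alpha> / 2)"
      unfolding powr_half_combine .
  qed (use U t const in \<open>auto simp: admissible_def\<close>)
  then show "duhamel_converges (quadratic U) t x" "norm (duhamel (quadratic U) t x) \<le> C * (4 * \<delta> * M) * t powr - (1/2)"
    by auto
qed

text \<open>Half of each radius is taken by \<open>H\<close>. The Duhamel term fits into the other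
  half because one factor always contributes \<open>2 * \<delta>\<close>, so its bound is linear in
  the remaining norm, with a coefficient made small by
  \<open>8 * C * \<delta> \<le> 1\<close>.\<close>

lemma admissible_step:
  assumes U: "admissible U"
  shows "admissible (\<lambda>t x. H t x - duhamel (quadratic U) t x)"
  unfolding admissible_def
proof (intro conjI allI impI)
  have Um: "(\<lambda>(t, x). U t x) \<in> borel_measurable (borel \<Otimes>\<^sub>M borel)" using U by (simp add: admissible_def)
  show "(\<lambda>(t, x). H t x - duhamel (quadratic U) t x) \<in> borel_measurable (borel \<Otimes>\<^sub>M borel)"
    using borel_measurable_diff[OF H_meas measurable_duhamel[OF measurable_quadratic[OF Um]]]
    by (simp add: case_prod_beta')
  have small: "C * (4 * \<delta> * B) * q \<le> B * q" if "0 \<le> B" "0 \<le> q" for B q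
  proof -
    have "(C * \<delta> * 4) * (B * q) \<le> 1 * (B * q)" using const that by (intro mult_right_mono) auto
    then show ?thesis by (simp add: mult_ac)
  qed
  fix t :: real and x :: "real^'n" assume t: "0 < t"
  have "norm (H t x - duhamel (quadratic U) t x) \<le> M * t powr - (1/2) + M * t powr - (1/2)"
    using H_sup[OF t, of x] duhamel_quadratic_sup(2)[OF U t, of x] small[of M "t powr - (1/2)"] const
    by (intro norm_triangle_le_diff add_mono) auto
  then show "norm (H t x - duhamel (quadratic U) t x) \<le> 2 * M * t powr - (1/2)" by simp
  assume x: "x \<noteq> 0"
  have "norm (duhamel (quadratic U) t x) \<le> C * (4 * \<delta> * \<delta>) * norm x powr - \<alpha> * t powr - ((1 - \<alpha>) / 2)"
  proof (rule duhamel_alpha[OF measurable_quadratic[OF Um] t _ x])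
    fix \<tau> :: real and y :: "real^'n" and k l assume \<tau>: "0 < \<tau>" and y: "y \<noteq> 0"
    have "\<bar>quadratic U \<tau> y $ k $ l\<bar> \<le> norm (U \<tau> y) * norm (U \<tau> y)" by (rule abs_quadratic_le)
    also have "\<dots> \<le> (2 * \<delta> * norm y powr - \<alpha> * \<tau> powr - ((1 - \<alpha>) / 2)) * (2 * \<delta> * norm y powr - \<alpha> * \<tau> powr - ((1 - \<alpha>) / 2))"
      using U \<tau> y by (intro mult_mono') (auto simp: admissible_def)
    also have "\<dots> = 4 * \<delta> * \<delta> * (norm y powr - \<alpha> * norm y powr - \<alpha>) * (\<tau> powr - ((1 - \<alpha>) / 2) * \<tau> powr - ((1 - \<alpha>) / 2))"
      by (simp only: mult_ac; simp)
    also have "norm y powr - \<alpha> * norm y powr - \<alpha> = norm y powr - (2 * \<alpha>)"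
      by (simp add: powr_add[symmetric])
    also have "\<tau> powr - ((1 - \<alpha>) / 2) * \<tau> powr - ((1 - \<alpha>) / 2) = \<tau> powr - (1 - \<alpha>)"
      unfolding powr_add[symmetric] by simp
    finally show "\<bar>quadratic U \<tau> y $ k $ l\<bar> \<le> 4 * \<delta> * \<delta> * norm y powr - (2 * \<alpha>) * \<tau> powr - (1 - \<alpha>)" .
  qed (use const in auto)
  also have "\<dots> \<le> \<delta> * (norm x powr - \<alpha> * t powr - ((1 - \<alpha>) / 2))"
    using small[of \<delta> "norm x powr - \<alpha> * t powr - ((1 - \<alpha>) / 2)"] const by (simp add: mult.assoc)
  finally have "norm (H t x - duhamel (quadratic U) t x) \<le> \<delta> * norm x powr - \<alpha> * t powr - ((1 - \<alpha>) / 2)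
      + \<delta> * (norm x powr - \<alpha> * t powr - ((1 - \<alpha>) / 2))"
    using H_alpha[OF t x] by (intro norm_triangle_le_diff add_mono)
  then show "norm (H t x - duhamel (quadratic U) t x) \<le> 2 * \<delta> * norm x powr - \<alpha> * t powr - ((1 - \<alpha>) / 2)"
    by (simp add: mult.assoc)
  have "norm (duhamel (quadratic U) t x) \<le> C * (4 * \<delta> * M) * norm x powr - 1"
  proof (rule duhamel_one[OF measurable_quadratic[OF Um] t _ x])
    fix \<tau> :: real and y :: "real^'n" and k l assume \<tau>: "0 < \<tau>" and y: "y \<noteq> 0"
    have "\<bar>quadratic U \<tau> y $ k $ l\<bar> \<le> norm (U \<tau> y) * norm (U \<tau> y)" by (rule abs_quadratic_le)
    also have "\<dots> \<le> (2 * M * norm y powr - 1) * (2 * \<delta> * norm y powr - \<alpha> * \<tau> powr - ((1 - \<alpha>) / 2))"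
      using U \<tau> y by (intro mult_mono') (auto simp: admissible_def)
    also have "\<dots> = 4 * \<delta> * M * (norm y powr - 1 * norm y powr - \<alpha>) * \<tau> powr - ((1 - \<alpha>) / 2)"
      by (simp only: mult_ac; simp)
    also have "norm y powr - 1 * norm y powr - \<alpha> = norm y powr - (1 + \<alpha>)"
      unfolding powr_add[symmetric] by simp
    finally show "\<bar>quadratic U \<tau> y $ k $ l\<bar> \<le> 4 * \<delta> * M * norm y powr - (1 + \<alpha>) * \<tau> powr - ((1 - \<alpha>) / 2)" .
  qed (use const in auto)
  also have "\<dots> \<le> M * norm x powr - 1" using const by (intro small) auto
  finally have "norm (H t x - duhamel (quadratic U) t x) \<le> M * norm x powr - 1 + M * norm x powr - 1"
    using H_one[OF t x] by (intro norm_triangle_le_diff add_mono)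
  then show "norm (H t x - duhamel (quadratic U) t x) \<le> 2 * M * norm x powr - 1" by simp
qed

text \<open>Distances are measured in the weight \<open>sqrt t\<close> alone, which sees every
  point. Smallness comes from the \<alpha>-norms of \<open>U\<close> and \<open>V\<close>: their sum
  \<open>4 * \<delta>\<close> multiplies the distance, and
  \<open>4 * C * \<delta> \<le> 1/2\<close>.\<close>

lemma duhamel_contraction:
  assumes U: "admissible U" and V: "admissible V" and Q: "0 \<le> Q"
    and diff: "\<And>t x. 0 < t \<Longrightarrow> norm (U t x - V t x) \<le> Q * t powr - (1/2)" and t: "0 < t"
  shows "norm (duhamel (quadratic U) t x - duhamel (quadratic V) t x) \<le> Q / 2 * t powr - (1/2)"
proof -
  let ?F = "\<lambda>\<tau> y. quadratic U \<tau> y - quadratic V \<tau> y"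
  have Um: "(\<lambda>(t, x). U t x) \<in> borel_measurable (borel \<Otimes>\<^sub>M borel)"
    and Vm: "(\<lambda>(t, x). V t x) \<in> borel_measurable (borel \<Otimes>\<^sub>M borel)" using U V by (simp_all add: admissible_def)
  have "norm (duhamel ?F t x) \<le> C * (4 * \<delta> * Q) * t powr - (1/2)"
  proof (rule duhamel_sup[THEN conjunct2])
    show "(\<lambda>(t, x). ?F t x) \<in> borel_measurable (borel \<Otimes>\<^sub>M borel)"
      using borel_measurable_diff[OF measurable_quadratic[OF Um] measurable_quadratic[OF Vm]]
      by (simp add: case_prod_beta')
    fix \<tau> :: real and y :: "real^'n" and k l assume \<tau>: "0 < \<tau>" and y: "y \<noteq> 0"
    let ?b = "2 * \<delta> * norm y powr - \<alpha> * \<tau> powr - ((1 - \<alpha>) / 2)"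
    have "\<bar>?F \<tau> y $ k $ l\<bar> \<le> (norm (U \<tau> y) + norm (V \<tau> y)) * norm (U \<tau> y - V \<tau> y)"
      using abs_quadratic_diff_le[of U \<tau> y k l V] by simp
    also have "\<dots> \<le> (?b + ?b) * (Q * \<tau> powr - (1/2))"
      using U V \<tau> y diff[OF \<tau>, of y] by (intro mult_mono' add_mono) (auto simp: admissible_def)
    also have "\<dots> = 4 * \<delta> * Q * norm y powr - \<alpha> * (\<tau> powr - ((1 - \<alpha>) / 2) * \<tau> powr - (1/2))" by simp
    finally show "\<bar>?F \<tau> y $ k $ l\<bar> \<le> 4 * \<delta> * Q * norm y powr - \<alpha> * \<tau> powr - (1 - \<alpha> / 2)"
      unfolding powr_half_combine .
  qed (use t const Q in auto)
  also have "\<dots> = (8 * C * \<delta>) * (Q / 2 * t powr - (1/2))" by simp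
  also have "\<dots> \<le> 1 * (Q / 2 * t powr - (1/2))"
    using const Q by (intro mult_right_mono) auto
  finally show ?thesis
    using duhamel_diff[OF duhamel_quadratic_sup(1)[OF U t] duhamel_quadratic_sup(1)[OF V t], of x] by simp
qed

primrec iterate :: "nat \<Rightarrow> real \<Rightarrow> real^'n \<Rightarrow> real^'n" where
  "iterate 0 = H"
| "iterate (Suc n) = (\<lambda>t x. H t x - duhamel (quadratic (iterate n)) t x)"

lemma admissible_iterate: "admissible (iterate n)"
  by (induction n) (auto intro: admissible_H admissible_step)

lemma iterate_increment:
  assumes "0 < t"
  shows "norm (iterate (Suc n) t x - iterate n t x) \<le> (4 * M * t powr - (1/2)) * (1/2) ^ n"
proof -
  have "\<forall>t>0. \<forall>x. norm (iterate (Suc n) t x - iterate n t x) \<le> (4 * M * (1/2) ^ n) * t powr - (1/2)"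
  proof (induction n)
    case 0
    show ?case
    proof (intro allI impI)
      fix t :: real and x :: "real^'n" assume "0 < t"
      then have "norm (iterate (Suc 0) t x) \<le> 2 * M * t powr - (1/2)" "norm (iterate 0 t x) \<le> 2 * M * t powr - (1/2)"
        using admissible_iterate unfolding admissible_def by blast+
      then have "norm (iterate (Suc 0) t x - iterate 0 t x) \<le> 2 * M * t powr - (1/2) + 2 * M * t powr - (1/2)"
        by (intro norm_triangle_le_diff add_mono)
      then show "norm (iterate (Suc 0) t x - iterate 0 t x) \<le> (4 * M * (1/2) ^ 0) * t powr - (1/2)" by simp
    qed
  next
    case (Suc n)
    show ?case
    proof (intro allI impI)
      fix t :: real and x :: "real^'n" assume t: "0 < t"
      have "norm (iterate (Suc (Suc n)) t x - iterate (Suc n) t x)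
          = norm (duhamel (quadratic (iterate (Suc n))) t x - duhamel (quadratic (iterate n)) t x)"
        by (simp add: norm_minus_commute)
      also have "\<dots> \<le> (4 * M * (1/2) ^ n) / 2 * t powr - (1/2)"
        using Suc.IH const t by (intro duhamel_contraction admissible_iterate) auto
      finally show "norm (iterate (Suc (Suc n)) t x - iterate (Suc n) t x) \<le> (4 * M * (1/2) ^ Suc n) * t powr - (1/2)"
        by simp
    qed
  qed
  then show ?thesis using assms by (simp add: mult_ac)
qed

text \<open>A pointwise limit, meaningful for \<open>t > 0\<close> only; the initial value is put in
  by hand in the theorem.\<close>

definition solution :: "real \<Rightarrow> real^'n \<Rightarrow> real^'n" where
  "solution t x = lim (\<lambda>n. iterate n t x)"

lemma iterate_tendsto_solution:
  assumes "0 < t"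
  shows "(\<lambda>n. iterate n t x) \<longlonglongrightarrow> solution t x"
    and "norm (solution t x - iterate n t x) \<le> (8 * M * (1/2) ^ n) * t powr - (1/2)"
  using geometric_increments_converge[where a = "\<lambda>n. iterate n t x", OF iterate_increment[OF assms]] by (simp_all add: solution_def mult_ac)

text \<open>All three bounds are closed under pointwise limits, so convergence in the single norm of
  the contraction suffices.\<close>

lemma admissible_solution: "admissible solution"
  unfolding admissible_def
proof (intro conjI allI impI)
  have "(\<lambda>p. iterate n (fst p) (snd p)) \<in> borel_measurable (borel \<Otimes>\<^sub>M borel)" for n
    using admissible_iterate[of n] by (simp add: admissible_def case_prod_beta')
  then have "(\<lambda>p. lim (\<lambda>n. iterate n (fst p) (snd p))) \<in> borel_measurable (borel \<Otimes>\<^sub>M borel)"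
    by (rule borel_measurable_lim_metric)
  then show "(\<lambda>(t, x). solution t x) \<in> borel_measurable (borel \<Otimes>\<^sub>M borel)"
    by (simp add: solution_def case_prod_beta')
  fix t :: real and x :: "real^'n" assume t: "0 < t"
  have lim: "norm (solution t x) \<le> B" if "\<And>n. norm (iterate n t x) \<le> B" for B
    using that by (intro LIMSEQ_le_const2[OF tendsto_norm[OF iterate_tendsto_solution(1)[OF t]]]) auto
  show "norm (solution t x) \<le> 2 * M * t powr - (1/2)"
    using t by (intro lim) (use admissible_iterate in \<open>auto simp: admissible_def\<close>)
  show "norm (solution t x) \<le> 2 * \<delta> * norm x powr - \<alpha> * t powr - ((1 - \<alpha>) / 2)"
    and "norm (solution t x) \<le> 2 * M * norm x powr - 1" if "x \<noteq> 0"
    using t that by (intro lim; use admissible_iterate in \<open>auto simp: admissible_def\<close>)+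
qed

text \<open>Passes to the limit in the recursion: the contraction estimate, applied to the solution
  and the \<open>n\<close>-th iterate, gives convergence of the Duhamel terms at every
  point.\<close>

lemma solution_eq:
  assumes t: "0 < t"
  shows "solution t x = H t x - duhamel (quadratic solution) t x"
proof -
  let ?r = "\<lambda>n. H t x - duhamel (quadratic (iterate n)) t x"
  have le: "norm (?r n - (H t x - duhamel (quadratic solution) t x)) \<le> (8 * M * t powr - (1/2) / 2) * (1/2) ^ n" for n
  proof -
    have "norm (duhamel (quadratic solution) t x - duhamel (quadratic (iterate n)) t x) \<le> (8 * M * (1/2) ^ n) / 2 * t powr - (1/2)"
      using const t by (intro duhamel_contraction admissible_iterate admissible_solution iterate_tendsto_solution) auto
    then show ?thesis by (simp add: mult_ac)
  qed
  have z: "(\<lambda>n. (8 * M * t powr - (1/2) / 2) * (1/2) ^ n) \<longlonglongrightarrow> 0"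
    by (intro tendsto_mult_right_zero LIMSEQ_power_zero) simp
  have "(\<lambda>n. ?r n - (H t x - duhamel (quadratic solution) t x)) \<longlonglongrightarrow> 0"
    by (rule Lim_null_comparison[OF always_eventually[OF allI[OF le]] z])
  then have "?r \<longlonglongrightarrow> H t x - duhamel (quadratic solution) t x"
    by (rule LIM_zero_cancel)
  moreover have "?r \<longlonglongrightarrow> solution t x"
    using LIMSEQ_Suc[OF iterate_tendsto_solution(1)[OF t, of x]] by simp
  ultimately show ?thesis by (rule LIMSEQ_unique[symmetric])
qed

end

section \<open>Decay at infinity and the theorem\<close>

lemma weighted_Linf_AE_le:
  fixes u :: "real^'n \<Rightarrow> 'b::euclidean_space"
  assumes "u \<in> weighted_Linf \<beta>"
  shows "\<exists>A\<ge>0. AE x in lebesgue. norm (u x) \<le> A * norm x powr - \<beta>"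
proof -
  define e where "e = weighted_Linf_norm \<beta> u"
  have e: "e < \<infinity>" using assms by (simp add: weighted_Linf_def e_def)
  define A where "A = max 0 (real_of_ereal e)"
  have A: "e \<le> ereal A" using e by (cases e) (auto simp: A_def)
  have "AE x in lebesgue. ereal (norm x powr \<beta> * norm (u x)) \<le> e"
    unfolding e_def weighted_Linf_norm_def by (rule esssup_AE)
  moreover have "AE x::real^'n in lebesgue. x \<noteq> 0"
    by (rule AE_completion[OF AE_lborel_singleton])
  ultimately have "AE x in lebesgue. norm (u x) \<le> A * norm x powr - \<beta>"
  proof eventually_elim
    case (elim x)
    have "ereal (norm x powr \<beta> * norm (u x)) \<le> ereal A" using elim(1) A by (rule order_trans)
    then have "norm x powr \<beta> * norm (u x) \<le> A" by simp
    then show ?case using elim(2) by (simp add: powr_minus field_simps)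
  qed
  moreover have "A \<ge> 0" by (simp add: A_def)
  ultimately show ?thesis by blast
qed

lemma ex_borel_vec_AE_eq:
  fixes u :: "real^'n \<Rightarrow> real^'n"
  assumes u: "u \<in> borel_measurable lebesgue"
  shows "\<exists>v\<in>borel_measurable borel. AE x in lebesgue. u x = v x"
proof -
  have "(\<lambda>x. u x $ i) \<in> borel_measurable lebesgue" for i
    using measurable_vec_nth_compose[OF u] .
  then have "\<forall>i. \<exists>g\<in>borel_measurable lborel. AE x in lborel. u x $ i = g x"
    using completion_ex_borel_measurable_real by blast
  then obtain g where g: "\<And>i. g i \<in> borel_measurable lborel" "\<And>i. AE x in lborel. u x $ i = g i x"
    by metis
  have "AE x in lborel. \<forall>i. u x $ i = g i x"
    using g(2) by (simp add: eventually_all_finite)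
  then have "AE x in lebesgue. u x = (\<chi> i. g i x)"
    by (intro AE_completion) (auto simp: vec_eq_iff)
  moreover have "(\<lambda>x. \<chi> i. g i x) \<in> borel_measurable borel"
    using g(1) by (intro borel_measurable_vec_lambda) simp
  ultimately show ?thesis by (intro bexI[of _ "\<lambda>x. \<chi> i. g i x"])
qed

text \<open>The datum is only Lebesgue measurable. A Borel version yields the same integrals at
  every \<open>(t, x)\<close> and makes the parameter integral jointly Borel measurable.\<close>

lemma measurable_heat:
  fixes u :: "real^'n \<Rightarrow> real^'n"
  assumes u: "u \<in> borel_measurable lebesgue"
  shows "(\<lambda>(t, x). heat t u x) \<in> borel_measurable (borel \<Otimes>\<^sub>M borel)"
proof -
  obtain v where v[measurable]: "v \<in> borel_measurable borel" and eq: "AE x in lebesgue. u x = v x"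
    using ex_borel_vec_AE_eq[OF u] by blast
  have "heat t u x = (LINT y|lborel. heat_kernel t (x - y) *\<^sub>R v y)" for t x
  proof -
    have k: "(\<lambda>y. heat_kernel t (x - y)) \<in> borel_measurable lborel"
      by measurable
    have "heat t u x = (LINT y|lebesgue. heat_kernel t (x - y) *\<^sub>R v y)"
      unfolding heat_def
    proof (rule integral_cong_AE)
      have v': "v \<in> borel_measurable lborel" using v by simp
      show "(\<lambda>y. heat_kernel t (x - y) *\<^sub>R u y) \<in> borel_measurable lebesgue"
        by (intro borel_measurable_scaleR measurable_completion[OF k] u)
      show "(\<lambda>y. heat_kernel t (x - y) *\<^sub>R v y) \<in> borel_measurable lebesgue"
        by (intro borel_measurable_scaleR measurable_completion[OF k] measurable_completion[OF v'])
    qed (use eq in auto)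
    also have "\<dots> = (LINT y|lborel. heat_kernel t (x - y) *\<^sub>R v y)"
      by (rule integral_completion) measurable
    finally show ?thesis .
  qed
  then show ?thesis by simp
qed

text \<open>Wherever \<open>|y| \<ge> 1\<close> the weight of \<open>U \<otimes> U\<close> is twice that of \<open>U\<close>, and wherever \<open>|y| < 1\<close> the
  bound \<open>|y| powr - b\<close> only becomes weaker as \<open>b\<close> grows; so the Duhamel term gains decay at infinity in every step.\<close>

lemma quadratic_weight_le:
  fixes U :: "real \<Rightarrow> real^'n \<Rightarrow> real^'n"
  assumes M: "0 \<le> M" and K: "0 \<le> K"
    and one: "norm (U \<tau> y) \<le> M * norm y powr - 1" and sup: "norm (U \<tau> y) \<le> M * \<tau> powr - (1/2)"
    and weight: "norm (U \<tau> y) \<le> K * norm y powr - b"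
    and b: "1 \<le> b'" "b' \<le> 2 * b" and \<tau>: "0 < \<tau>" "\<tau> < T" and y: "y \<noteq> 0"
  shows "\<bar>quadratic U \<tau> y $ k $ l\<bar> \<le> (K\<^sup>2 * sqrt T + M\<^sup>2) * norm y powr - b' * \<tau> powr - (1/2)"
proof -
  have "norm (U \<tau> y) * norm (U \<tau> y) \<le> (K\<^sup>2 * sqrt T + M\<^sup>2) * norm y powr - b' * \<tau> powr - (1/2)"
  proof (cases "norm y \<ge> 1")
    case True
    \<comment> \<open>The far region has no singularity in time; the factor
      \<open>\<tau> powr - (1/2)\<close> is inserted to match the near region. This is where the
      constant comes to depend on \<open>T\<close>.\<close>
    have "1 \<le> sqrt T * \<tau> powr - (1/2)"
      using \<tau> by (simp add: powr_minus powr_half_sqrt field_simps)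
    have "norm (U \<tau> y) * norm (U \<tau> y) \<le> (K * norm y powr - b) * (K * norm y powr - b)"
      using weight by (intro mult_mono') auto
    also have "\<dots> = K\<^sup>2 * norm y powr - (2 * b)"
      by (simp add: power2_eq_square powr_add[symmetric])
    also have "\<dots> \<le> K\<^sup>2 * norm y powr - b'"
      using True b by (intro mult_left_mono powr_mono) auto
    also have "\<dots> \<le> (K\<^sup>2 * norm y powr - b') * (sqrt T * \<tau> powr - (1/2))"
      using mult_left_mono[OF \<open>1 \<le> sqrt T * \<tau> powr - (1/2)\<close>, of "K\<^sup>2 * norm y powr - b'"] by simp
    also have "\<dots> \<le> (K\<^sup>2 * sqrt T + M\<^sup>2) * norm y powr - b' * \<tau> powr - (1/2)"
      using M by (simp add: algebra_simps)
    finally show ?thesis .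
  next
    case False
    have "norm (U \<tau> y) * norm (U \<tau> y) \<le> (M * norm y powr - 1) * (M * \<tau> powr - (1/2))"
      using one sup by (intro mult_mono') auto
    also have "\<dots> = M\<^sup>2 * norm y powr - 1 * \<tau> powr - (1/2)"
      by (simp add: power2_eq_square)
    also have "\<dots> \<le> M\<^sup>2 * norm y powr - b' * \<tau> powr - (1/2)"
      using False b y by (intro mult_right_mono mult_left_mono powr_mono') auto
    also have "\<dots> \<le> (K\<^sup>2 * sqrt T + M\<^sup>2) * norm y powr - b' * \<tau> powr - (1/2)"
      using \<tau> by (intro mult_right_mono) auto
    finally show ?thesis .
  qed
  then show ?thesis using abs_quadratic_le[of U \<tau> y k l] by linarith
qed

text \<open>The Duhamel estimate is used with equal spatial orders \<open>b'\<close> on both sides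
  and time exponent 1/2. The resulting power of \<open>t\<close> is 0, no spatial order is lost, and
  \<open>b'\<close> merely has to stay below the dimension. The decay of the linear part
  \<open>H\<close> limits how far the improvement goes.\<close>

lemma weight_improvement:
  fixes U H :: "real \<Rightarrow> real^'n \<Rightarrow> real^'n"
  assumes U: "(\<lambda>(t, x). U t x) \<in> borel_measurable (borel \<Otimes>\<^sub>M borel)"
    and eq: "\<And>t x. 0 < t \<Longrightarrow> U t x = H t x - duhamel (quadratic U) t x"
    and M: "0 \<le> M"
    and one: "\<And>t x. 0 < t \<Longrightarrow> x \<noteq> 0 \<Longrightarrow> norm (U t x) \<le> M * norm x powr - 1"
    and sup: "\<And>t x. 0 < t \<Longrightarrow> norm (U t x) \<le> M * t powr - (1/2)"
    and H: "\<And>t x. 0 < t \<Longrightarrow> x \<noteq> 0 \<Longrightarrow> norm (H t x) \<le> L * norm x powr - b'"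
    and K: "0 \<le> K" and T: "0 < T"
    and weight: "\<And>t x. 0 < t \<Longrightarrow> t < T \<Longrightarrow> x \<noteq> 0 \<Longrightarrow> norm (U t x) \<le> K * norm x powr - b"
    and b: "1 \<le> b'" "b' \<le> 2 * b" "b' < real CARD('n)"
  shows "\<exists>K'\<ge>0. \<forall>t x. 0 < t \<longrightarrow> t < T \<longrightarrow> x \<noteq> 0 \<longrightarrow> norm (U t x) \<le> K' * norm x powr - b'"
proof -
  have b0: "b' \<noteq> 0" "0 \<le> b'" using b by auto
  obtain C where C: "C > 0" "\<forall>(F :: real \<Rightarrow> real^'n \<Rightarrow> real^'n^'n) t x A.
     (\<lambda>(t, x). F t x) \<in> borel_measurable (borel \<Otimes>\<^sub>M borel) \<longrightarrow> 0 < t \<longrightarrow> 0 \<le> A \<longrightarrow> x \<noteq> 0 \<or> b' = 0 \<longrightarrow>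
     (\<forall>\<tau> y k l. 0 < \<tau> \<longrightarrow> \<tau> < t \<longrightarrow> y \<noteq> 0 \<longrightarrow> \<bar>F \<tau> y $ k $ l\<bar> \<le> A * norm y powr - b' * \<tau> powr - (1/2)) \<longrightarrow>
     duhamel_converges F t x \<and>
     norm (duhamel F t x) \<le> C * A * spatial_weight b' x * t powr (1/2 - (b' - b') / 2 - 1/2)"
    by (rule duhamel_bound[of b' b' "1/2", where 'n = 'n]) (use b in auto)
  define A where "A = K\<^sup>2 * sqrt T + M\<^sup>2"
  have A: "A \<ge> 0" using T by (simp add: A_def)
  have "norm (U t x) \<le> max 0 (L + C * A) * norm x powr - b'" if t: "0 < t" "t < T" and x: "x \<noteq> 0" for t x
  proof -
    have "norm (duhamel (quadratic U) t x) \<le> C * A * spatial_weight b' x * t powr (1/2 - (b' - b') / 2 - 1/2)"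
    proof (intro C(2)[rule_format, THEN conjunct2] measurable_quadratic[OF U] A t)
      fix \<tau> :: real and y :: "real^'n" and k l assume \<tau>: "0 < \<tau>" "\<tau> < t" and y: "y \<noteq> 0"
      then have \<tau>T: "\<tau> < T" using t by simp
      show "\<bar>quadratic U \<tau> y $ k $ l\<bar> \<le> A * norm y powr - b' * \<tau> powr - (1/2)"
        unfolding A_def by (rule quadratic_weight_le[where U = U, OF M K one[OF \<tau>(1) y] sup[OF \<tau>(1), of y] weight[OF \<tau>(1) \<tau>T y] b(1,2) \<tau>(1) \<tau>T y])
    qed (use x in simp)
    also have "\<dots> = C * A * norm x powr - b'"
      using b0 t by (simp add: spatial_weight_def)
    finally have "norm (U t x) \<le> L * norm x powr - b' + C * A * norm x powr - b'"
      unfolding eq[OF t(1)] using H[OF t(1) x] by (intro norm_triangle_le_diff add_mono)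
    also have "\<dots> = (L + C * A) * norm x powr - b'" by (simp add: algebra_simps)
    also have "\<dots> \<le> max 0 (L + C * A) * norm x powr - b'" by (intro mult_right_mono) auto
    finally show ?thesis .
  qed
  then show ?thesis by (intro exI[of _ "max 0 (L + C * A)"]) auto
qed

lemma SUP_prod_less_infinity:
  fixes f :: "'a \<Rightarrow> 'b \<Rightarrow> real"
  assumes "\<And>x t. t \<in> S \<Longrightarrow> f x t \<le> K"
  shows "(SUP (x, t) \<in> UNIV \<times> S. ereal (f x t)) < \<infinity>"
proof -
  have "(SUP (x, t) \<in> UNIV \<times> S. ereal (f x t)) \<le> ereal K"
    using assms by (intro SUP_least) auto
  then show ?thesis by (rule le_less_trans) simp
qed

theorem theorem3:
  fixes \<alpha> :: real
  assumes "CARD('n::finite) \<ge> 2" and "0 < \<alpha>" and "\<alpha> < 1"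
  shows "\<exists>\<delta>>0. \<forall>(\<beta>::real) (u0 :: real^'n \<Rightarrow> real^'n).
    1 \<le> \<beta> \<and> \<beta> < real CARD('n) \<longrightarrow>
    u0 \<in> weighted_Linf 1 \<inter> weighted_Linf \<beta> \<longrightarrow>
    divergence_free u0 \<longrightarrow>
    (SUP (x, t) \<in> UNIV \<times> {0<..}.
      ereal (norm x powr \<alpha> * t powr ((1 - \<alpha>) / 2) * norm (heat t u0 x))) \<le> ereal \<delta> \<longrightarrow>
    (\<exists>u. mild_solution \<infinity> u0 u \<and>
      (SUP (x, t) \<in> UNIV \<times> {0<..}. ereal ((norm x + sqrt t) * norm (u t x))) < \<infinity> \<and>
      (\<forall>T>0. (SUP (x, t) \<in> UNIV \<times> {0<..<T}. ereal (norm x powr \<beta> * norm (u t x))) < \<infinity>))"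
proof -
  have d2: "2 \<le> real CARD('n)" using assms(1) by simp
  \<comment> \<open>The three spatial orders \<open>2 * \<alpha>\<close>,
    \<open>1 + \<alpha>\<close> and \<open>\<alpha>\<close> are below 2; dimension at least 2 puts
    them in the admissible range.\<close>
  obtain C1 where C1: "C1 > 0" "\<forall>(F :: real \<Rightarrow> real^'n \<Rightarrow> real^'n^'n) t x A.
     (\<lambda>(t, x). F t x) \<in> borel_measurable (borel \<Otimes>\<^sub>M borel) \<longrightarrow> 0 < t \<longrightarrow> 0 \<le> A \<longrightarrow> x \<noteq> 0 \<or> \<alpha> = 0 \<longrightarrow>
     (\<forall>\<tau> y k l. 0 < \<tau> \<longrightarrow> \<tau> < t \<longrightarrow> y \<noteq> 0 \<longrightarrow> \<bar>F \<tau> y $ k $ l\<bar> \<le> A * norm y powr - (2 * \<alpha>) * \<tau> powr - (1 - \<alpha>)) \<longrightarrow>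
     duhamel_converges F t x \<and>
     norm (duhamel F t x) \<le> C1 * A * spatial_weight \<alpha> x * t powr (1/2 - (2 * \<alpha> - \<alpha>) / 2 - (1 - \<alpha>))"
    by (rule duhamel_bound[of \<alpha> "2 * \<alpha>" "1 - \<alpha>", where 'n = 'n]) (use assms d2 in auto)
  obtain C2 where C2: "C2 > 0" "\<forall>(F :: real \<Rightarrow> real^'n \<Rightarrow> real^'n^'n) t x A.
     (\<lambda>(t, x). F t x) \<in> borel_measurable (borel \<Otimes>\<^sub>M borel) \<longrightarrow> 0 < t \<longrightarrow> 0 \<le> A \<longrightarrow> x \<noteq> 0 \<or> (1::real) = 0 \<longrightarrow>
     (\<forall>\<tau> y k l. 0 < \<tau> \<longrightarrow> \<tau> < t \<longrightarrow> y \<noteq> 0 \<longrightarrow> \<bar>F \<tau> y $ k $ l\<bar> \<le> A * norm y powr - (1 + \<alpha>) * \<tau> powr - ((1 - \<alpha>) / 2)) \<longrightarrow>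
     duhamel_converges F t x \<and>
     norm (duhamel F t x) \<le> C2 * A * spatial_weight 1 x * t powr (1/2 - (1 + \<alpha> - 1) / 2 - (1 - \<alpha>) / 2)"
    by (rule duhamel_bound[of 1 "1 + \<alpha>" "(1 - \<alpha>) / 2", where 'n = 'n]) (use assms d2 in auto)
  obtain C3 where C3: "C3 > 0" "\<forall>(F :: real \<Rightarrow> real^'n \<Rightarrow> real^'n^'n) t x A.
     (\<lambda>(t, x). F t x) \<in> borel_measurable (borel \<Otimes>\<^sub>M borel) \<longrightarrow> 0 < t \<longrightarrow> 0 \<le> A \<longrightarrow> x \<noteq> 0 \<or> (0::real) = 0 \<longrightarrow>
     (\<forall>\<tau> y k l. 0 < \<tau> \<longrightarrow> \<tau> < t \<longrightarrow> y \<noteq> 0 \<longrightarrow> \<bar>F \<tau> y $ k $ l\<bar> \<le> A * norm y powr - \<alpha> * \<tau> powr - (1 - \<alpha> / 2)) \<longrightarrow>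
     duhamel_converges F t x \<and>
     norm (duhamel F t x) \<le> C3 * A * spatial_weight 0 x * t powr (1/2 - (\<alpha> - 0) / 2 - (1 - \<alpha> / 2))"
    by (rule duhamel_bound[of 0 \<alpha> "1 - \<alpha> / 2", where 'n = 'n]) (use assms d2 in auto)
  define C where "C = C1 + C2 + C3"
  have C: "C > 0" "C1 \<le> C" "C2 \<le> C" "C3 \<le> C" using C1(1) C2(1) C3(1) by (auto simp: C_def)
  \<comment> \<open>Fixed before \<open>\<beta>\<close> and \<open>u0\<close> are introduced, hence
    a function of \<alpha> and the dimension alone. The 8 makes the contraction factor
    \<open>4 * C * \<delta>\<close> equal to 1/2.\<close>
  define \<delta> where "\<delta> = 1 / (8 * C)"
  have \<delta>: "\<delta> > 0" "8 * C * \<delta> \<le> 1" using C by (auto simp: \<delta>_def)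
  have e1: "1/2 - (2 * \<alpha> - \<alpha>) / 2 - (1 - \<alpha>) = - ((1 - \<alpha>) / 2)"
    "1/2 - (1 + \<alpha> - 1) / 2 - (1 - \<alpha>) / 2 = 0" "1/2 - (\<alpha> - 0) / 2 - (1 - \<alpha> / 2) = - (1/2)"
    by (simp_all add: diff_divide_distrib)
  show ?thesis
  proof (intro exI[of _ \<delta>] conjI allI impI)
    show "\<delta> > 0" by (rule \<delta>)
    fix \<beta> :: real and u0 :: "real^'n \<Rightarrow> real^'n"
    assume \<beta>: "1 \<le> \<beta> \<and> \<beta> < real CARD('n)" and u0: "u0 \<in> weighted_Linf 1 \<inter> weighted_Linf \<beta>"
      and small: "(SUP (x, t) \<in> UNIV \<times> {0<..}. ereal (norm x powr \<alpha> * t powr ((1 - \<alpha>) / 2) * norm (heat t u0 x))) \<le> ereal \<delta>"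
    have u0m: "u0 \<in> borel_measurable lebesgue" using u0 by (simp add: weighted_Linf_def)
    obtain A1 where A1: "A1 \<ge> 0" "AE x in lebesgue. norm (u0 x) \<le> A1 * norm x powr - 1"
      using weighted_Linf_AE_le u0 by blast
    obtain A2 where A2: "A2 \<ge> 0" "AE x in lebesgue. norm (u0 x) \<le> A2 * norm x powr - \<beta>"
      using weighted_Linf_AE_le u0 by blast
    \<comment> \<open>Every order between 1 and \<open>\<beta>\<close> is available: in the unit
      ball the bound of order 1 is the stronger one, outside it the bound of order
      \<open>\<beta>\<close>. The intermediate orders are needed by the decay induction.\<close>
    have heat_weight: "\<exists>L\<ge>0. \<forall>t x. 0 < t \<longrightarrow> integrable lebesgue (\<lambda>y. heat_kernel t (x - y) *\<^sub>R u0 y) \<and>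
        norm (heat t u0 x) \<le> L * t powr (- b / 2) \<and> (x \<noteq> 0 \<longrightarrow> norm (heat t u0 x) \<le> L * norm x powr - b)"
      if b: "1 \<le> b" "b \<le> \<beta>" for b
    proof -
      have "AE x::real^'n in lebesgue. x \<noteq> 0"
        by (rule AE_completion[OF AE_lborel_singleton])
      with A1(2) A2(2) have AE: "AE x in lebesgue. norm (u0 x) \<le> (A1 + A2) * norm x powr - b"
      proof eventually_elim
        case (elim x)
        have "norm x powr - 1 \<le> norm x powr - b \<or> norm x powr - \<beta> \<le> norm x powr - b"
        proof (cases "norm x \<le> 1")
          case True
          then show ?thesis using b by (intro disjI1 powr_mono') auto
        next
          case False
          then show ?thesis using b by (intro disjI2 powr_mono) auto
        qed
        then have "A1 * norm x powr - 1 \<le> A1 * norm x powr - b \<or> A2 * norm x powr - \<beta> \<le> A2 * norm x powr - b"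
          using A1(1) A2(1) by (blast intro: mult_left_mono)
        moreover have "0 \<le> A1 * norm x powr - b" "0 \<le> A2 * norm x powr - b" using A1(1) A2(1) by auto
        ultimately have "norm (u0 x) \<le> A1 * norm x powr - b + A2 * norm x powr - b"
          using elim(1,2) by linarith
        then show ?case by (simp add: algebra_simps)
      qed
      have "0 \<le> b" "b < real CARD('n)" using b \<beta> by auto
      then obtain C0 where C0: "C0 > 0" "\<forall>(u :: real^'n \<Rightarrow> real^'n) t x A. u \<in> borel_measurable lebesgue \<longrightarrow> 0 < t \<longrightarrow> 0 \<le> A \<longrightarrow>
         (AE y in lebesgue. norm (u y) \<le> A * norm y powr - b) \<longrightarrow>
         integrable lebesgue (\<lambda>y. heat_kernel t (x - y) *\<^sub>R u y) \<and>
         norm (heat t u x) \<le> C0 * A * t powr (- b / 2) \<and>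
         (x \<noteq> 0 \<longrightarrow> norm (heat t u x) \<le> C0 * A * norm x powr - b)"
        by (rule heat_bound[where 'n = 'n])
      have "0 \<le> A1 + A2" using A1(1) A2(1) by simp
      then show ?thesis
        using C0(1) C0(2)[rule_format, OF u0m _ _ AE] by (intro exI[of _ "C0 * (A1 + A2)"]) auto
    qed
    \<comment> \<open>The order \<open>b = 1\<close> supplies the weights \<open>|x|\<close> and
      \<open>sqrt t\<close> at once, with a common constant.\<close>
    obtain M where M: "M \<ge> 0" "\<And>t x. 0 < t \<Longrightarrow> integrable lebesgue (\<lambda>y. heat_kernel t (x - y) *\<^sub>R u0 y)"
      "\<And>t x. 0 < t \<Longrightarrow> norm (heat t u0 x) \<le> M * t powr (- 1 / 2)"
      "\<And>t x. 0 < t \<Longrightarrow> x \<noteq> 0 \<Longrightarrow> norm (heat t u0 x) \<le> M * norm x powr - 1"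
      using heat_weight[of 1] \<beta> by auto
    interpret picard \<alpha> C \<delta> M "\<lambda>t. heat t u0"
    proof unfold_locales
      show "0 < \<alpha>" "\<alpha> < 1" by fact+
      show "0 < C" by (rule C)
      show "0 \<le> \<delta>" "8 * C * \<delta> \<le> 1" using \<delta> by auto
      show "0 \<le> M" by (rule M)
      show "(\<lambda>(t, x). heat t u0 x) \<in> borel_measurable (borel \<Otimes>\<^sub>M borel)"
        using u0m by (rule measurable_heat)
    next
      fix t :: real and x :: "real^'n" assume t: "0 < t" and x: "x \<noteq> 0"
      have "ereal (norm x powr \<alpha> * t powr ((1 - \<alpha>) / 2) * norm (heat t u0 x)) \<le> ereal \<delta>"
        using t by (intro order_trans[OF _ small] SUP_upper2[of "(x, t)"]) auto
      then have "norm x powr \<alpha> * t powr ((1 - \<alpha>) / 2) * norm (heat t u0 x) \<le> \<delta>" by simp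
      then show "norm (heat t u0 x) \<le> \<delta> * norm x powr - \<alpha> * t powr - ((1 - \<alpha>) / 2)"
        using t x by (simp add: powr_minus field_simps)
    next
      show "norm (heat t u0 x) \<le> M * norm x powr - 1" if "0 < t" "x \<noteq> 0" for t x
        using M(4) that by blast
      show "norm (heat t u0 x) \<le> M * t powr - (1/2)" if "0 < t" for t x
        using M(3)[OF that, of x] by simp
    next
      fix F :: "real \<Rightarrow> real^'n \<Rightarrow> real^'n^'n" and t A :: real and x :: "real^'n"
      assume F: "(\<lambda>(t, x). F t x) \<in> borel_measurable (borel \<Otimes>\<^sub>M borel)" and t: "0 < t" and A: "0 \<le> A" and x: "x \<noteq> 0"
        and FA: "\<And>\<tau> y k l. 0 < \<tau> \<Longrightarrow> y \<noteq> 0 \<Longrightarrow> \<bar>F \<tau> y $ k $ l\<bar> \<le> A * norm y powr - (2 * \<alpha>) * \<tau> powr - (1 - \<alpha>)"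
      have "norm (duhamel F t x) \<le> C1 * A * spatial_weight \<alpha> x * t powr - ((1 - \<alpha>) / 2)"
        using C1(2)[rule_format, OF F t A _ FA, of x, THEN conjunct2] x by (simp only: e1) auto
      also have "\<dots> \<le> C * A * spatial_weight \<alpha> x * t powr - ((1 - \<alpha>) / 2)"
        using C A by (intro mult_right_mono) (auto simp: spatial_weight_def)
      finally show "norm (duhamel F t x) \<le> C * A * norm x powr - \<alpha> * t powr - ((1 - \<alpha>) / 2)"
        using assms by (simp add: spatial_weight_def)
    next
      fix F :: "real \<Rightarrow> real^'n \<Rightarrow> real^'n^'n" and t A :: real and x :: "real^'n"
      assume F: "(\<lambda>(t, x). F t x) \<in> borel_measurable (borel \<Otimes>\<^sub>M borel)" and t: "0 < t" and A: "0 \<le> A" and x: "x \<noteq> 0"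
        and FA: "\<And>\<tau> y k l. 0 < \<tau> \<Longrightarrow> y \<noteq> 0 \<Longrightarrow> \<bar>F \<tau> y $ k $ l\<bar> \<le> A * norm y powr - (1 + \<alpha>) * \<tau> powr - ((1 - \<alpha>) / 2)"
      have "norm (duhamel F t x) \<le> C2 * A * spatial_weight 1 x * t powr 0"
        using C2(2)[rule_format, OF F t A _ FA, of x, THEN conjunct2] x by (simp only: e1) auto
      also have "\<dots> \<le> C * A * spatial_weight 1 x * t powr 0"
        using C A by (intro mult_right_mono) (auto simp: spatial_weight_def)
      finally show "norm (duhamel F t x) \<le> C * A * norm x powr - 1"
        using t by (simp add: spatial_weight_def)
    next
      fix F :: "real \<Rightarrow> real^'n \<Rightarrow> real^'n^'n" and t A :: real and x :: "real^'n"
      assume F: "(\<lambda>(t, x). F t x) \<in> borel_measurable (borel \<Otimes>\<^sub>M borel)" and t: "0 < t" and A: "0 \<le> A"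
        and FA: "\<And>\<tau> y k l. 0 < \<tau> \<Longrightarrow> y \<noteq> 0 \<Longrightarrow> \<bar>F \<tau> y $ k $ l\<bar> \<le> A * norm y powr - \<alpha> * \<tau> powr - (1 - \<alpha> / 2)"
      have *: "duhamel_converges F t x \<and> norm (duhamel F t x) \<le> C3 * A * spatial_weight 0 x * t powr - (1/2)"
        using C3(2)[rule_format, OF F t A _ FA, of x] by (simp only: e1) auto
      have "C3 * A * t powr - (1/2) \<le> C * A * t powr - (1/2)"
        using C A by (intro mult_right_mono) auto
      then show "duhamel_converges F t x \<and> norm (duhamel F t x) \<le> C * A * t powr - (1/2)"
        using * by (simp add: spatial_weight_def)
    qed
    let ?W = solution
    \<comment> \<open>Only the value at time 0 is changed. The Duhamel integral runs over the open
      interval \<open>{0<..<t}\<close> and does not see it.\<close>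
    define u where "u t = (if t = 0 then u0 else ?W t)" for t
    have u_pos: "u t = ?W t" if "0 < t" for t using that by (simp add: u_def)
    have W: "(\<lambda>(t, x). ?W t x) \<in> borel_measurable (borel \<Otimes>\<^sub>M borel)"
      "\<And>t x. 0 < t \<Longrightarrow> x \<noteq> 0 \<Longrightarrow> norm (?W t x) \<le> 2 * M * norm x powr - 1"
      "\<And>t x. 0 < t \<Longrightarrow> norm (?W t x) \<le> 2 * M * t powr - (1/2)"
      using admissible_solution by (auto simp: admissible_def)
    show "\<exists>u. mild_solution \<infinity> u0 u \<and>
      (SUP (x, t) \<in> UNIV \<times> {0<..}. ereal ((norm x + sqrt t) * norm (u t x))) < \<infinity> \<and>
      (\<forall>T>0. (SUP (x, t) \<in> UNIV \<times> {0<..<T}. ereal (norm x powr \<beta> * norm (u t x))) < \<infinity>)"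
    proof (intro exI[of _ u] conjI allI impI)
      show "mild_solution \<infinity> u0 u"
        unfolding mild_solution_def
      proof (intro conjI allI impI ballI)
        show "u 0 = u0" by (simp add: u_def)
        have "(\<lambda>(t, x). ?W t x) \<in> borel_measurable lebesgue"
          using W(1) by (intro measurable_completion) (simp add: borel_prod)
        then have "(\<lambda>(t, x). ?W t x) \<in> borel_measurable (lebesgue_on ({t. 0 < t \<and> ereal t \<le> \<infinity>} \<times> UNIV))"
          by (rule measurable_restrict_space1)
        also have "?this \<longleftrightarrow> (\<lambda>(t, x). u t x) \<in> borel_measurable (lebesgue_on ({t. 0 < t \<and> ereal t \<le> \<infinity>} \<times> UNIV))"
          by (intro measurable_cong) (auto simp: u_pos)
        finally show "(\<lambda>(t, x). u t x) \<in> borel_measurable (lebesgue_on ({t. 0 < t \<and> ereal t \<le> \<infinity>} \<times> UNIV))" .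
        fix t :: real and x :: "real^'n" assume "0 < t \<and> ereal t \<le> \<infinity>"
        then have t: "0 < t" by simp
        show "integrable lebesgue (\<lambda>y. heat_kernel t (x - y) *\<^sub>R u0 y)" using t by (rule M)
        have q: "(\<lambda>y. tensor (u \<tau> y) (u \<tau> y)) = quadratic ?W \<tau>" if "\<tau> \<in> {0<..<t}" for \<tau>
          using that by (simp add: fun_eq_iff quadratic_def u_pos)
        have conv: "duhamel_converges (quadratic ?W) t x"
          using admissible_solution t by (rule duhamel_quadratic_sup)
        show "oseen_converges (t - \<tau>) (\<lambda>y. tensor (u \<tau> y) (u \<tau> y)) x" if "\<tau> \<in> {0<..<t}" for \<tau>
          using conv that unfolding q[OF that] duhamel_converges_def by blast
        have "set_integrable lebesgue {0<..<t} (\<lambda>\<tau>. oseen (t - \<tau>) (\<lambda>y. tensor (u \<tau> y) (u \<tau> y)) x)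
            = set_integrable lebesgue {0<..<t} (\<lambda>\<tau>. oseen (t - \<tau>) (quadratic ?W \<tau>) x)"
          by (intro set_integrable_cong refl) (simp add: q)
        then show "set_integrable lebesgue {0<..<t} (\<lambda>\<tau>. oseen (t - \<tau>) (\<lambda>y. tensor (u \<tau> y) (u \<tau> y)) x)"
          using conv unfolding duhamel_converges_def by blast
        have "(LINT \<tau>:{0<..<t}|lebesgue. oseen (t - \<tau>) (\<lambda>y. tensor (u \<tau> y) (u \<tau> y)) x) = duhamel (quadratic ?W) t x"
          unfolding duhamel_def by (intro set_lebesgue_integral_cong) (auto simp: q)
        then show "u t x = heat t u0 x - (LINT \<tau>:{0<..<t}|lebesgue. oseen (t - \<tau>) (\<lambda>y. tensor (u \<tau> y) (u \<tau> y)) x)"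
          using solution_eq[OF t, of x] t by (simp add: u_pos)
      qed
    next
      show "(SUP (x, t) \<in> UNIV \<times> {0<..}. ereal ((norm x + sqrt t) * norm (u t x))) < \<infinity>"
      proof (rule SUP_prod_less_infinity[where K = "4 * M"])
        fix x :: "real^'n" and t :: real assume "t \<in> {0<..}"
        then have t: "0 < t" by simp
        have "norm x * norm (?W t x) \<le> 2 * M"
          using W(2)[OF t, of x] M(1) by (cases "x = 0") (simp_all add: powr_minus field_simps)
        moreover have "sqrt t * norm (?W t x) \<le> 2 * M"
          using W(3)[OF t, of x] t by (simp add: powr_minus powr_half_sqrt field_simps)
        ultimately show "(norm x + sqrt t) * norm (u t x) \<le> 4 * M"
          unfolding u_pos[OF t] distrib_right by linarith
      qed
    next
      fix T :: real assume T: "0 < T"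
      \<comment> \<open>Doubling is capped at \<open>\<beta>\<close>, which keeps every order below
        the dimension and within the decay of the heat evolution; since
        \<open>\<beta> < 2 ^ n\<close> for some \<open>n\<close>, finitely many steps reach
        \<open>\<beta>\<close>.\<close>
      have "\<exists>K\<ge>0. \<forall>t x. 0 < t \<longrightarrow> t < T \<longrightarrow> x \<noteq> 0 \<longrightarrow> norm (?W t x) \<le> K * norm x powr - min (2 ^ n) \<beta>" for n
      proof (induction n)
        case 0
        show ?case using W(2) M(1) \<beta> by (intro exI[of _ "2 * M"]) (auto simp: min_def)
      next
        case (Suc n)
        then obtain K where K: "K \<ge> 0" "\<And>t x. 0 < t \<Longrightarrow> t < T \<Longrightarrow> x \<noteq> 0 \<Longrightarrow> norm (?W t x) \<le> K * norm x powr - min (2 ^ n) \<beta>"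
          by blast
        have b: "1 \<le> min (2 ^ Suc n) \<beta>" "min (2 ^ Suc n) \<beta> \<le> 2 * min (2 ^ n) \<beta>" "min (2 ^ Suc n) \<beta> < real CARD('n)" "min (2 ^ Suc n) \<beta> \<le> \<beta>"
          using \<beta> one_le_power[of "2::real" "Suc n"] by (auto simp: min_def)
        obtain L where L: "\<And>t x. 0 < t \<Longrightarrow> x \<noteq> 0 \<Longrightarrow> norm (heat t u0 x) \<le> L * norm x powr - min (2 ^ Suc n) \<beta>"
          using heat_weight[OF b(1,4)] by blast
        show ?case
          using M(1) by (intro weight_improvement[OF W(1) solution_eq _ W(2,3) L K(1) T K(2) b(1-3)]) auto
      qed
      moreover obtain n where "\<beta> < 2 ^ n"
        using real_arch_pow[of 2 \<beta>] by auto
      then have "min (2 ^ n) \<beta> = \<beta>" by simp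
      ultimately obtain K where K: "K \<ge> 0" "\<And>t x. 0 < t \<Longrightarrow> t < T \<Longrightarrow> x \<noteq> 0 \<Longrightarrow> norm (?W t x) \<le> K * norm x powr - \<beta>"
        by metis
      show "(SUP (x, t) \<in> UNIV \<times> {0<..<T}. ereal (norm x powr \<beta> * norm (u t x))) < \<infinity>"
      proof (rule SUP_prod_less_infinity[where K = K])
        fix x :: "real^'n" and t :: real assume "t \<in> {0<..<T}"
        then show "norm x powr \<beta> * norm (u t x) \<le> K"
          using K(2)[of t x] K(1) by (cases "x = 0") (simp_all add: u_pos powr_minus field_simps)
      qed
    qed
  qed
qed

end
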